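(* Let $M\simeq\mathbb Z^d$ be a lattice, let $\square\subset M_{\mathbb R}$ be a compact convex set of dimension $d$. Let $w$ be the lattice width of $\square$ with respect to $M$. (a) If $w>d^2$, then $M\cap\mathrm{int}\,\square\ne\emptyset$. (b) If $w>d(d+1)$, then $\dim(M\cap\mathrm{int}\,\square)=d$. (c) If $w>2d^2$, then $M\cap\mathrm{int}\,\square$ spans $M$. (d) $\sqrt[d]{d!\,|M\cap\mathrm{int}\,\square|}\ge\frac{w}{d}-d$. (e) $\sqrt[d]{d!\,\mathrm{vol}_M(\square)}\ge\frac{w}{d}$.
   Context: $M_{\mathbb R}=M\otimes_{\mathbb Z}\mathbb R$. The lattice width of a compact convex set $\square\subset M_{\mathbb R}$ is the smallest length of an interval $\varphi(\square)$, over all $\varphi\in\mathrm{Hom}_{\mathbb Z}(M,\mathbb Z)\setminus0$. For a subset $A\subseteq M_{\mathbb R}$, $\dim(A)$ is the dimension of the $\mathbb R$-vector space generated by $A-A=\{a'-a:a,a'\in A\}$. A subset $A\subseteq M$ spans the lattice $M$ if $A-A$ generates $M$ as a lattice (abelian group). $\mathrm{int}$ denotes the interior, $|\cdot|$ the cardinality, and $\mathrm{vol}_M$ is the Lebesgue measure on $M_{\mathbb R}$ normalized so that a fundamental parallelepiped of $M$ has volume $1$. *)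

theory Defs
  imports "HOL-Analysis.Analysis" "HOL-Computational_Algebra.Group_Closure"
begin

(* A lattice M of rank d is modelled as a full-rank lattice in its own realification
   'a = M \<otimes> \<real>, with d = DIM('a): M is the subgroup generated by an \<real>-basis B of 'a.
   The inner product of 'a plays no role. Every Euclidean space has DIM('a) \<ge> 1. *)

definition lattice_basis :: "'a::euclidean_space set \<Rightarrow> 'a set \<Rightarrow> bool" where
  "lattice_basis B M \<longleftrightarrow> independent B \<and> span B = UNIV \<and> M = group_closure B"

(* Hom(M, \<int>): a homomorphism M \<rightarrow> \<int> is represented by its unique \<real>-linear extension to
   'a. The zero homomorphism corresponds to the zero functional, since M spans 'a. *)

definition lattice_dual :: "'a::euclidean_space set \<Rightarrow> ('a \<Rightarrow> real) set" where
  "lattice_dual M = {\<phi>. linear \<phi> \<and> \<phi> ` M \<subseteq> \<int>}"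

(* For S nonempty, compact and convex, \<phi> ` S is the interval from Inf (\<phi> ` S) to
   Sup (\<phi> ` S). The outer infimum is the minimum whenever S has nonempty interior. *)

definition lattice_width :: "'a::euclidean_space set \<Rightarrow> 'a set \<Rightarrow> real" where
  "lattice_width M S = (INF \<phi> \<in> lattice_dual M - {\<lambda>_. 0}. Sup (\<phi> ` S) - Inf (\<phi> ` S))"

(* The set of differences A - A; the notation A - A itself denotes set difference. *)

definition differences :: "'a::ab_group_add set \<Rightarrow> 'a set" where
  "differences A = {a' - a | a a'. a \<in> A \<and> a' \<in> A}"

(* The library's dim X is the dimension of the linear span of X. *)

definition dim_set :: "'a::euclidean_space set \<Rightarrow> nat" where
  "dim_set A = dim (differences A)"

definition spans_lattice :: "'a::ab_group_add set \<Rightarrow> 'a set \<Rightarrow> bool" where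
  "spans_lattice A M \<longleftrightarrow> A \<subseteq> M \<and> group_closure (differences A) = M"

definition fundamental_parallelepiped :: "'a::euclidean_space set \<Rightarrow> 'a set" where
  "fundamental_parallelepiped B =
    {\<Sum>b\<in>B. c b *\<^sub>R b | c. \<forall>b\<in>B. 0 \<le> c b \<and> c b < 1}"

(* Lebesgue measure rescaled so that the fundamental parallelepiped of the basis B gets
   volume 1. It depends only on the lattice generated by B, as two bases of a lattice
   differ by a unimodular matrix. *)

definition lattice_volume :: "'a::euclidean_space set \<Rightarrow> 'a set \<Rightarrow> real" where
  "lattice_volume B S =
    measure lebesgue S / measure lebesgue (fundamental_parallelepiped B)"

end

theory Submission
  imports Defs "HOL-Probability.Distributions" "HOL-Complex_Analysis.Complex_Analysis"
begin

text \<open>Let \<open>C = S - S\<close>. The Bourgain-Milman inequality with Kuperberg's constant, proved by a Gaussian integral and a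
  holomorphic rotation, bounds the volume product of a \<open>j\<close>-dimensional projection of \<open>C\<close> and its polar. Packing
  the quotient lattice and its dual then shows that the quotient lattice has a nonzero vector of gauge less than
  \<open>j / w\<close> if \<open>j \<ge> 2\<close>; for \<open>j = 1\<close> this holds by definition of the width. Inductively one finds a basis
  \<open>v 0, ..., v (d-1)\<close> of \<open>M\<close> and chords \<open>b k - a k\<close> of \<open>S\<close> equal to \<open>l k * v k\<close> modulo the earlier \<open>v i\<close>, with
  \<open>l k \<ge> w / (d - k)\<close>. The parallelepiped of the vectors \<open>u k = (b k - a k) / l k\<close> is a fundamental domain of \<open>M\<close>,
  and since \<open>1 / l 0 + ... + 1 / l (d-1) \<le> d (d + 1) / (2 w)\<close>, translates of it and of its dilates fit into the
  interior of \<open>S\<close>. This yields (a), (b), (d) and (e); for (c) it shows that the translates of half the interior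
  by \<open>M\<close> cover the space, which is connected.\<close>

text \<open>Origin of the constant: if t is the least gauge of a nonzero vector of the rank-j
  quotient, packing gives (t w \<pi>)^j <= 4^j j!, and j! <= ((j + 1) / 2)^j turns this into t w
  \<pi> <= 2 (j + 1), which is less than j \<pi> once j >= 2. A volume product of only 4^j / (j!)^2
  would bound t w merely by a quantity of order j^2. Obstacle: the dimension is fixed by the type,
  but the quotients have every rank j <= d. They are therefore never formed. \<open>A\<close> is a
  set of coordinate vectors standing for the directions already used, the gauges depend on the
  remaining coordinates only, and the \<open>A\<close>-coordinates carry the identity field, whose
  Gaussian factors cancel at the end. In the Gaussian part \<open>F\<close> maps a pair (x, y) to (x
  + y, g x - g y). The weight exp (- (q x + q y) / 2) is at most exp (- \<Theta>) taken at the image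
  point, whereas the pairing of the two components of the image makes no reference to
  \<open>g\<close>. The rotation links the integrals of these two kinds.\<close>

text \<open>The library states determinants and changes of variables only for \<open>real^'n\<close>; this index type transports
  them to an arbitrary Euclidean space.\<close>

typedef (overloaded) 'a dimidx = "{..<DIM('a::euclidean_space)}"
  by (rule exI[of _ 0]) simp
instantiation dimidx :: (euclidean_space) wellorder
begin
definition less_eq_dimidx :: "'a dimidx \<Rightarrow> 'a dimidx \<Rightarrow> bool" where
  "less_eq_dimidx x y \<longleftrightarrow> Rep_dimidx x \<le> Rep_dimidx y"
definition less_dimidx :: "'a dimidx \<Rightarrow> 'a dimidx \<Rightarrow> bool" where
  "less_dimidx x y \<longleftrightarrow> Rep_dimidx x < Rep_dimidx y"
instance
proof
  fix x y z :: "'a dimidx" and P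
  show "(x < y) = (x \<le> y \<and> \<not> y \<le> x)" "x \<le> x" "x \<le> y \<Longrightarrow> y \<le> z \<Longrightarrow> x \<le> z"
    "x \<le> y \<Longrightarrow> y \<le> x \<Longrightarrow> x = y" "x \<le> y \<or> y \<le> x"
    by (auto simp: less_eq_dimidx_def less_dimidx_def Rep_dimidx_inject)
  assume *: "\<And>x::'a dimidx. (\<And>y. y < x \<Longrightarrow> P y) \<Longrightarrow> P x"
  show "P x"
    by (induction x rule: measure_induct_rule[of Rep_dimidx]) (auto intro: * simp: less_dimidx_def)
qed
end
instance dimidx :: (euclidean_space) finite
proof
  have "(UNIV :: 'a dimidx set) = Abs_dimidx ` {..<DIM('a)}"
    by (metis type_definition.univ type_definition_dimidx)
  then show "finite (UNIV :: 'a dimidx set)"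
    by (metis finite_imageI finite_lessThan)
qed

lemma card_dimidx: "CARD('a::euclidean_space dimidx) = DIM('a)"
  by (metis card_lessThan type_definition.card type_definition_dimidx)

lemma ex_dimidx_basis: "\<exists>e. bij_betw e (UNIV :: 'a::euclidean_space dimidx set) (Basis :: 'a set)"
  by (simp add: bij_betw_iff_card card_dimidx)

definition dbasis :: "'a::euclidean_space dimidx \<Rightarrow> 'a" where
  "dbasis = (SOME e. bij_betw e UNIV Basis)"

lemma bij_dbasis: "bij_betw dbasis UNIV (Basis :: 'a::euclidean_space set)"
  unfolding dbasis_def using someI_ex[OF ex_dimidx_basis] .

definition to_vec :: "'a::euclidean_space \<Rightarrow> real^('a dimidx)" where
  "to_vec x = (\<chi> i. x \<bullet> dbasis i)"

definition of_vec :: "real^('a dimidx) \<Rightarrow> 'a::euclidean_space" where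
  "of_vec v = (\<Sum>i\<in>UNIV. v $ i *\<^sub>R dbasis i)"

lemma dbasis_Basis [simp]: "dbasis i \<in> Basis"
  using bij_dbasis by (auto simp: bij_betw_def)

lemma inner_dbasis: "dbasis i \<bullet> dbasis j = (if i = j then 1 else 0)"
  using bij_dbasis by (auto simp: inner_Basis bij_betw_def inj_on_def)

lemma to_vec_of_vec [simp]: "to_vec (of_vec v) = v"
  by (simp add: to_vec_def of_vec_def vec_eq_iff inner_sum_left inner_dbasis if_distrib cong: if_cong)

lemma of_vec_to_vec [simp]: "of_vec (to_vec x) = x"
proof -
  have "of_vec (to_vec x) = (\<Sum>b\<in>Basis. (x \<bullet> b) *\<^sub>R b)"
    unfolding to_vec_def of_vec_def using sum.reindex_bij_betw[OF bij_dbasis, of "\<lambda>b. (x \<bullet> b) *\<^sub>R b"] by simp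
  then show ?thesis by (simp add: euclidean_representation)
qed

lemma linear_to_vec: "linear to_vec"
  by (rule linearI) (auto simp: to_vec_def vec_eq_iff inner_add_left)

lemma linear_of_vec: "linear of_vec"
  by (rule linearI) (auto simp: of_vec_def sum.distrib scaleR_add_left scaleR_sum_right)

lemma inner_to_vec: "to_vec x \<bullet> to_vec y = x \<bullet> y"
proof -
  have "to_vec x \<bullet> to_vec y = (\<Sum>b\<in>Basis. (x \<bullet> b) * (y \<bullet> b))"
    unfolding to_vec_def inner_vec_def 
    using sum.reindex_bij_betw[OF bij_dbasis, of "\<lambda>b. (x \<bullet> b) * (y \<bullet> b)"] by simp
  then show ?thesis by (simp add: euclidean_inner[symmetric])
qed

lemma to_vec_image: "to_vec ` S = of_vec -` S"
  by (auto simp: image_iff) (metis to_vec_of_vec)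

lemma continuous_to_vec: "continuous_on S to_vec" and continuous_of_vec: "continuous_on T of_vec"
  using linear_to_vec linear_of_vec linear_continuous_on linear_linear by blast+

lemma measurable_of_vec [measurable]: "of_vec \<in> borel_measurable borel"
  using continuous_of_vec by (auto intro: borel_measurable_continuous_onI)

lemma distr_of_vec: "distr lborel borel (of_vec :: real^('a dimidx) \<Rightarrow> 'a::euclidean_space) = lborel"
proof (rule lborel_eqI[symmetric])
  fix l u :: 'a assume lu: "\<And>b. b \<in> Basis \<Longrightarrow> l \<bullet> b \<le> u \<bullet> b"
  have R: "(\<forall>b\<in>Basis. P b) \<longleftrightarrow> (\<forall>i. P (dbasis i))" for P :: "'a \<Rightarrow> bool"
    using bij_dbasis unfolding bij_betw_def by (metis (no_types) dbasis_Basis rangeE)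
  have e: "of_vec -` box l u = box (to_vec l) (to_vec u)"
    unfolding to_vec_image[symmetric]
  proof (intro set_eqI iffI)
    fix v :: "real^('a dimidx)"
    assume "v \<in> to_vec ` box l u" then show "v \<in> box (to_vec l) (to_vec u)"
      unfolding mem_box_cart by (auto simp: mem_box to_vec_def)
  next
    fix v assume "v \<in> box (to_vec l) (to_vec u)"
    then have "of_vec v \<in> box l u"
    proof -
      have "of_vec v \<bullet> dbasis i = v $ i" for i
        using to_vec_of_vec[of v] by (simp add: to_vec_def vec_eq_iff)
      moreover have "\<forall>i. to_vec l $ i < v $ i \<and> v $ i < to_vec u $ i"
        using \<open>v \<in> box (to_vec l) (to_vec u)\<close> unfolding mem_box_cart .
      ultimately show ?thesis unfolding mem_box R by (simp add: to_vec_def)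
    qed
    then show "v \<in> to_vec ` box l u" by (metis image_eqI to_vec_of_vec)
  qed
  have "emeasure (distr lborel borel of_vec) (box l u) = emeasure lborel (box (to_vec l) (to_vec u))"
    by (subst emeasure_distr) (auto simp: e measurable_of_vec)
  also have "\<dots> = ennreal (\<Prod>b\<in>Basis. (to_vec u - to_vec l) \<bullet> b)"
    by (rule emeasure_lborel_box) (auto simp: Basis_vec_def inner_axis to_vec_def lu)
  also have "(\<Prod>b\<in>Basis. (to_vec u - to_vec l) \<bullet> b) = (\<Prod>i\<in>UNIV. (u - l) \<bullet> dbasis i)"
  proof -
    have "bij_betw (\<lambda>i::'a dimidx. axis i (1::real)) UNIV Basis"
      by (auto simp: bij_betw_def inj_on_def Basis_vec_def axis_eq_axis)
    from prod.reindex_bij_betw[OF this, of "\<lambda>b. (to_vec u - to_vec l) \<bullet> b"]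
    show ?thesis by (simp add: inner_axis to_vec_def inner_diff_left)
  qed
  also have "\<dots> = (\<Prod>b\<in>Basis. (u - l) \<bullet> b)"
    using prod.reindex_bij_betw[OF bij_dbasis, of "\<lambda>b. (u - l) \<bullet> b"] .
  finally show "emeasure (distr lborel borel of_vec) (box l u) = ennreal (\<Prod>b\<in>Basis. (u - l) \<bullet> b)" .
qed simp

lemma to_vec_borel: "S \<in> sets borel \<Longrightarrow> to_vec ` S \<in> sets borel"
  unfolding to_vec_image using measurable_sets[OF measurable_of_vec, of S] by simp

lemma emeasure_to_vec:
  assumes "S \<in> sets borel" shows "emeasure lborel (to_vec ` S) = emeasure lborel S"
proof -
  have "emeasure lborel S = emeasure (distr lborel borel of_vec) S" by (simp add: distr_of_vec)
  also have "\<dots> = emeasure lborel (to_vec ` S)"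
    using assms by (subst emeasure_distr) (auto simp: to_vec_image measurable_of_vec)
  finally show ?thesis by simp
qed

section \<open>Volumes under linear and differentiable maps\<close>

definition unit_cube :: "'a::euclidean_space set" where "unit_cube = cbox 0 One"

lemma emeasure_unit_cube: "emeasure lborel (unit_cube :: 'a::euclidean_space set) = 1"
  unfolding unit_cube_def by (subst emeasure_lborel_cbox) auto

lemma unit_cube_borel [measurable]: "unit_cube \<in> sets borel"
  by (simp add: unit_cube_def)

definition lin_vec :: "('a::euclidean_space \<Rightarrow> 'a) \<Rightarrow> real^('a dimidx) \<Rightarrow> real^('a dimidx)" where
  "lin_vec f = to_vec \<circ> f \<circ> of_vec"

lemma linear_lin_vec: "linear f \<Longrightarrow> linear (lin_vec f)"
  unfolding lin_vec_def by (intro linear_compose linear_to_vec linear_of_vec)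

lemma lin_vec_image: "lin_vec f ` (to_vec ` S) = to_vec ` f ` S"
  by (auto simp: lin_vec_def image_iff)

lemma emeasure_linear_image:
  assumes f: "linear f" "S \<in> sets borel" "f ` S \<in> sets borel" "emeasure lborel S < \<infinity>"
  shows "emeasure lborel (f ` S) = ennreal \<bar>det (matrix (lin_vec f))\<bar> * emeasure lborel S"
proof -
  let ?S = "to_vec ` S"
  have S: "?S \<in> lmeasurable"
    using assms by (simp add: fmeasurable_def to_vec_borel emeasure_to_vec)
  have 1: "lin_vec f ` ?S \<in> lmeasurable" 
    and 2: "measure lebesgue (lin_vec f ` ?S) = \<bar>det (matrix (lin_vec f))\<bar> * measure lebesgue ?S"
    using measurable_linear_image[OF linear_lin_vec[OF f(1)] S] measure_linear_image[OF linear_lin_vec[OF f(1)] S] by auto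
  have "emeasure lborel (f ` S) = emeasure lebesgue (lin_vec f ` ?S)"
    by (simp add: lin_vec_image emeasure_to_vec assms to_vec_borel)
  also have "\<dots> = ennreal (measure lebesgue (lin_vec f ` ?S))"
    using 1 by (simp add: emeasure_eq_measure2 )
  also have "\<dots> = ennreal \<bar>det (matrix (lin_vec f))\<bar> * ennreal (measure lebesgue ?S)"
    unfolding 2 by (simp add: ennreal_mult)
  also have "ennreal (measure lebesgue ?S) = emeasure lborel S"
  proof -
    have "ennreal (measure lebesgue ?S) = emeasure lebesgue ?S"
      using S by (rule emeasure_eq_measure2[symmetric])
    also have "\<dots> = emeasure lborel ?S" using assms by (simp add: to_vec_borel)
    finally show ?thesis using assms by (simp add: emeasure_to_vec)
  qed
  finally show ?thesis .
qed

lemma compact_unit_cube: "compact unit_cube" by (simp add: unit_cube_def)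

lemma emeasure_linear_image_cube:
  assumes "linear f" shows "emeasure lborel (f ` unit_cube) = ennreal \<bar>det (matrix (lin_vec f))\<bar>"
proof -
  have "compact (f ` unit_cube)"
    using assms compact_unit_cube by (metis compact_continuous_image linear_continuous_on linear_linear)
  then show ?thesis
    by (subst emeasure_linear_image[OF assms]) (auto simp: emeasure_unit_cube borel_closed compact_imp_closed)
qed

text \<open>Transposing a matrix keeps its determinant. This makes the covolumes of a lattice and of
  its dual reciprocal in \<open>ldet_dual\<close>.\<close>

lemma emeasure_adjoint_image_cube:
  fixes f :: "'a::euclidean_space \<Rightarrow> 'a"
  assumes "linear f" shows "emeasure lborel (adjoint f ` unit_cube) = emeasure lborel (f ` unit_cube)"
proof -
  have "matrix (lin_vec (adjoint f)) = transpose (matrix (lin_vec f))"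
  proof -
    have "adjoint (lin_vec f) = lin_vec (adjoint f)"
      by (rule adjoint_unique) (metis (no_types, opaque_lifting) adjoint_works assms comp_apply inner_to_vec lin_vec_def of_vec_to_vec to_vec_of_vec)
    then show ?thesis using matrix_adjoint[OF linear_lin_vec[OF assms]] by simp
  qed
  then show ?thesis
    using assms by (simp add: emeasure_linear_image_cube adjoint_linear det_transpose)
qed

lemma has_derivative_lin_vec:
  assumes "(F has_derivative F') (at x within B)"
  shows "(lin_vec F has_derivative lin_vec F') (at (to_vec x) within to_vec ` B)"
proof -
  have 1: "(of_vec has_derivative of_vec) (at (to_vec x) within to_vec ` B)"
    by (rule linear_imp_has_derivative[OF linear_of_vec])
  have i: "of_vec ` to_vec ` B = B" by (force simp: image_iff)
  have 2: "(F has_derivative F') (at (of_vec (to_vec x)) within of_vec ` to_vec ` B)"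
    using assms by (simp add: i)
  have 3: "(to_vec has_derivative to_vec) (at (F (of_vec (to_vec x))) within UNIV)"
    by (rule linear_imp_has_derivative[OF linear_to_vec])
  show ?thesis unfolding lin_vec_def
    using has_derivative_in_compose[OF has_derivative_in_compose[OF 1 2] has_derivative_at_withinI[OF 3]] 
    by (simp add: o_def image_image)
qed

text \<open>The area formula turns both measures into integrals of Jacobian determinants, which
  agree because \<open>L\<close> has determinant 1 or -1. Comparing two images avoids evaluating the
  Jacobian of \<open>F\<close>.\<close>

lemma emeasure_image_compare:
  fixes F G :: "'a::euclidean_space \<Rightarrow> 'a"
  assumes B: "B \<in> sets borel" "F ` B \<in> sets borel" "G ` B \<in> sets borel"
    and F: "\<And>x. x \<in> B \<Longrightarrow> (F has_derivative F' x) (at x within B)" "inj_on F B"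
    and G: "\<And>x. x \<in> B \<Longrightarrow> (G has_derivative F' x \<circ> L) (at x within B)" "inj_on G B"
    and L: "linear L" "emeasure lborel (L ` unit_cube) = 1"
  shows "emeasure lborel (G ` B) = emeasure lborel (F ` B)"
proof -
  let ?B = "to_vec ` B"
  have inj: "inj_on (lin_vec H) ?B" if "inj_on H B" for H :: "'a \<Rightarrow> 'a"
    using that by (auto simp: inj_on_def lin_vec_def) (metis of_vec_to_vec)
  have det: "\<bar>det (matrix (lin_vec (F' x \<circ> L)))\<bar> = \<bar>det (matrix (lin_vec (F' x)))\<bar>" if "x \<in> B" for x
  proof -
    have lF: "linear (F' x)" using F(1)[OF that] has_derivative_linear by blast
    have "lin_vec (F' x \<circ> L) = lin_vec (F' x) \<circ> lin_vec L" by (simp add: lin_vec_def fun_eq_iff)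
    then have "matrix (lin_vec (F' x \<circ> L)) = matrix (lin_vec (F' x)) ** matrix (lin_vec L)"
      by (simp add: matrix_compose linear_lin_vec lF L)
    moreover have "\<bar>det (matrix (lin_vec L))\<bar> = 1"
      using L emeasure_linear_image_cube[OF L(1)] by simp
    ultimately show ?thesis by (simp add: det_mul abs_mult)
  qed
  have m: "lin_vec F ` ?B \<in> lmeasurable \<and> measure lebesgue (lin_vec F ` ?B) = m \<longleftrightarrow>
        lin_vec G ` ?B \<in> lmeasurable \<and> measure lebesgue (lin_vec G ` ?B) = m" for m
  proof -
    have "lin_vec F ` ?B \<in> lmeasurable \<and> measure lebesgue (lin_vec F ` ?B) = m \<longleftrightarrow>
       ((\<lambda>x. \<bar>det (matrix (lin_vec (F' (of_vec x))))\<bar>) has_integral m) ?B"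
      using F(1) by (intro has_measure_differentiable_image) (auto simp: inj F to_vec_borel B has_derivative_lin_vec)
    also have "\<dots> \<longleftrightarrow> ((\<lambda>x. \<bar>det (matrix (lin_vec (F' (of_vec x) \<circ> L)))\<bar>) has_integral m) ?B"
      by (rule has_integral_cong) (auto simp: det)
    also have "\<dots> \<longleftrightarrow> lin_vec G ` ?B \<in> lmeasurable \<and> measure lebesgue (lin_vec G ` ?B) = m"
      using G(1) by (intro has_measure_differentiable_image[symmetric]) (auto simp: inj G to_vec_borel B has_derivative_lin_vec)
    finally show ?thesis .
  qed
  have e: "emeasure lborel (H ` B) = emeasure lebesgue (lin_vec H ` ?B)" if "H ` B \<in> sets borel" for H :: "'a \<Rightarrow> 'a"
    by (simp add: lin_vec_image emeasure_to_vec that to_vec_borel)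
  have s: "lin_vec H ` ?B \<in> sets lebesgue" if "H ` B \<in> sets borel" for H :: "'a \<Rightarrow> 'a"
    by (simp add: lin_vec_image that to_vec_borel)
  show ?thesis
  \<comment> \<open>The equivalence \<open>m\<close> speaks about finite measures only; it also
    shows that if one image has infinite measure, so has the other.\<close>
  proof (cases "lin_vec F ` ?B \<in> lmeasurable")
    case True
    then show ?thesis using m e B by (metis emeasure_eq_measure2)
  next
    case False
    then have "lin_vec G ` ?B \<notin> lmeasurable" using m by blast
    moreover have inf: "emeasure lebesgue X = \<infinity>" if "X \<in> sets lebesgue" "X \<notin> lmeasurable" for X :: "(real^'a dimidx) set"
      using that fmeasurableI[of X lebesgue] by (metis infinity_ennreal_def top.not_eq_extremum)
    ultimately have "emeasure lebesgue (lin_vec G ` ?B) = \<infinity>" "emeasure lebesgue (lin_vec F ` ?B) = \<infinity>"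
      using False s[OF B(2)] s[OF B(3)] inf by blast+
    then show ?thesis unfolding e[OF B(2)] e[OF B(3)] by simp
  qed
qed

lemma mem_unit_cube: "x \<in> unit_cube \<longleftrightarrow> (\<forall>b\<in>Basis. 0 \<le> x \<bullet> b \<and> x \<bullet> b \<le> 1)"
  by (simp add: unit_cube_def mem_box)

lemma norm_Pair_sq: "(norm (a, b))\<^sup>2 = (norm a)\<^sup>2 + (norm b)\<^sup>2"
  by (simp add: norm_Pair)

section \<open>Monotone homogeneous fields\<close>

text \<open>The Jacobian of \<open>F\<close> at \<open>(x, y)\<close> is \<open>\<plusminus> det (Dg x + Dg y)\<close>, and \<open>Dg\<close> is homogeneous of degree 0. Hence the
  conjugate \<open>T \<alpha>\<close> of the scaling \<open>(x, y) \<mapsto> (\<alpha> x, y / \<alpha>)\<close> by \<open>F\<close> preserves Lebesgue measure.\<close>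

locale monotone_field =
  fixes g :: "'a::euclidean_space \<Rightarrow> 'a" and \<delta> :: real and Z :: "'a set"
  assumes delta_pos: "\<delta> > 0"
    and hom: "t > 0 \<Longrightarrow> g (t *\<^sub>R x) = t *\<^sub>R g x"
    and mono: "\<delta> * (norm (x - y))\<^sup>2 \<le> (g x - g y) \<bullet> (x - y)"
    and cont: "continuous_on UNIV g"
    and Z_closed: "closed Z" and Z_negl: "negligible Z"
    and Z_cone: "t > 0 \<Longrightarrow> x \<in> Z \<Longrightarrow> t *\<^sub>R x \<in> Z"
    and diffZ: "g differentiable_on Z"
    and diff: "x \<notin> Z \<Longrightarrow> g differentiable (at x)"
begin

text \<open>When \<open>g\<close> is the gradient of half a squared norm, the first component adds
  vectors and the second subtracts covectors. Their pairing is (q x - q y) / 2 + \<beta> (x, y),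
  which is how \<open>E\<close> at \<open>\<i>\<close> becomes a function of \<open>F p\<close>
  alone.\<close>

definition F :: "'a \<times> 'a \<Rightarrow> 'a \<times> 'a" where
  "F p = (fst p + snd p, g (fst p) - g (snd p))"

definition q :: "'a \<Rightarrow> real" where "q x = 2 * (x \<bullet> g x)"
definition nn :: "'a \<Rightarrow> real" where "nn x = (norm x)\<^sup>2 + (norm (g x))\<^sup>2"

lemma g_0: "g 0 = 0"
  using hom[of 2 0] by (metis scaleR_2 scaleR_zero_right add_cancel_right_right zero_less_numeral)

lemma q_ge: "2 * \<delta> * (norm x)\<^sup>2 \<le> q x"
  using mono[of x 0] by (simp add: q_def g_0 inner_commute)

lemma q_hom: "t > 0 \<Longrightarrow> q (t *\<^sub>R x) = t\<^sup>2 * q x"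
  and nn_hom: "t > 0 \<Longrightarrow> nn (t *\<^sub>R x) = t\<^sup>2 * nn x"
  by (simp_all add: q_def nn_def hom power2_eq_square algebra_simps)

lemma nn_nonneg [simp]: "nn x \<ge> 0"
  by (simp add: nn_def)

lemma g_bound: "\<exists>C>0. \<forall>x. norm (g x) \<le> C * norm x"
proof -
  have "compact (g ` sphere 0 1)"
    by (intro compact_continuous_image continuous_on_subset[OF cont]) auto
  then obtain C where C: "C > 0" "\<And>x. norm x = 1 \<Longrightarrow> norm (g x) \<le> C"
    using bounded_pos[of "g ` sphere 0 1"] compact_imp_bounded by (metis dist_0_norm image_eqI mem_sphere)
  have "norm (g x) \<le> C * norm x" for x
  proof (cases "x = 0")
    case False
    then have "g x = norm x *\<^sub>R g (x /\<^sub>R norm x)" by (subst hom[symmetric]) auto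
    moreover have "norm (g (x /\<^sub>R norm x)) \<le> C" using False by (intro C) auto
    ultimately show ?thesis using False by (simp add: mult.commute)
  qed (simp add: g_0)
  then show ?thesis using C by blast
qed

lemma ex_coercive: "\<exists>c. 0 < c \<and> c \<le> 1 \<and> (\<forall>x. c * nn x \<le> q x)"
proof -
  obtain C where C: "C > 0" "\<And>x. norm (g x) \<le> C * norm x" using g_bound by blast
  define c where "c = min 1 (2 * \<delta> / (1 + C\<^sup>2))"
  have c: "0 < c" "c \<le> 1" using delta_pos by (auto simp: c_def add_pos_nonneg)
  have "c * nn x \<le> q x" for x
  proof -
    have "(norm (g x))\<^sup>2 \<le> C\<^sup>2 * (norm x)\<^sup>2"
      using C(2)[of x] by (metis norm_ge_zero power_mono power_mult_distrib)
    then have "nn x \<le> (1 + C\<^sup>2) * (norm x)\<^sup>2" by (simp add: nn_def algebra_simps)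
    then have "c * nn x \<le> c * ((1 + C\<^sup>2) * (norm x)\<^sup>2)" using c by (simp add: mult_left_mono)
    also have "\<dots> \<le> 2 * \<delta> / (1 + C\<^sup>2) * ((1 + C\<^sup>2) * (norm x)\<^sup>2)"
      by (intro mult_right_mono) (auto simp: c_def)
    also have "\<dots> = 2 * \<delta> * (norm x)\<^sup>2"
      using add_pos_nonneg[of 1 "C\<^sup>2"] by (simp add: field_simps)
    finally show ?thesis using q_ge[of x] by linarith
  qed
  then show ?thesis using c by blast
qed

definition c where "c = (SOME c. 0 < c \<and> c \<le> 1 \<and> (\<forall>x. c * nn x \<le> q x))"

lemma c_pos: "0 < c" and q_coercive: "c * nn x \<le> q x"
  using someI_ex[OF ex_coercive] unfolding c_def[symmetric] by blast+

text \<open>The increments of the two arguments are opposite while those of \<open>g\<close> agree,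
  so the two monotonicity estimates bound a number and its negative from below by nonnegative
  quantities; both must vanish.\<close>

lemma F_inj: "inj F"
proof (rule injI)
  fix p p' assume "F p = F p'"
  then have 1: "fst p - fst p' = - (snd p - snd p')" and 2: "g (fst p) - g (fst p') = g (snd p) - g (snd p')"
    by (auto simp: F_def algebra_simps) 
  have "(g (fst p) - g (fst p')) \<bullet> (fst p - fst p') = - ((g (snd p) - g (snd p')) \<bullet> (snd p - snd p'))"
    unfolding 1 2 by (simp add: inner_diff_right)
  then have "\<delta> * (norm (fst p - fst p'))\<^sup>2 + \<delta> * (norm (snd p - snd p'))\<^sup>2 \<le> 0"
    using mono[of "fst p" "fst p'"] mono[of "snd p" "snd p'"] by linarith
  then have "\<delta> * ((norm (fst p - fst p'))\<^sup>2 + (norm (snd p - snd p'))\<^sup>2) \<le> 0" by (simp add: algebra_simps)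
  then have "(norm (fst p - fst p'))\<^sup>2 + (norm (snd p - snd p'))\<^sup>2 \<le> 0"
    using delta_pos by (simp add: mult_le_0_iff)
  then have "(norm (fst p - fst p'))\<^sup>2 = 0 \<and> (norm (snd p - snd p'))\<^sup>2 = 0"
    by (simp add: sum_power2_le_zero_iff)
  then show "p = p'" by (simp add: prod_eq_iff)
qed

lemma F_cont: "continuous_on UNIV F"
  unfolding F_def by (intro continuous_intros continuous_on_compose2[OF cont]) auto

lemma norm_F: "(norm (F p))\<^sup>2 = nn (fst p) + nn (snd p) + 2 * (fst p \<bullet> snd p - g (fst p) \<bullet> g (snd p))"
  unfolding F_def norm_Pair_sq by (simp add: nn_def power2_norm_eq_inner inner_add_left inner_add_right
      inner_diff_left inner_diff_right inner_commute)

lemma norm_F_le: "(norm (F p))\<^sup>2 \<le> 2 * (nn (fst p) + nn (snd p))"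
proof -
  have "2 * (fst p \<bullet> snd p) \<le> (norm (fst p))\<^sup>2 + (norm (snd p))\<^sup>2"
    using zero_le_power2[of "norm (fst p - snd p)"] by (simp add: power2_norm_eq_inner inner_diff inner_commute)
  moreover have "- 2 * (g (fst p) \<bullet> g (snd p)) \<le> (norm (g (fst p)))\<^sup>2 + (norm (g (snd p)))\<^sup>2"
    using zero_le_power2[of "norm (g (fst p) + g (snd p))"] by (simp add: power2_norm_eq_inner inner_add inner_commute)
  ultimately show ?thesis unfolding norm_F nn_def by (simp add: algebra_simps)
qed

text \<open>Pairing \<open>F p\<close> with \<open>R\<close> = (g x + g y, x - y) gives q x + q y,
  which is coercive, while |F p|^2 + |R|^2 = 2 (nn x + nn y) keeps \<open>R\<close> from being
  large. Cauchy-Schwarz then bounds |F p| from below.\<close>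

lemma norm_F_ge: "c\<^sup>2 / 2 * (nn (fst p) + nn (snd p)) \<le> (norm (F p))\<^sup>2"
proof -
  obtain x y where p: "p = (x, y)" by (cases p)
  define s where "s = nn x + nn y"
  define R where "R = (g x + g y, x - y)"
  have "c * s \<le> q x + q y" using q_coercive[of x] q_coercive[of y] by (simp add: s_def algebra_simps)
  also have "q x + q y = F p \<bullet> R"
    by (simp add: q_def F_def R_def p inner_add inner_diff inner_commute algebra_simps)
  also have "\<dots> \<le> norm (F p) * norm R" by (rule norm_cauchy_schwarz)
  finally have 1: "c * s \<le> norm (F p) * norm R" .
  have "(norm R)\<^sup>2 = 2 * s - (norm (F p))\<^sup>2"
    unfolding norm_F R_def norm_Pair_sq 
    by (simp add: s_def p nn_def power2_norm_eq_inner inner_add inner_diff inner_commute)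
  then have 2: "(norm R)\<^sup>2 \<le> 2 * s" by simp
  have s: "s \<ge> 0" by (simp add: s_def)
  have "(c * s)\<^sup>2 \<le> (norm (F p))\<^sup>2 * (norm R)\<^sup>2"
    using power_mono[OF 1, of 2] c_pos s by (simp add: power_mult_distrib)
  also have "\<dots> \<le> (norm (F p))\<^sup>2 * (2 * s)" using 2 by (simp add: mult_left_mono)
  finally have "s * (c\<^sup>2 / 2 * s) \<le> s * (norm (F p))\<^sup>2" by (simp add: power2_eq_square algebra_simps)
  then have "c\<^sup>2 / 2 * s \<le> (norm (F p))\<^sup>2"
    using s by (cases "s = 0") auto
  then show ?thesis by (simp add: s_def p)
qed

text \<open>The range is open by invariance of domain, and closed because \<open>norm_F_ge\<close>
  makes \<open>F\<close> proper; the target is connected.\<close>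

lemma F_surj: "surj F"
proof -
  have op: "open (range F)"
    by (rule invariance_of_domain[OF F_cont open_UNIV F_inj])
  have cl: "closed (range F)"
    unfolding closed_sequential_limits
  proof (intro allI impI, elim conjE)
    fix Y y assume Y: "\<forall>n. Y n \<in> range F" and lim: "Y \<longlonglongrightarrow> y"
    from Y have "\<forall>n. \<exists>x. Y n = F x" by blast
    then obtain X where X: "\<And>n. Y n = F (X n)" by metis
    have "bounded (range Y)" using lim convergent_imp_bounded by blast
    then obtain K where K: "\<And>n. norm (F (X n)) \<le> K" unfolding bounded_iff X by auto
    have "norm (X n) \<le> sqrt (2 / c\<^sup>2 * K\<^sup>2)" for n
    proof -
      have "(norm (X n))\<^sup>2 \<le> nn (fst (X n)) + nn (snd (X n))"
        by (simp add: nn_def norm_prod_def)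
      also have "\<dots> = 2 / c\<^sup>2 * (c\<^sup>2 / 2 * (nn (fst (X n)) + nn (snd (X n))))" using c_pos by simp
      also have "\<dots> \<le> 2 / c\<^sup>2 * (norm (F (X n)))\<^sup>2" by (intro mult_left_mono norm_F_ge) auto
      also have "\<dots> \<le> 2 / c\<^sup>2 * K\<^sup>2" by (intro mult_left_mono power_mono K) auto
      finally show ?thesis by (rule real_le_rsqrt)
    qed
    then have "bounded (range X)" unfolding bounded_iff by auto
    then obtain l r where r: "strict_mono r" "(X \<circ> r) \<longlonglongrightarrow> l"
      using bounded_imp_convergent_subsequence by blast
    have "(\<lambda>n. F ((X \<circ> r) n)) \<longlonglongrightarrow> F l"
      using continuous_on_tendsto_compose[OF F_cont r(2)] by simp
    moreover have "(\<lambda>n. F ((X \<circ> r) n)) \<longlonglongrightarrow> y"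
      using LIMSEQ_subseq_LIMSEQ[OF lim r(1)] by (simp add: X o_def)
    ultimately have "y = F l" using LIMSEQ_unique by blast
    then show "y \<in> range F" by blast
  qed
  show ?thesis using op cl clopen by blast
qed

definition H where "H = inv F"

lemma F_H [simp]: "F (H z) = z" and H_F [simp]: "H (F p) = p"
  using F_inj F_surj by (auto simp: H_def surj_f_inv_f)

lemma H_cont: "continuous_on UNIV H"
proof -
  obtain G where "homeomorphism UNIV (range F) F G"
    using invariance_of_domain_homeomorphism[OF open_UNIV F_cont] F_inj by auto
  then have "continuous_on UNIV G" "\<And>z. G (F z) = z"
    using F_surj unfolding homeomorphism_def by auto
  moreover have "G = H" using calculation(2) by (metis F_H ext)
  ultimately show ?thesis by simp
qed

lemma H_measurable [measurable]: "H \<in> borel_measurable borel"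
  and F_measurable [measurable]: "F \<in> borel_measurable borel"
  using H_cont F_cont by (auto intro: borel_measurable_continuous_onI)

definition Lam :: "real \<Rightarrow> 'a \<times> 'a \<Rightarrow> 'a \<times> 'a" where
  "Lam \<alpha> p = (\<alpha> *\<^sub>R fst p, (1/\<alpha>) *\<^sub>R snd p)"

lemma Lam_Lam: "\<alpha> > 0 \<Longrightarrow> Lam \<alpha> (Lam (1/\<alpha>) p) = p"
  by (simp add: Lam_def)

lemma linear_Lam: "linear (Lam \<alpha>)"
  by (rule linearI) (auto simp: Lam_def algebra_simps)

lemma emeasure_Lam_cube: 
  assumes "\<alpha> > 0" shows "emeasure lborel (Lam \<alpha> ` unit_cube) = 1"
proof -
  have 1: "Lam \<alpha> ` unit_cube = cbox 0 (\<alpha> *\<^sub>R One) \<times> cbox 0 ((1/\<alpha>) *\<^sub>R One)"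
  proof (intro set_eqI iffI)
    fix p :: "'a \<times> 'a" assume "p \<in> Lam \<alpha> ` unit_cube"
    then show "p \<in> cbox 0 (\<alpha> *\<^sub>R One) \<times> cbox 0 ((1/\<alpha>) *\<^sub>R One)" using assms
      by (auto simp: Lam_def mem_unit_cube mem_box Basis_prod_def ball_Un divide_right_mono)
  next
    fix p :: "'a \<times> 'a" assume p: "p \<in> cbox 0 (\<alpha> *\<^sub>R One) \<times> cbox 0 ((1/\<alpha>) *\<^sub>R One)"
    have "Lam (1/\<alpha>) p \<in> unit_cube" using p assms
      by (auto simp: Lam_def mem_unit_cube mem_box Basis_prod_def ball_Un field_simps)
    then show "p \<in> Lam \<alpha> ` unit_cube" by (metis Lam_Lam assms image_eqI)
  qed
  have "emeasure lborel (Lam \<alpha> ` unit_cube) = 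
      emeasure lborel (cbox 0 (\<alpha> *\<^sub>R One) :: 'a set) * emeasure lborel (cbox 0 ((1/\<alpha>) *\<^sub>R One) :: 'a set)"
    unfolding 1 lborel_prod[symmetric] by (rule lborel.emeasure_pair_measure_Times) auto
  also have "\<dots> = ennreal (\<alpha> ^ DIM('a)) * ennreal ((1/\<alpha>) ^ DIM('a))"
    using assms by (subst (1 2) emeasure_lborel_cbox) auto
  also have "\<dots> = 1" using assms by (simp add: ennreal_mult[symmetric] power_divide)
  finally show ?thesis .
qed

definition T where "T \<alpha> = F \<circ> Lam \<alpha> \<circ> H"

definition Sreg :: "('a \<times> 'a) set" where "Sreg = (- Z) \<times> (- Z)"

lemma Lam_Sreg: 
  assumes "\<alpha> > 0" shows "Lam \<alpha> ` Sreg = Sreg"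
proof -
  have "Lam \<beta> p \<in> Sreg" if "\<beta> > 0" "p \<in> Sreg" for \<beta> p
  proof -
    have *: "t *\<^sub>R x \<notin> Z" if "x \<notin> Z" "t > 0" for t x
      using Z_cone[of "1/t" "t *\<^sub>R x"] that by auto
    show ?thesis using that by (auto simp: Sreg_def Lam_def *)
  qed
  then show ?thesis using assms Lam_Lam[OF assms]
    by (auto simp: image_iff) (metis divide_pos_pos zero_less_one)
qed

lemma F_differentiable_on:
  assumes "g differentiable_on U" "g differentiable_on V"
  shows "F differentiable_on (U \<times> V)"
proof -
  show ?thesis
    unfolding differentiable_on_def
  proof
    fix p assume p: "p \<in> U \<times> V"
    obtain D1 D2 where D: "(g has_derivative D1) (at (fst p) within U)" "(g has_derivative D2) (at (snd p) within V)"
      using assms p unfolding differentiable_on_def differentiable_def by (metis mem_Times_iff)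
    have D1: "((\<lambda>p. g (fst p)) has_derivative (\<lambda>h. D1 (fst h))) (at p within U \<times> V)"
      by (rule has_derivative_in_compose[OF has_derivative_fst[OF has_derivative_ident]])
         (rule has_derivative_subset[OF D(1)], auto)
    have D2: "((\<lambda>p. g (snd p)) has_derivative (\<lambda>h. D2 (snd h))) (at p within U \<times> V)"
      by (rule has_derivative_in_compose[OF has_derivative_snd[OF has_derivative_ident]])
         (rule has_derivative_subset[OF D(2)], auto)
    have "(F has_derivative (\<lambda>h. (fst h + snd h, D1 (fst h) - D2 (snd h)))) (at p within U \<times> V)"
      unfolding F_def by (auto intro!: derivative_eq_intros D1 D2)
    then show "F differentiable at p within U \<times> V" unfolding differentiable_def by blast
  qed
qed

lemma negligible_Z_Times: "negligible (Z \<times> (UNIV :: 'a set))" "negligible ((UNIV :: 'a set) \<times> Z)"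
proof -
  have Z: "Z \<in> sets borel" using Z_closed by simp
  have Z0: "emeasure lborel Z = 0" using Z_negl Z by (simp add: negligible_iff_emeasure0)
  have "emeasure lborel (Z \<times> (UNIV :: 'a set)) = 0" "emeasure lborel ((UNIV :: 'a set) \<times> Z) = 0"
    unfolding lborel_prod[symmetric] by (subst lborel.emeasure_pair_measure_Times; simp add: Z Z0)+
  moreover have "Z \<times> (UNIV :: 'a set) \<in> sets borel" "(UNIV :: 'a set) \<times> Z \<in> sets borel"
    using Z_closed by (auto intro!: borel_closed closed_Times)
  ultimately show "negligible (Z \<times> (UNIV :: 'a set))" "negligible ((UNIV :: 'a set) \<times> Z)"
    by (simp_all add: negligible_iff_emeasure0)
qed

lemma negligible_F_sing: "negligible (- F ` Sreg)"
proof -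
  have "g differentiable_on (- Z)"
    by (auto simp: differentiable_on_def intro: differentiable_at_withinI diff)
  note d = this diffZ
  have sub: "- F ` Sreg \<subseteq> F ` (Z \<times> Z) \<union> F ` (Z \<times> -Z) \<union> F ` ((-Z) \<times> Z)"
  proof
    fix z assume z: "z \<in> - F ` Sreg"
    have "H z \<notin> Sreg" using z F_H by (metis ComplD image_eqI)
    then show "z \<in> F ` (Z \<times> Z) \<union> F ` (Z \<times> -Z) \<union> F ` ((-Z) \<times> Z)"
    proof -
      obtain a b where ab: "H z = (a, b)" by (cases "H z")
      then have "z = F (a, b)" using F_H[of z] by simp
      then show ?thesis using \<open>H z \<notin> Sreg\<close> ab by (auto simp: Sreg_def)
    qed
  qed
  have "negligible (F ` (Z \<times> Z))" "negligible (F ` (Z \<times> -Z))" "negligible (F ` ((-Z) \<times> Z))"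
    using F_differentiable_on[OF d(2) d(2)] F_differentiable_on[OF d(2) d(1)] F_differentiable_on[OF d(1) d(2)]
    by (auto intro!: negligible_differentiable_image_negligible intro: negligible_subset[OF negligible_Z_Times(1)] negligible_subset[OF negligible_Z_Times(2)])
  then show ?thesis by (intro negligible_subset[OF _ sub] negligible_Un)
qed

lemma emeasure_T_image:
  assumes \<alpha>: "\<alpha> > 0" and A: "A \<in> sets borel" "T \<alpha> ` A \<in> sets borel"
  shows "emeasure lborel (T \<alpha> ` A) = emeasure lborel A"
proof -
  have FS: "F ` Sreg \<in> sets borel"
  proof -
    have "F ` Sreg = H -` Sreg" by (auto simp: image_iff) (metis F_H)
    moreover have "Sreg \<in> sets borel" unfolding Sreg_def using Z_closed by (intro borel_open open_Times) auto
    ultimately show ?thesis using measurable_sets[OF H_measurable, of Sreg] by simp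
  qed
  define B where "B = F -` A \<inter> Sreg"
  have FB: "F ` B = A \<inter> F ` Sreg" by (auto simp: B_def)
  have LS: "Lam \<alpha> ` Sreg = Sreg" by (rule Lam_Sreg[OF \<alpha>])
  have GB: "(F \<circ> Lam \<alpha>) ` B = T \<alpha> ` A \<inter> F ` Sreg"
  proof (intro equalityI subsetI)
    fix z assume "z \<in> (F \<circ> Lam \<alpha>) ` B"
    then obtain p where p: "p \<in> B" "z = F (Lam \<alpha> p)" by auto
    have "z = T \<alpha> (F p)" by (simp add: p T_def)
    moreover have "F p \<in> A" "Lam \<alpha> p \<in> Sreg" using p LS by (auto simp: B_def)
    ultimately show "z \<in> T \<alpha> ` A \<inter> F ` Sreg" using p(2) by blast
  next
    fix z assume "z \<in> T \<alpha> ` A \<inter> F ` Sreg"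
    then obtain a s where a: "a \<in> A" "z = F (Lam \<alpha> (H a))" "s \<in> Sreg" "z = F s" by (auto simp: T_def)
    then have "Lam \<alpha> (H a) = s" using F_inj by (simp add: inj_eq)
    moreover obtain s' where "s' \<in> Sreg" "s = Lam \<alpha> s'" using LS a(3) by blast
    moreover have "inj (Lam \<alpha>)" using \<alpha> by (auto simp: inj_def Lam_def prod_eq_iff)
    ultimately have "H a \<in> Sreg" by (metis injD)
    then have "H a \<in> B" using a by (simp add: B_def)
    then show "z \<in> (F \<circ> Lam \<alpha>) ` B" using a by auto
  qed
  define D where "D x = frechet_derivative g (at x)" for x
  have D: "(g has_derivative D x) (at x)" if "x \<notin> Z" for x
    using diff[OF that] frechet_derivative_works unfolding D_def by blast
  define F' where "F' p h = (fst h + snd h, D (fst p) (fst h) - D (snd p) (snd h))" for p h :: "'a \<times> 'a"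
  have D1: "((\<lambda>p. g (fst p)) has_derivative (\<lambda>h. D (fst p) (fst h))) (at p within S)" 
    and D2: "((\<lambda>p. g (snd p)) has_derivative (\<lambda>h. D (snd p) (snd h))) (at p within S)"
    if "p \<in> Sreg" for p :: "'a \<times> 'a" and S
    using that by (auto simp: Sreg_def intro!: has_derivative_compose[OF _ D] derivative_intros)
  have F': "(F has_derivative F' p) (at p within B)" if "p \<in> B" for p
    using that D1[of p B] D2[of p B] unfolding F_def F'_def B_def by (auto intro!: derivative_eq_intros)
  have G': "(F \<circ> Lam \<alpha> has_derivative F' p \<circ> Lam \<alpha>) (at p within B)" if "p \<in> B" for p
  proof -
    have pS: "p \<in> Sreg" using that by (simp add: B_def)
    then have "linear (D (fst p))" "linear (D (snd p))" 
      using has_derivative_linear[OF D] by (auto simp: Sreg_def)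
    then have l: "D (fst p) (\<alpha> *\<^sub>R h) = \<alpha> *\<^sub>R D (fst p) h" "D (snd p) ((1/\<alpha>) *\<^sub>R h) = (1/\<alpha>) *\<^sub>R D (snd p) h" for h
      by (simp_all add: linear_cmul)
    have G: "F \<circ> Lam \<alpha> = (\<lambda>p. (\<alpha> *\<^sub>R fst p + (1/\<alpha>) *\<^sub>R snd p, \<alpha> *\<^sub>R g (fst p) - (1/\<alpha>) *\<^sub>R g (snd p)))"
      using \<alpha> by (simp add: F_def Lam_def fun_eq_iff hom[OF \<alpha>] hom[of "1/\<alpha>"])
    have "F' p \<circ> Lam \<alpha> = (\<lambda>h. (\<alpha> *\<^sub>R fst h + (1/\<alpha>) *\<^sub>R snd h, \<alpha> *\<^sub>R D (fst p) (fst h) - (1/\<alpha>) *\<^sub>R D (snd p) (snd h)))"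
      by (simp add: F'_def Lam_def fun_eq_iff l)
    then show ?thesis unfolding G
      using D1[OF pS, of B] D2[OF pS, of B] by (auto intro!: derivative_eq_intros)
  qed
  have "emeasure lborel ((F \<circ> Lam \<alpha>) ` B) = emeasure lborel (F ` B)"
  proof (rule emeasure_image_compare[OF _ _ _ F' _ G' _ linear_Lam emeasure_Lam_cube[OF \<alpha>]])
    have "Sreg \<in> sets borel" unfolding Sreg_def using Z_closed by (intro borel_open open_Times) auto
    moreover have "F -` A \<in> sets borel" using A measurable_sets[OF F_measurable, of A] by simp
    ultimately show "B \<in> sets borel" unfolding B_def by blast
    show "F ` B \<in> sets borel" "(F \<circ> Lam \<alpha>) ` B \<in> sets borel"
      unfolding FB GB using A FS by auto
    show "inj_on F B" using F_inj by (rule inj_on_subset) auto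
    have "inj (Lam \<alpha>)" using \<alpha> by (auto simp: inj_def Lam_def prod_eq_iff)
    then show "inj_on (F \<circ> Lam \<alpha>) B" using inj_compose[OF F_inj] inj_on_subset by blast
  qed
  moreover have "emeasure lborel (X \<inter> F ` Sreg) = emeasure lborel X" if "X \<in> sets borel" for X
  proof (rule emeasure_eq_AE)
    have "- F ` Sreg \<in> null_sets lborel"
      using negligible_F_sing FS by (auto simp: negligible_iff_null_sets null_sets_def)
    then show "AE x in lborel. (x \<in> X \<inter> F ` Sreg) = (x \<in> X)" 
      by (rule AE_I') auto
  qed (use that FS in auto)
  ultimately show ?thesis using A unfolding FB GB by metis
qed

lemma T_measurable [measurable]: "T \<alpha> \<in> borel_measurable borel"
proof -
  have "Lam \<alpha> \<in> borel_measurable borel"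
    by (intro borel_measurable_continuous_onI linear_continuous_on) (simp add: linear_Lam linear_linear)
  then show ?thesis unfolding T_def by measurable
qed

lemma T_T: "\<alpha> > 0 \<Longrightarrow> T \<alpha> (T (1/\<alpha>) z) = z"
  by (simp add: T_def Lam_Lam)

lemma distr_T: 
  assumes \<alpha>: "\<alpha> > 0" shows "distr lborel borel (T \<alpha>) = lborel"
proof (rule measure_eqI)
  fix X assume "X \<in> sets (distr lborel borel (T \<alpha>))"
  then have X: "X \<in> sets borel" by simp
  have 1: "T \<alpha> ` (T \<alpha> -` X) = X" 
  proof (intro equalityI subsetI)
    fix z assume "z \<in> X"
    then show "z \<in> T \<alpha> ` (T \<alpha> -` X)" using T_T[OF \<alpha>, of z] by (metis image_eqI vimageI2)
  qed auto
  have 2: "T \<alpha> -` X \<in> sets borel" using measurable_sets[OF T_measurable X, of \<alpha>] by simp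
  show "emeasure (distr lborel borel (T \<alpha>)) X = emeasure lborel X"
    using emeasure_T_image[OF \<alpha> 2] X unfolding 1 by (simp add: emeasure_distr)
qed simp

end

section \<open>Gaussian integrals and holomorphic parameter integrals\<close>

lemma nn_integral_gaussian_real:
  assumes "\<sigma> > 0" shows "(\<integral>\<^sup>+(x::real). ennreal (exp (- x\<^sup>2 / (2 * \<sigma>\<^sup>2))) \<partial>lborel) = ennreal (sqrt (2 * pi * \<sigma>\<^sup>2))"
proof -
  have "(\<integral>\<^sup>+(x::real). ennreal (exp (- x\<^sup>2 / (2 * \<sigma>\<^sup>2))) \<partial>lborel) = 
      (\<integral>\<^sup>+(x::real). ennreal (sqrt (2 * pi * \<sigma>\<^sup>2)) * ennreal (normal_density 0 \<sigma> x) \<partial>lborel)"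
    using assms by (intro nn_integral_cong) (simp add: normal_density_def ennreal_mult'[symmetric])
  also have "\<dots> = ennreal (sqrt (2 * pi * \<sigma>\<^sup>2)) * (\<integral>\<^sup>+(x::real). ennreal (normal_density 0 \<sigma> x) \<partial>lborel)"
    by (rule nn_integral_cmult) auto
  also have "(\<integral>\<^sup>+(x::real). ennreal (normal_density 0 \<sigma> x) \<partial>lborel) = 1"
    using assms by (subst nn_integral_eq_integral) (auto simp: integrable_normal_density integral_normal_density)
  finally show ?thesis by simp
qed

lemma nn_integral_gaussian:
  assumes "\<kappa> > 0"
  shows "(\<integral>\<^sup>+(x::'a::euclidean_space). ennreal (exp (- \<kappa> * (norm x)\<^sup>2)) \<partial>lborel) = ennreal (sqrt (pi / \<kappa>) ^ DIM('a))"
proof -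
  define \<sigma> where "\<sigma> = sqrt (1 / (2 * \<kappa>))"
  have \<sigma>: "\<sigma> > 0" "\<sigma>\<^sup>2 = 1 / (2 * \<kappa>)" using assms by (auto simp: \<sigma>_def)
  have "ennreal (exp (- \<kappa> * (norm x)\<^sup>2)) = (\<Prod>b\<in>Basis. ennreal (exp (- (x \<bullet> b)\<^sup>2 / (2 * \<sigma>\<^sup>2))))" for x :: 'a
  proof -
    have "- \<kappa> * (norm x)\<^sup>2 = (\<Sum>b\<in>Basis. - (x \<bullet> b)\<^sup>2 / (2 * \<sigma>\<^sup>2))"
      using assms by (simp add: \<sigma>(2) norm_eq_sqrt_inner euclidean_inner[of x x] power2_eq_square[symmetric] sum_nonneg
          sum_divide_distrib[symmetric] sum_negf sum_distrib_left field_simps)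
    then show ?thesis by (simp add: exp_sum prod_ennreal)
  qed
  then have "(\<integral>\<^sup>+(x::'a). ennreal (exp (- \<kappa> * (norm x)\<^sup>2)) \<partial>lborel) = 
     (\<Prod>b\<in>(Basis::'a set). (\<integral>\<^sup>+x. ennreal (exp (- x\<^sup>2 / (2 * \<sigma>\<^sup>2))) \<partial>lborel))"
    by (simp only:) (rule nn_integral_lborel_prod, auto)
  also have "\<dots> = ennreal (sqrt (pi / \<kappa>) ^ DIM('a))"
    unfolding nn_integral_gaussian_real[OF \<sigma>(1)] using \<sigma> assms by (simp add: ennreal_power)
  finally show ?thesis .
qed

lemma integrable_gaussian:
  assumes "\<kappa> > 0" shows "integrable lborel (\<lambda>x::'a::euclidean_space. exp (- \<kappa> * (norm x)\<^sup>2))"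
proof (rule integrableI_nonneg)
  show "(\<integral>\<^sup>+(x::'a). ennreal (exp (- \<kappa> * (norm x)\<^sup>2)) \<partial>lborel) < \<infinity>"
    unfolding nn_integral_gaussian[OF assms] by simp
qed auto

lemma integral_gaussian:
  assumes "\<kappa> > 0" shows "(\<integral>(x::'a::euclidean_space). exp (- \<kappa> * (norm x)\<^sup>2) \<partial>lborel) = sqrt (pi / \<kappa>) ^ DIM('a)"
proof -
  have "(\<integral>(x::'a). exp (- \<kappa> * (norm x)\<^sup>2) \<partial>lborel) = enn2real (\<integral>\<^sup>+(x::'a). ennreal (exp (- \<kappa> * (norm x)\<^sup>2)) \<partial>lborel)"
    by (rule integral_eq_nn_integral) auto
  also have "\<dots> = sqrt (pi / \<kappa>) ^ DIM('a)"
    unfolding nn_integral_gaussian[OF assms] using assms by simp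
  finally show ?thesis .
qed

text \<open>Cauchy's inequality bounds the derivative in the parameter by a multiple of the majorant
  \<open>G\<close>, so dominated convergence applies to the difference quotients.\<close>

lemma has_field_derivative_param_integral:
  fixes u :: "complex \<Rightarrow> 'b \<Rightarrow> complex"
  assumes r: "r > 0" and hol: "\<And>x. (\<lambda>\<eta>. u \<eta> x) holomorphic_on ball \<eta>0 r"
    and bd: "\<And>\<eta> x. \<eta> \<in> ball \<eta>0 r \<Longrightarrow> norm (u \<eta> x) \<le> G x" and G: "integrable M G"
    and meas: "\<And>\<eta>. \<eta> \<in> ball \<eta>0 r \<Longrightarrow> u \<eta> \<in> borel_measurable M"
  shows "\<exists>W'. ((\<lambda>\<eta>. \<integral>x. u \<eta> x \<partial>M) has_field_derivative W') (at \<eta>0)"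
proof -
  define D where "D x = deriv (\<lambda>\<eta>. u \<eta> x) \<eta>0" for x
  define B where "B = ball \<eta>0 (r/2)"
  have B_sub: "B \<subseteq> ball \<eta>0 r" using r by (auto simp: B_def)
  have \<eta>0B: "\<eta>0 \<in> B" using r by (simp add: B_def)
  have int: "integrable M (u \<eta>)" if "\<eta> \<in> ball \<eta>0 r" for \<eta>
    by (rule Bochner_Integration.integrable_bound[OF G meas[OF that]]) (use bd[OF that] in \<open>auto intro!: AE_I2 order_trans[OF _ abs_ge_self]\<close>)
  have df: "((\<lambda>\<eta>. u \<eta> x) has_field_derivative deriv (\<lambda>\<eta>. u \<eta> x) \<eta>) (at \<eta>)" if "\<eta> \<in> B" for \<eta> x
    using holomorphic_derivI[OF hol open_ball] that B_sub by blast
  have dB: "norm (deriv (\<lambda>\<eta>. u \<eta> x) \<eta>) \<le> 3 / r * G x" if "\<eta> \<in> B" for \<eta> x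
  proof -
    \<comment> \<open>Half the radius for the points and a third for the Cauchy discs stay within
      the ball on which \<open>G\<close> is a majorant.\<close>
    have sub: "cball \<eta> (r/3) \<subseteq> ball \<eta>0 r"
    proof
      fix y assume "y \<in> cball \<eta> (r/3)"
      then have "dist \<eta>0 y \<le> dist \<eta>0 \<eta> + r/3" using dist_triangle[of \<eta>0 y \<eta>] by simp
      moreover have "dist \<eta>0 \<eta> < r/2" using that by (simp add: B_def)
      ultimately show "y \<in> ball \<eta>0 r" using r by simp
    qed
    have "norm ((deriv ^^ 1) (\<lambda>\<eta>. u \<eta> x) \<eta>) \<le> fact 1 * G x / (r/3) ^ 1"
    proof (rule Cauchy_inequality)
      show "(\<lambda>\<eta>. u \<eta> x) holomorphic_on ball \<eta> (r/3)" 
        using hol sub by (meson holomorphic_on_subset ball_subset_cball order_trans)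
      show "continuous_on (cball \<eta> (r/3)) (\<lambda>\<eta>. u \<eta> x)"
        using hol sub by (meson continuous_on_subset holomorphic_on_imp_continuous_on)
      show "r / 3 > 0" using r by simp
      fix y assume "norm (\<eta> - y) = r/3"
      then have "y \<in> ball \<eta>0 r" using sub by (auto simp: dist_norm)
      then show "norm (u y x) \<le> G x" by (rule bd)
    qed
    then show ?thesis by (simp add: field_simps)
  qed
  have lip: "norm ((u \<eta> x - u \<eta>0 x) / (\<eta> - \<eta>0)) \<le> 3 / r * G x" if "\<eta> \<in> B - {\<eta>0}" for \<eta> x
  proof -
    have "norm (u \<eta> x - u \<eta>0 x) \<le> 3 / r * G x * norm (\<eta> - \<eta>0)"
      using df dB that \<eta>0B by (intro field_differentiable_bound[where S=B and f'="deriv (\<lambda>\<eta>. u \<eta> x)"]) 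
        (auto simp: B_def intro: has_field_derivative_at_within)
    then show ?thesis using that by (simp add: norm_divide divide_le_eq)
  qed
  have lim: "((\<lambda>\<eta>. ((\<integral>x. u \<eta> x \<partial>M) - (\<integral>x. u \<eta>0 x \<partial>M)) / (\<eta> - \<eta>0)) \<longlongrightarrow> (\<integral>x. D x \<partial>M)) (at \<eta>0 within B)"
    unfolding tendsto_at_iff_sequentially
  proof (intro allI impI)
    fix X assume XB: "\<forall>i. X i \<in> B - {\<eta>0}" and X: "X \<longlonglongrightarrow> \<eta>0"
    have q: "(\<lambda>i. (u (X i) x - u \<eta>0 x) / (X i - \<eta>0)) \<longlonglongrightarrow> D x" for x
    proof -
      have "((\<lambda>\<eta>. (u \<eta> x - u \<eta>0 x) / (\<eta> - \<eta>0)) \<longlongrightarrow> D x) (at \<eta>0)"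
        using df[OF \<eta>0B, of x] unfolding D_def has_field_derivative_iff .
      then show ?thesis unfolding tendsto_at_iff_sequentially using XB X by (auto simp: o_def)
    qed
    have m: "(\<lambda>x. (u (X i) x - u \<eta>0 x) / (X i - \<eta>0)) \<in> borel_measurable M" for i
    proof -
      have "X i \<in> ball \<eta>0 r" "\<eta>0 \<in> ball \<eta>0 r" using XB B_sub \<eta>0B by blast+
      from meas[OF this(1)] meas[OF this(2)] show ?thesis by measurable
    qed
    have "(\<lambda>i. \<integral>x. (u (X i) x - u \<eta>0 x) / (X i - \<eta>0) \<partial>M) \<longlonglongrightarrow> (\<integral>x. D x \<partial>M)"
    proof (rule integral_dominated_convergence[where w="\<lambda>x. 3 / r * G x"])
      show "D \<in> borel_measurable M" using q m by (rule borel_measurable_LIMSEQ_metric[rotated])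
    qed (use m q G lip XB in auto)
    moreover have "(\<integral>x. (u (X i) x - u \<eta>0 x) / (X i - \<eta>0) \<partial>M) = ((\<integral>x. u (X i) x \<partial>M) - (\<integral>x. u \<eta>0 x \<partial>M)) / (X i - \<eta>0)" for i
    proof -
      have "X i \<in> ball \<eta>0 r" "\<eta>0 \<in> ball \<eta>0 r" using XB B_sub \<eta>0B by blast+
      from int[OF this(1)] int[OF this(2)] show ?thesis by simp
    qed
    ultimately show "((\<lambda>\<eta>. ((\<integral>x. u \<eta> x \<partial>M) - (\<integral>x. u \<eta>0 x \<partial>M)) / (\<eta> - \<eta>0)) \<circ> X) \<longlonglongrightarrow> (\<integral>x. D x \<partial>M)"
      unfolding o_def by (simp only:)
  qed
  have "at \<eta>0 within B = at \<eta>0" using \<eta>0B by (intro at_within_open) (auto simp: B_def)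
  then show ?thesis using lim unfolding has_field_derivative_iff by auto
qed

section \<open>Holomorphic rotation of the Gaussian integral\<close>

definition W0 :: "'a::euclidean_space itself \<Rightarrow> real \<Rightarrow> complex" where
  "W0 TYPE('a) \<epsilon> = (\<integral>(z::'a\<times>'a). exp (- (1/2) * Complex (\<epsilon> * (norm z)\<^sup>2) (2 * (fst z \<bullet> snd z))) \<partial>lborel)"

lemma sin_cos_ge_1: assumes "0 \<le> \<theta>" "\<theta> \<le> pi/2" shows "1 \<le> sin \<theta> + cos \<theta>"
proof -
  have s: "0 \<le> sin \<theta>" "sin \<theta> \<le> 1" "0 \<le> cos \<theta>" "cos \<theta> \<le> 1"
    using assms by (auto intro!: sin_ge_zero cos_ge_zero)
  have "(sin \<theta>)\<^sup>2 \<le> sin \<theta>" "(cos \<theta>)\<^sup>2 \<le> cos \<theta>"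
    using s by (auto simp: power2_eq_square mult_left_le)
  then show ?thesis using sin_cos_squared_add[of \<theta>] by linarith
qed

context monotone_field begin

text \<open>Rotating \<open>\<eta>\<close> from 1 to \<open>\<i>\<close> turns the damped Gaussian \<open>exp (- (q x + q y) / 2)\<close> into an oscillatory integral
  \<open>W0\<close> that no longer depends on \<open>g\<close>, while \<open>W\<close> stays constant: it is holomorphic in \<open>\<eta>\<close> and, by invariance
  under \<open>T\<close>, constant on rays. Taking \<open>g\<close> to be the identity evaluates \<open>W0\<close>. The parameter \<open>\<epsilon>\<close> only ensures
  absolute convergence.\<close>

definition \<beta> :: "'a \<times> 'a \<Rightarrow> real" where "\<beta> p = snd p \<bullet> g (fst p) - fst p \<bullet> g (snd p)"
definition \<pi> :: "'a \<times> 'a \<Rightarrow> real" where "\<pi> p = fst p \<bullet> snd p - g (fst p) \<bullet> g (snd p)"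

text \<open>Three properties fix this exponent. Scaling (x, y) to (r x, y / r) replaces \<eta> by
  r^2 \<eta>, since \<open>\<beta>\<close> and \<open>\<pi>\<close> are invariant. At \<eta> = 1 the
  real part is - (q x + q y) / 2 - \<epsilon> \<pi> (x, y). At \<eta> = \<open>\<i>\<close> the
  \<epsilon>-terms add up to |F p|^2 and the others to the pairing of the components of
  \<open>F p\<close>.\<close>

definition E :: "real \<Rightarrow> complex \<Rightarrow> 'a \<times> 'a \<Rightarrow> complex" where
  "E \<epsilon> \<eta> p = - (1/2) * (\<eta> * Complex (q (fst p)) (- \<epsilon> * nn (fst p)) + Complex (q (snd p)) (\<epsilon> * nn (snd p)) / \<eta>
      + Complex (2 * \<epsilon> * \<pi> p) (2 * \<beta> p))"

definition W :: "real \<Rightarrow> complex \<Rightarrow> complex" where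
  "W \<epsilon> \<eta> = (\<integral>z. exp (E \<epsilon> \<eta> (H z)) \<partial>lborel)"

lemma E_Lam: assumes "r > 0" shows "E \<epsilon> \<eta> (Lam r p) = E \<epsilon> (of_real (r\<^sup>2) * \<eta>) p"
proof -
  have "\<beta> (Lam r p) = \<beta> p" "\<pi> (Lam r p) = \<pi> p"
    using assms by (simp_all add: \<beta>_def \<pi>_def Lam_def hom hom[of "1/r"])
  moreover have "Complex (r\<^sup>2 * x) (- \<epsilon> * (r\<^sup>2 * y)) = of_real (r\<^sup>2) * Complex x (- \<epsilon> * y)" for x y
    by (simp add: complex_eq_iff)
  moreover have "Complex ((1/r)\<^sup>2 * x) (\<epsilon> * ((1/r)\<^sup>2 * y)) = Complex x (\<epsilon> * y) / of_real (r\<^sup>2)" for x y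
    by (simp add: complex_eq_iff Re_divide_of_real Im_divide_of_real power_divide)
  ultimately show ?thesis
    using assms unfolding E_def by (simp only: Lam_def fst_conv snd_conv q_hom nn_hom q_hom[of "1/r"] nn_hom[of "1/r"] zero_less_divide_1_iff) 
      (simp add: field_simps)
qed

lemma E_measurable [measurable]: "(\<lambda>z. exp (E \<epsilon> \<eta> (H z))) \<in> borel_measurable borel"
proof -
  have "continuous_on UNIV (\<lambda>z. exp (E \<epsilon> \<eta> (H z)))"
    unfolding E_def q_def nn_def \<beta>_def \<pi>_def Complex_eq divide_inverse
    by (intro continuous_intros continuous_on_compose2[OF cont] continuous_on_compose2[OF H_cont] continuous_on_fst continuous_on_snd) auto
  then show ?thesis by (rule borel_measurable_continuous_onI)
qed

lemma W_scale: assumes "r > 0" shows "W \<epsilon> (of_real r * \<eta>) = W \<epsilon> \<eta>"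
proof -
  define s where "s = sqrt r"
  have s: "s > 0" "s\<^sup>2 = r" using assms by (auto simp: s_def)
  have "W \<epsilon> \<eta> = (\<integral>z. exp (E \<epsilon> \<eta> (H z)) \<partial>(distr lborel borel (T s)))"
    by (simp add: W_def distr_T s)
  also have "\<dots> = (\<integral>z. exp (E \<epsilon> \<eta> (H (T s z))) \<partial>lborel)"
    by (subst integral_distr) auto
  also have "\<dots> = (\<integral>z. exp (E \<epsilon> (of_real r * \<eta>) (H z)) \<partial>lborel)"
    by (simp add: T_def E_Lam s)
  finally show ?thesis by (simp add: W_def)
qed

lemma norm_F': "(norm (F p))\<^sup>2 = nn (fst p) + nn (snd p) + 2 * \<pi> p"
  by (simp add: norm_F \<pi>_def)

text \<open>The exponent needs damping of size \<epsilon> \<open>nn\<close> throughout, but the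
  \<epsilon>-term has weight sin \<theta> only. The deficit 1 - sin \<theta> is at most cos
  \<theta>, the weight of \<open>q\<close>, and \<open>q\<close> dominates c \<open>nn\<close> with
  \<epsilon> <= c.\<close>

lemma Re_E_cis:
  assumes "0 \<le> \<theta>" "\<theta> \<le> pi/2" "0 < \<epsilon>" "\<epsilon> \<le> c"
  shows "Re (E \<epsilon> (cis \<theta>) p) \<le> - \<epsilon> / 2 * (norm (F p))\<^sup>2"
proof -
  let ?n = "nn (fst p) + nn (snd p)" and ?a = "q (fst p) + q (snd p)"
  have e: "Re (E \<epsilon> (cis \<theta>) p) = - (1/2) * (cos \<theta> * ?a + \<epsilon> * sin \<theta> * ?n + 2 * \<epsilon> * \<pi> p)"
  proof -
    have 1: "Complex u v / cis \<theta> = Complex (cos \<theta> * u + sin \<theta> * v) (cos \<theta> * v - sin \<theta> * u)" for u v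
      unfolding divide_inverse cis_inverse by (simp add: complex_eq_iff mult.commute)
    have 2: "cis \<theta> * Complex u v = Complex (cos \<theta> * u - sin \<theta> * v) (cos \<theta> * v + sin \<theta> * u)" for u v
      by (simp add: complex_eq_iff)
    show ?thesis unfolding E_def 1 2 by (simp add: field_simps)
  qed
  have c0: "cos \<theta> \<ge> 0" using assms by (intro cos_ge_zero) auto
  have "\<epsilon> * (1 - sin \<theta>) * ?n \<le> c * cos \<theta> * ?n"
    using sin_cos_ge_1[OF assms(1,2)] assms(3,4) by (intro mult_right_mono mult_mono) (auto intro: add_nonneg_nonneg)
  also have "\<dots> = cos \<theta> * (c * nn (fst p) + c * nn (snd p))" by (simp add: algebra_simps)
  also have "\<dots> \<le> cos \<theta> * ?a"
    using q_coercive c0 by (intro mult_left_mono add_mono) auto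
  finally show ?thesis unfolding e norm_F' by (simp add: algebra_simps)
qed

lemma norm_F_Lam_ge:
  assumes "1/4 \<le> r\<^sup>2" "r\<^sup>2 \<le> 4" "r > 0"
  shows "c\<^sup>2 / 16 * (norm (F p))\<^sup>2 \<le> (norm (F (Lam r p)))\<^sup>2"
proof -
  have "1/4 * (nn (fst p) + nn (snd p)) \<le> r\<^sup>2 * nn (fst p) + (1/r)\<^sup>2 * nn (snd p)"
  proof -
    have "1/4 \<le> (1/r)\<^sup>2" using assms by (simp add: power_divide field_simps)
    then have "1/4 * nn (fst p) \<le> r\<^sup>2 * nn (fst p)" "1/4 * nn (snd p) \<le> (1/r)\<^sup>2 * nn (snd p)"
      using mult_right_mono[OF assms(1) nn_nonneg] mult_right_mono[OF _ nn_nonneg, of "1/4" "(1/r)\<^sup>2"] by blast+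
    then show ?thesis by (simp add: algebra_simps)
  qed
  also have "\<dots> = nn (fst (Lam r p)) + nn (snd (Lam r p))"
    using assms by (simp add: Lam_def nn_hom nn_hom[of "1/r"])
  finally have "1/4 * (nn (fst p) + nn (snd p)) \<le> nn (fst (Lam r p)) + nn (snd (Lam r p))" .
  then have "c\<^sup>2 / 2 * (1/4 * (nn (fst p) + nn (snd p))) \<le> c\<^sup>2 / 2 * (nn (fst (Lam r p)) + nn (snd (Lam r p)))"
    by (intro mult_left_mono) auto
  also have "\<dots> \<le> (norm (F (Lam r p)))\<^sup>2" by (rule norm_F_ge)
  finally have 1: "c\<^sup>2 / 8 * (nn (fst p) + nn (snd p)) \<le> (norm (F (Lam r p)))\<^sup>2" by simp
  have "c\<^sup>2 / 16 * (norm (F p))\<^sup>2 \<le> c\<^sup>2 / 16 * (2 * (nn (fst p) + nn (snd p)))"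
    by (intro mult_left_mono norm_F_le) auto
  also have "\<dots> = c\<^sup>2 / 8 * (nn (fst p) + nn (snd p))" by simp
  finally show ?thesis using 1 by linarith
qed

text \<open>Complex differentiability at a point of the arc involves a disc around it, so one
  integrable majorant must serve a whole quarter annulus. The modulus r is absorbed into
  \<open>Lam\<close> with factor sqrt r.\<close>

lemma norm_exp_E:
  assumes "0 \<le> \<theta>" "\<theta> \<le> pi/2" "0 < \<epsilon>" "\<epsilon> \<le> c" "1/4 \<le> r" "r \<le> 4"
  shows "norm (exp (E \<epsilon> (of_real r * cis \<theta>) (H z))) \<le> exp (- (\<epsilon> * c\<^sup>2 / 32) * (norm z)\<^sup>2)"
proof -
  define s where "s = sqrt r"
  have s: "s > 0" "s\<^sup>2 = r" using assms by (auto simp: s_def)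
  have "Re (E \<epsilon> (of_real r * cis \<theta>) (H z)) = Re (E \<epsilon> (cis \<theta>) (Lam s (H z)))"
    by (simp add: E_Lam s)
  also have "\<dots> \<le> - \<epsilon> / 2 * (norm (F (Lam s (H z))))\<^sup>2" by (rule Re_E_cis[OF assms(1-4)])
  also have "\<dots> \<le> - \<epsilon> / 2 * (c\<^sup>2 / 16 * (norm (F (H z)))\<^sup>2)"
    using assms s by (intro mult_left_mono_neg norm_F_Lam_ge) auto
  finally show ?thesis by (simp add: norm_exp_eq_Re)
qed

lemma W_const:
  assumes "0 < \<epsilon>" "\<epsilon> \<le> c" shows "W \<epsilon> \<i> = W \<epsilon> 1"
proof -
  define G where "G z = exp (- (\<epsilon> * c\<^sup>2 / 32) * (norm z)\<^sup>2)" for z :: "'a \<times> 'a"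
  have G: "integrable lborel G" unfolding G_def using assms c_pos by (intro integrable_gaussian) auto
  have bd: "norm (exp (E \<epsilon> \<eta> (H z))) \<le> G z" if "Re \<eta> \<ge> 0" "Im \<eta> \<ge> 0" "1/4 \<le> norm \<eta>" "norm \<eta> \<le> 4" for \<eta> z
  proof -
    have n0: "norm \<eta> \<noteq> 0" using that by auto
    then have e: "\<eta> = of_real (norm \<eta>) * cis (Arg \<eta>)" using rcis_cmod_Arg[of \<eta>] by (simp add: rcis_def)
    have "Arg \<eta> \<le> pi/2"
    proof (rule ccontr)
      assume "\<not> ?thesis"
      then have "cos (Arg \<eta>) < cos (pi/2)" using Arg_le_pi[of \<eta>] by (intro cos_monotone_0_pi) auto
      moreover have "Re \<eta> = norm \<eta> * cos (Arg \<eta>)" using e by (metis Re_rcis rcis_cmod_Arg)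
      ultimately show False using that n0 by (simp add: zero_le_mult_iff)
    qed
    moreover have "0 \<le> Arg \<eta>" using that Arg_less_0 by blast
    ultimately have "0 \<le> Arg \<eta>" "Arg \<eta> \<le> pi/2" by auto
    then show ?thesis using norm_exp_E[of "Arg \<eta>" \<epsilon> "norm \<eta>" z] assms that e unfolding G_def by metis
  qed
  define f where "f \<theta> = W \<epsilon> (cis \<theta>)" for \<theta>
  \<comment> \<open>Discs around the end points of the arc leave the closed quadrant in which
    \<open>bd\<close> holds. The derivative is thus taken at interior angles only, and the end
    points are reached by continuity.\<close>
  have der: "(f has_vector_derivative 0) (at \<theta>)" if "0 < \<theta>" "\<theta> < pi/2" for \<theta>
  proof -
    have pos: "cos \<theta> > 0" "sin \<theta> > 0" using that by (auto intro!: cos_gt_zero sin_gt_zero)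
    define r where "r = min (1/2) (min (cos \<theta>) (sin \<theta>))"
    have r: "r > 0" "r \<le> 1/2" "r \<le> cos \<theta>" "r \<le> sin \<theta>" using pos by (auto simp: r_def)
    have ball: "Re \<eta> > 0 \<and> Im \<eta> > 0 \<and> 1/2 \<le> norm \<eta> \<and> norm \<eta> \<le> 3/2" if "\<eta> \<in> ball (cis \<theta>) r" for \<eta>
    proof -
      have n: "norm (cis \<theta> - \<eta>) < r" using that by (simp add: dist_norm)
      have "\<bar>Re (cis \<theta> - \<eta>)\<bar> < r" "\<bar>Im (cis \<theta> - \<eta>)\<bar> < r"
        using n abs_Re_le_cmod[of "cis \<theta> - \<eta>"] abs_Im_le_cmod[of "cis \<theta> - \<eta>"] by linarith+
      moreover have "\<bar>norm (cis \<theta>) - norm \<eta>\<bar> < r" using n norm_triangle_ineq3[of "cis \<theta>" \<eta>] by linarith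
      ultimately show ?thesis using r by auto
    qed
    have "\<exists>W'. ((\<lambda>\<eta>. \<integral>z. exp (E \<epsilon> \<eta> (H z)) \<partial>lborel) has_field_derivative W') (at (cis \<theta>))"
    proof (rule has_field_derivative_param_integral[OF r(1) _ _ G])
      fix z show "(\<lambda>\<eta>. exp (E \<epsilon> \<eta> (H z))) holomorphic_on ball (cis \<theta>) r"
        unfolding E_def using ball by (intro holomorphic_intros) force+
      fix \<eta> assume "\<eta> \<in> ball (cis \<theta>) r"
      then show "norm (exp (E \<epsilon> \<eta> (H z))) \<le> G z" using ball[of \<eta>] by (intro bd) auto
    qed auto
    then obtain W' where W': "(W \<epsilon> has_field_derivative W') (at (cis \<theta>))" by (auto simp: W_def[abs_def])
    \<comment> \<open>A complex derivative can be computed in any direction. Along the ray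
      \<open>W\<close> is constant by \<open>W_scale\<close>, hence \<open>W'\<close> is 0, and so
      is the derivative along the arc.\<close>
    have "((\<lambda>t. W \<epsilon> (of_real t * cis \<theta>)) has_vector_derivative (cis \<theta> * W')) (at 1)"
    proof -
      have "((\<lambda>t. of_real t * cis \<theta>) has_vector_derivative cis \<theta>) (at (1::real))"
        by (auto intro!: derivative_eq_intros simp: has_vector_derivative_def has_derivative_mult_left scaleR_conv_of_real)
      then show ?thesis using field_vector_diff_chain_at[of "\<lambda>t. of_real t * cis \<theta>" "cis \<theta>" 1 "W \<epsilon>" W'] W' by (simp add: o_def)
    qed
    moreover have "((\<lambda>t. W \<epsilon> (of_real t * cis \<theta>)) has_vector_derivative 0) (at 1)"
    proof (rule has_vector_derivative_transform_within_open[where S="{0<..}"])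
      show "((\<lambda>t. W \<epsilon> (cis \<theta>)) has_vector_derivative 0) (at (1::real))" by simp
    qed (auto simp: W_scale)
    ultimately have "cis \<theta> * W' = 0" by (rule vector_derivative_unique_at)
    then have "W' = 0" by simp
    have "(cis has_vector_derivative (\<i> * cis \<theta>)) (at \<theta>)"
      unfolding cis_conv_exp[abs_def]
      by (rule has_vector_derivative_real_field[where f="\<lambda>x. exp (\<i> * x)"]) (auto intro!: derivative_eq_intros)
    then show ?thesis using field_vector_diff_chain_at[of cis "\<i> * cis \<theta>" \<theta> "W \<epsilon>" W'] W' \<open>W' = 0\<close> by (simp add: o_def f_def[abs_def])
  qed
  have cont: "continuous_on {0..pi/2} f"
    unfolding continuous_on_sequentially
  proof (intro allI ballI impI, elim conjE)
    fix X \<theta> assume th: "\<theta> \<in> {0..pi/2}" and X: "\<forall>n. X n \<in> {0..pi/2}" "X \<longlonglongrightarrow> \<theta>"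
    show "(f \<circ> X) \<longlonglongrightarrow> f \<theta>"
      unfolding f_def W_def o_def
    proof (rule integral_dominated_convergence[OF _ _ G])
      show "AE z in lborel. norm (exp (E \<epsilon> (cis (X i)) (H z))) \<le> G z" for i
        using spec[OF X(1), of i] by (intro AE_I2 bd) (auto intro!: cos_ge_zero sin_ge_zero)
      show "AE z in lborel. (\<lambda>i. exp (E \<epsilon> (cis (X i)) (H z))) \<longlonglongrightarrow> exp (E \<epsilon> (cis \<theta>) (H z))"
        unfolding E_def cis_conv_exp by (intro AE_I2 tendsto_intros X(2)) auto
    qed auto
  qed
  have "f (pi/2) = f 0"
  proof (rule has_derivative_zero_unique_strong_interval[OF _ cont refl, where k="{0, pi/2}"])
    fix x assume "x \<in> {0..pi/2} - {0, pi/2}"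
    then show "(f has_derivative (\<lambda>h. 0)) (at x within {0..pi/2})"
      using der[of x] by (auto simp: has_vector_derivative_def intro: has_derivative_at_withinI)
  qed auto
  then show ?thesis by (simp add: f_def)
qed

lemma W_i: "W \<epsilon> \<i> = W0 TYPE('a) \<epsilon>"
proof -
  have "E \<epsilon> \<i> p = - (1/2) * Complex (\<epsilon> * (norm (F p))\<^sup>2) (2 * (fst (F p) \<bullet> snd (F p)))" for p
    unfolding E_def norm_F' 
    by (simp add: complex_eq_iff F_def q_def \<beta>_def inner_add inner_diff inner_commute algebra_simps add_divide_distrib diff_divide_distrib)
  then show ?thesis unfolding W_def W0_def by simp
qed


text \<open>At \<eta> = 1 the term - \<epsilon> \<pi> p is at most \<epsilon> / c times (q x + q y)
  / 2, because |F p|^2 >= 0 and \<open>q\<close> dominates c \<open>nn\<close>. The remaining factor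
  \<open>s\<close> in front of \<Theta> is removed by rescaling with sqrt s, which in the doubled
  dimension costs s to the power \<open>DIM('a)\<close>.\<close>

lemma norm_W0_le:
  assumes \<Theta>: "\<Theta> \<in> borel_measurable borel" "\<And>t z. t > 0 \<Longrightarrow> \<Theta> (t *\<^sub>R z) = t\<^sup>2 * \<Theta> z"
    and le: "\<And>p. \<Theta> (F p) \<le> (q (fst p) + q (snd p)) / 2"
    and \<epsilon>: "0 < \<epsilon>" "\<epsilon> < c"
  shows "ennreal (norm (W0 TYPE('a) \<epsilon>) * (1 - \<epsilon> / c) ^ DIM('a)) \<le> (\<integral>\<^sup>+z. ennreal (exp (- \<Theta> z)) \<partial>lborel)"
proof -
  define s where "s = 1 - \<epsilon> / c"
  have s: "s > 0" using \<epsilon> c_pos by (simp add: s_def)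
  note [measurable] = \<Theta>(1)
  have int: "integrable lborel (\<lambda>z. exp (E \<epsilon> 1 (H z)))"
  proof (rule Bochner_Integration.integrable_bound[OF integrable_gaussian[of "\<epsilon> * c\<^sup>2 / 32"]])
    show "AE z in lborel. norm (exp (E \<epsilon> 1 (H z))) \<le> norm (exp (- (\<epsilon> * c\<^sup>2 / 32) * (norm z)\<^sup>2))"
      using norm_exp_E[of 0 \<epsilon> 1] \<epsilon> by simp
  qed (use \<epsilon> c_pos in auto)
  have Re: "Re (E \<epsilon> 1 p) \<le> - (s * \<Theta> (F p))" for p
  proof -
    let ?a = "(q (fst p) + q (snd p)) / 2" and ?n = "nn (fst p) + nn (snd p)"
    have "Re (E \<epsilon> 1 p) = - ?a - \<epsilon> * \<pi> p" by (simp add: E_def field_simps)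
    moreover have "- \<epsilon> * \<pi> p \<le> \<epsilon> * (?n / 2)"
    proof -
      have "- \<pi> p \<le> ?n / 2" 
      proof -
        have "0 \<le> ?n + 2 * \<pi> p" unfolding norm_F'[symmetric] by simp
        then show ?thesis by (simp add: field_simps)
      qed
      then have "\<epsilon> * (- \<pi> p) \<le> \<epsilon> * (?n / 2)" using \<epsilon> by (intro mult_left_mono) auto
      then show ?thesis by simp
    qed
    moreover have "\<epsilon> * (?n / 2) \<le> \<epsilon> / c * ?a"
    proof -
      have "c * ?n \<le> q (fst p) + q (snd p)" 
        using q_coercive[of "fst p"] q_coercive[of "snd p"] by (simp add: algebra_simps)
      then have "?n \<le> (q (fst p) + q (snd p)) / c" using c_pos by (simp add: field_simps)
      then have "\<epsilon> * ?n \<le> \<epsilon> * ((q (fst p) + q (snd p)) / c)" using \<epsilon> by (intro mult_left_mono) auto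
      then show ?thesis by simp
    qed
    ultimately have "Re (E \<epsilon> 1 p) \<le> - ?a + \<epsilon> / c * ?a" by linarith
    also have "\<dots> = - (s * ?a)" unfolding s_def left_diff_distrib by simp
    finally have "Re (E \<epsilon> 1 p) \<le> - (s * ?a)" .
    also have "\<dots> \<le> - (s * \<Theta> (F p))" using mult_left_mono[OF le[of p], of s] s by simp
    finally show ?thesis .
  qed
  have "ennreal (norm (W0 TYPE('a) \<epsilon>)) = ennreal (norm (W \<epsilon> 1))"
    using W_const[of \<epsilon>] W_i[of \<epsilon>] \<epsilon> by simp
  also have "\<dots> \<le> (\<integral>\<^sup>+z. ennreal (norm (exp (E \<epsilon> 1 (H z)))) \<partial>lborel)"
    unfolding W_def by (rule integral_norm_bound_ennreal[OF int])
  also have "\<dots> \<le> (\<integral>\<^sup>+z. ennreal (exp (- (s * \<Theta> z))) \<partial>lborel)"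
  proof (intro nn_integral_mono ennreal_leI)
    fix z show "norm (exp (E \<epsilon> 1 (H z))) \<le> exp (- (s * \<Theta> z))"
      using Re[of "H z"] by (simp add: norm_exp_eq_Re)
  qed
  finally have 1: "ennreal (norm (W0 TYPE('a) \<epsilon>)) \<le> (\<integral>\<^sup>+z. ennreal (exp (- (s * \<Theta> z))) \<partial>lborel)" .
  have "(\<integral>\<^sup>+z. ennreal (exp (- \<Theta> z)) \<partial>lborel) = ennreal (sqrt s ^ DIM('a \<times> 'a)) * (\<integral>\<^sup>+z. ennreal (exp (- \<Theta> (sqrt s *\<^sub>R z))) \<partial>lborel)"
    using s by (subst lborel_affine[of "sqrt s" 0]) 
      (simp_all add: nn_integral_density nn_integral_distr nn_integral_cmult del: DIM_prod)
  also have "sqrt s ^ DIM('a \<times> 'a) = s ^ DIM('a)"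
    using s by (simp add: power_add power_mult_distrib[symmetric])
  also have "(\<integral>\<^sup>+z. ennreal (exp (- \<Theta> (sqrt s *\<^sub>R z))) \<partial>lborel) = (\<integral>\<^sup>+z. ennreal (exp (- (s * \<Theta> z))) \<partial>lborel)"
    using s by (simp add: \<Theta>(2))
  finally have 2: "(\<integral>\<^sup>+z. ennreal (exp (- \<Theta> z)) \<partial>lborel) = ennreal (s ^ DIM('a)) * (\<integral>\<^sup>+z. ennreal (exp (- (s * \<Theta> z))) \<partial>lborel)" .
  have "ennreal (norm (W0 TYPE('a) \<epsilon>) * s ^ DIM('a)) = ennreal (s ^ DIM('a)) * ennreal (norm (W0 TYPE('a) \<epsilon>))"
    using s by (simp add: ennreal_mult mult.commute)
  also have "\<dots> \<le> (\<integral>\<^sup>+z. ennreal (exp (- \<Theta> z)) \<partial>lborel)"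
    unfolding 2 using 1 by (intro mult_left_mono) auto
  finally show ?thesis by (simp add: s_def)
qed

end

lemma monotone_field_id: "monotone_field (\<lambda>x::'a::euclidean_space. x) 1 {}"
  by unfold_locales (auto simp: power2_norm_eq_inner)

text \<open>For the identity field \<open>\<pi>\<close> and \<open>\<beta>\<close> vanish and
  \<open>q\<close> = \<open>nn\<close>, so the exponent at \<eta> = 1 is explicit in z. Its Gaussian
  decay no longer depends on \<epsilon>, which permits the limit \<epsilon> -> 0.\<close>

lemma W0_eq:
  assumes "0 < \<epsilon>" "\<epsilon> \<le> monotone_field.c (\<lambda>x::'a::euclidean_space. x)"
  shows "W0 TYPE('a) \<epsilon> = (\<integral>(z::'a\<times>'a). exp (Complex (- (1/2) * (norm z)\<^sup>2) (\<epsilon> * (fst z \<bullet> snd z))) \<partial>lborel)"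
proof -
  interpret idf: monotone_field "\<lambda>x::'a. x" 1 "{}" by (rule monotone_field_id)
  have "idf.E \<epsilon> 1 (idf.H z) = Complex (- (1/2) * (norm z)\<^sup>2) (\<epsilon> * (fst z \<bullet> snd z))" for z :: "'a \<times> 'a"
  proof -
    obtain x y where p: "idf.H z = (x, y)" by (cases "idf.H z")
    then have z: "z = (x + y, x - y)" using idf.F_H[of z] by (simp add: idf.F_def)
    have 1: "(norm z)\<^sup>2 = 2 * (x \<bullet> x) + 2 * (y \<bullet> y)"
      unfolding z norm_Pair_sq power2_norm_eq_inner by (simp add: inner_add_left inner_add_right inner_diff_left inner_diff_right)
    have 2: "fst z \<bullet> snd z = x \<bullet> x - y \<bullet> y"
      unfolding z by (simp add: inner_add_left inner_add_right inner_diff_left inner_diff_right inner_commute[of y x])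
    have 3: "idf.\<pi> (x, y) = 0" "idf.\<beta> (x, y) = 0" 
      unfolding idf.\<pi>_def idf.\<beta>_def fst_conv snd_conv inner_commute[of y x] by (rule diff_self)+
    have 4: "idf.nn u = 2 * (u \<bullet> u)" "idf.q u = 2 * (u \<bullet> u)" for u :: 'a
      unfolding idf.nn_def idf.q_def power2_norm_eq_inner by simp_all
    have 5: "- (1/2) * (1 * Complex (2 * a) (- \<epsilon> * (2 * a)) + Complex (2 * b) (\<epsilon> * (2 * b)) / 1 + Complex (2 * \<epsilon> * 0) (2 * 0))
        = Complex (- (1/2) * (2 * a + 2 * b)) (\<epsilon> * (a - b))" for a b
      by (simp add: complex_eq_iff field_simps)
    show ?thesis unfolding p idf.E_def fst_conv snd_conv 1 2 3 4 by (rule 5)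
  qed
  then show ?thesis using idf.W_const[OF assms] idf.W_i[of \<epsilon>] unfolding idf.W_def by simp
qed

lemma W0_tendsto:
  assumes e: "\<And>n. 0 < e n" "\<And>n. e n \<le> monotone_field.c (\<lambda>x::'a::euclidean_space. x)" "e \<longlonglongrightarrow> 0"
  shows "(\<lambda>n. norm (W0 TYPE('a) (e n))) \<longlonglongrightarrow> (2 * pi) ^ DIM('a)"
proof -
  let ?I = "\<integral>(z::'a\<times>'a). exp (Complex (- (1/2) * (norm z)\<^sup>2) (0 * (fst z \<bullet> snd z))) \<partial>lborel"
  have m: "(\<lambda>z::'a\<times>'a. exp (Complex (- (1/2) * (norm z)\<^sup>2) (r * (fst z \<bullet> snd z)))) \<in> borel_measurable lborel" for r
  proof -
    have "(\<lambda>z::'a\<times>'a. exp (Complex (- (1/2) * (norm z)\<^sup>2) (r * (fst z \<bullet> snd z)))) \<in> borel_measurable borel"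
      unfolding Complex_eq by (intro borel_measurable_continuous_onI continuous_intros)
    then show ?thesis by (simp only: measurable_lborel2)
  qed
  have "(\<lambda>n. \<integral>(z::'a\<times>'a). exp (Complex (- (1/2) * (norm z)\<^sup>2) (e n * (fst z \<bullet> snd z))) \<partial>lborel) \<longlonglongrightarrow> ?I"
  proof (rule integral_dominated_convergence[OF _ _ integrable_gaussian[of "1/2"]])
    show "AE z::'a\<times>'a in lborel. (\<lambda>n. exp (Complex (- (1/2) * (norm z)\<^sup>2) (e n * (fst z \<bullet> snd z)))) 
        \<longlonglongrightarrow> exp (Complex (- (1/2) * (norm z)\<^sup>2) (0 * (fst z \<bullet> snd z)))"
      unfolding Complex_eq by (intro AE_I2 tendsto_intros e)
    show "AE z::'a\<times>'a in lborel. norm (exp (Complex (- (1/2) * (norm z)\<^sup>2) (e n * (fst z \<bullet> snd z)))) \<le> exp (- (1/2) * (norm z)\<^sup>2)" for n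
      by (intro AE_I2) (simp only: norm_exp_eq_Re complex.sel order_refl)
  qed (rule m, rule m, simp)
  moreover have "?I = of_real ((2 * pi) ^ DIM('a))"
  proof -
    have "exp (Complex x (0 * y)) = of_real (exp x)" for x y
      by (simp only: mult_zero_left complex_of_real_def[symmetric] exp_of_real)
    then have "?I = of_real (\<integral>(z::'a\<times>'a). exp (- (1/2) * (norm z)\<^sup>2) \<partial>lborel)"
      by (simp only: integral_complex_of_real)
    also have "(\<integral>(z::'a\<times>'a). exp (- (1/2) * (norm z)\<^sup>2) \<partial>lborel) = sqrt (pi / (1/2)) ^ DIM('a\<times>'a)"
      by (rule integral_gaussian) simp
    also have "\<dots> = sqrt (2 * pi) ^ (2 * DIM('a))"
      by (simp only: DIM_prod mult_2[symmetric]) (simp add: mult.commute)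
    also have "\<dots> = (2 * pi) ^ DIM('a)"
      unfolding power_mult by simp
    finally show ?thesis .
  qed
  ultimately have "(\<lambda>n. W0 TYPE('a) (e n)) \<longlonglongrightarrow> of_real ((2 * pi) ^ DIM('a))"
    using W0_eq[OF e(1,2)] by simp
  from tendsto_norm[OF this] show ?thesis unfolding norm_of_real by simp
qed

context monotone_field begin

theorem two_pi_power_le:
  assumes \<Theta>: "\<Theta> \<in> borel_measurable borel" "\<And>t z. t > 0 \<Longrightarrow> \<Theta> (t *\<^sub>R z) = t\<^sup>2 * \<Theta> z"
    and le: "\<And>p. \<Theta> (F p) \<le> (q (fst p) + q (snd p)) / 2"
  shows "ennreal ((2 * pi) ^ DIM('a)) \<le> (\<integral>\<^sup>+z. ennreal (exp (- \<Theta> z)) \<partial>lborel)"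
proof -
  interpret idf: monotone_field "\<lambda>x::'a. x" 1 "{}" by (rule monotone_field_id)
  define c0 where "c0 = min c (monotone_field.c (\<lambda>x::'a. x))"
  have c0: "c0 > 0" using c_pos idf.c_pos by (simp add: c0_def)
  \<comment> \<open>The shift by 2 keeps every \<open>e n\<close> strictly below \<open>c0\<close>,
    as the strict bound \<epsilon> < c in \<open>norm_W0_le\<close> requires.\<close>
  define e where "e n = c0 * inverse (real (Suc (Suc n)))" for n
  have e0: "0 < e n" for n using c0 by (simp add: e_def)
  have e1: "e n < c0" for n
  proof -
    have "inverse (real (Suc (Suc n))) < 1" by (simp add: inverse_less_1_iff)
    then show ?thesis using mult_strict_left_mono[of _ 1 c0] c0 unfolding e_def by fastforce
  qed
  have "(\<lambda>n. c0 * inverse (real (Suc (Suc n)))) \<longlonglongrightarrow> c0 * 0"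
    by (rule tendsto_mult[OF tendsto_const LIMSEQ_Suc[OF LIMSEQ_inverse_real_of_nat]])
  then have lim: "e \<longlonglongrightarrow> 0" by (simp add: e_def[abs_def])
  have "(\<lambda>n. norm (W0 TYPE('a) (e n)) * (1 - e n / c) ^ DIM('a)) \<longlonglongrightarrow> (2 * pi) ^ DIM('a) * (1 - 0 / c) ^ DIM('a)"
    using e1 c_pos by (intro tendsto_intros W0_tendsto lim e0) (auto simp: c0_def less_imp_le)
  then have "(\<lambda>n. ennreal (norm (W0 TYPE('a) (e n)) * (1 - e n / c) ^ DIM('a))) \<longlonglongrightarrow> ennreal ((2 * pi) ^ DIM('a))"
    by (intro tendsto_ennrealI) simp
  then show ?thesis
    by (rule LIMSEQ_le_const2) (use norm_W0_le[OF \<Theta> le] e0 e1 in \<open>auto simp: c0_def\<close>)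
qed

end

section \<open>Volume products\<close>

definition pr :: "'a::euclidean_space set \<Rightarrow> 'a \<Rightarrow> 'a" where
  "pr J x = (\<Sum>b\<in>J. (x \<bullet> b) *\<^sub>R b)"

lemma linear_pr: "linear (pr J)"
  by (rule linearI) (auto simp: pr_def inner_add_left scaleR_add_left sum.distrib scaleR_sum_right)

lemma pr_inner:
  assumes "J \<subseteq> Basis" shows "pr J x \<bullet> y = (\<Sum>b\<in>J. (x \<bullet> b) * (y \<bullet> b))"
proof -
  have "pr J x \<bullet> y = (\<Sum>b\<in>J. (x \<bullet> b) * (b \<bullet> y))" by (simp add: pr_def inner_sum_left)
  then show ?thesis by (simp add: inner_commute)
qed

lemma pr_inner_basis:
  assumes "J \<subseteq> Basis" "b \<in> Basis" shows "pr J x \<bullet> b = (if b \<in> J then x \<bullet> b else 0)"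
proof -
  have "finite J" using assms(1) finite_Basis finite_subset by blast
  then show ?thesis using assms unfolding pr_inner[OF assms(1)]
    by (subst sum.cong[OF refl, where h="\<lambda>c. if c = b then x \<bullet> b else 0"]) (auto simp: inner_Basis subset_iff)
qed

lemma pr_sym: assumes "J \<subseteq> Basis" shows "pr J x \<bullet> y = x \<bullet> pr J y"
  using pr_inner[OF assms, of x y] pr_inner[OF assms, of y x] by (simp add: inner_commute mult.commute)

lemma pr_pr: assumes "J \<subseteq> Basis" shows "pr J (pr J x) = pr J x"
  by (rule euclidean_eqI) (simp add: pr_inner_basis assms)

lemma norm_pr_sq: assumes "J \<subseteq> Basis" shows "(norm (pr J x))\<^sup>2 = pr J x \<bullet> x"
  by (simp add: power2_norm_eq_inner pr_sym[OF assms, of _ "pr J x"] pr_pr assms inner_commute)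

lemma pr_split: assumes "J \<subseteq> Basis" shows "x = pr (Basis - J) x + pr J x"
  by (rule euclidean_eqI) (use assms in \<open>auto simp: pr_inner_basis inner_add_left\<close>)

lemma norm_pr_split: assumes "J \<subseteq> Basis" shows "(norm x)\<^sup>2 = (norm (pr (Basis - J) x))\<^sup>2 + (norm (pr J x))\<^sup>2"
proof -
  have "(norm x)\<^sup>2 = (pr (Basis - J) x + pr J x) \<bullet> x"
    using pr_split[OF assms, of x] by (simp add: power2_norm_eq_inner)
  then show ?thesis by (simp add: norm_pr_sq assms inner_add_left)
qed

section \<open>Smooth even norms and the regularised field\<close>

text \<open>The graph of t^k lies above its tangent at s. Bernoulli's inequality for even exponents
  allows t / s - 1 below -1, so the signs of s and t are free.\<close>

lemma young_even:
  assumes "even k" "k > 0"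
  shows "real k * s ^ (k - 1) * t \<le> t ^ k + real (k - 1) * s ^ k"
proof (cases "s = 0")
  case True
  then show ?thesis using assms by (cases "k = 1") (auto simp: zero_power)
next
  case False
  have "1 + real k * (t / s - 1) \<le> (1 + (t / s - 1)) ^ k"
    by (rule Bernoulli_inequality_even[OF assms(1)])
  then have "s ^ k * (1 + real k * (t / s - 1)) \<le> s ^ k * (t / s) ^ k"
    using assms by (intro mult_left_mono) (auto simp: zero_le_even_power)
  moreover have "s ^ k * (t / s) ^ k = t ^ k" using False by (simp add: power_divide)
  moreover have "s ^ k * (1 + real k * (t / s - 1)) = s ^ k + real k * (s ^ (k - 1) * t) - real k * s ^ k"
  proof -
    have e: "s ^ k * (t / s) = s ^ (k - 1) * t" using False assms by (cases k) auto
    have "s ^ k * (1 + real k * (t / s - 1)) = s ^ k + real k * (s ^ k * (t / s)) - real k * s ^ k"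
      by (simp only: algebra_simps)
    then show ?thesis unfolding e .
  qed
  ultimately have "s ^ k + real k * (s ^ (k - 1) * t) - real k * s ^ k \<le> t ^ k"
    by linarith
  moreover have "real (k - 1) = real k - 1" using assms by (simp add: of_nat_diff)
  ultimately show ?thesis by (simp add: algebra_simps)
qed

text \<open>\<open>G\<close> is the gradient of \<open>N\<^sup>2 / 2\<close>, where \<open>N\<close> is a smooth norm close to \<open>x \<mapsto> max {\<bar>y \<bullet> x\<bar> | y \<in> Y}\<close> for
  large \<open>m\<close>.\<close>

locale even_norm =
  fixes Y :: "'a::euclidean_space set" and m :: nat
  assumes fin: "finite Y" and m: "m > 0"
begin

definition \<sigma> :: "'a \<Rightarrow> real" where "\<sigma> x = (\<Sum>y\<in>Y. (y \<bullet> x) ^ (2 * m))"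
definition N :: "'a \<Rightarrow> real" where "N x = \<sigma> x powr (1 / (2 * m))"
definition G :: "'a \<Rightarrow> 'a" where "G x = \<sigma> x powr (1 / m - 1) *\<^sub>R (\<Sum>y\<in>Y. (y \<bullet> x) ^ (2 * m - 1) *\<^sub>R y)"

lemma \<sigma>_nonneg: "\<sigma> x \<ge> 0"
  unfolding \<sigma>_def by (intro sum_nonneg) (simp add: zero_le_even_power)

lemma \<sigma>_eq_0: "\<sigma> x = 0 \<longleftrightarrow> (\<forall>y\<in>Y. y \<bullet> x = 0)"
  unfolding \<sigma>_def using fin m by (subst sum_nonneg_eq_0_iff) (auto simp: zero_le_even_power)

lemma N_nonneg: "N x \<ge> 0" by (simp add: N_def)

lemma N_power: "N x ^ (2 * m) = \<sigma> x"
  using \<sigma>_nonneg[of x] m by (cases "\<sigma> x = 0") (auto simp: N_def powr_powr powr_realpow[symmetric] zero_power)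

lemma N_sq: "(N x)\<^sup>2 = \<sigma> x powr (1 / m)"
  using \<sigma>_nonneg[of x] m by (cases "\<sigma> x = 0") (auto simp: N_def powr_powr powr_realpow[symmetric])

lemma inner_le_N: assumes "y \<in> Y" shows "\<bar>y \<bullet> x\<bar> \<le> N x"
proof -
  have "\<bar>y \<bullet> x\<bar> ^ (2 * m) = (y \<bullet> x) ^ (2 * m)" by (simp add: power_even_abs)
  also have "\<dots> \<le> \<sigma> x" unfolding \<sigma>_def by (rule member_le_sum[OF assms]) (auto simp: fin zero_le_even_power)
  also have "\<dots> = N x ^ (2 * m)" by (simp add: N_power)
  finally show ?thesis using N_nonneg m by (meson power_mono_iff abs_ge_zero mult_pos_pos zero_less_numeral power_le_imp_le_base power_less_imp_less_base not_le)
qed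

lemma N_le: assumes "\<And>y. y \<in> Y \<Longrightarrow> \<bar>y \<bullet> x\<bar> \<le> 1" shows "(N x)\<^sup>2 \<le> real (card Y) powr (1 / m)"
proof -
  have "\<sigma> x \<le> (\<Sum>y\<in>Y. 1)" unfolding \<sigma>_def
    using assms by (intro sum_mono) (metis power_even_abs even_mult_iff even_numeral power_le_one abs_ge_zero)
  then show ?thesis unfolding N_sq using \<sigma>_nonneg[of x] m by (intro powr_mono2) auto
qed

lemma N_scale: "N (t *\<^sub>R x) = \<bar>t\<bar> * N x"
proof -
  have "\<sigma> (t *\<^sub>R x) = t ^ (2*m) * \<sigma> x" by (simp add: \<sigma>_def power_mult_distrib sum_distrib_left)
  then have "(N (t *\<^sub>R x)) ^ (2 * m) = (\<bar>t\<bar> * N x) ^ (2 * m)" by (simp add: N_power power_mult_distrib power_even_abs)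
  then show ?thesis by (rule power_eq_imp_eq_base) (use N_nonneg m in auto)
qed

text \<open>Hoelder's inequality for the exponents 2 m and 2 m / (2 m - 1): normalise both families
  to norm 1 and sum \<open>young_even\<close>.\<close>

lemma holder: "(\<Sum>y\<in>Y. (y \<bullet> x) ^ (2 * m - 1) * (y \<bullet> u)) \<le> N x ^ (2 * m - 1) * N u"
proof (cases "N x = 0 \<or> N u = 0")
  case True
  then have "\<sigma> x = 0 \<or> \<sigma> u = 0" by (metis N_power m mult_pos_pos zero_less_numeral zero_power)
  then have "(\<Sum>y\<in>Y. (y \<bullet> x) ^ (2 * m - 1) * (y \<bullet> u)) = 0"
    using m by (auto simp: \<sigma>_eq_0 zero_power)
  then show ?thesis using N_nonneg by simp
next
  case False
  let ?k = "2 * m" let ?s = "N x" let ?t = "N u"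
  have pos: "?s > 0" "?t > 0" using False N_nonneg by (auto simp: less_le)
  have k: "even ?k" "?k > 0" using m by auto
  have "(\<Sum>y\<in>Y. real ?k * ((y \<bullet> x) / ?s) ^ (?k - 1) * ((y \<bullet> u) / ?t)) \<le> (\<Sum>y\<in>Y. ((y \<bullet> u) / ?t) ^ ?k + real (?k - 1) * ((y \<bullet> x) / ?s) ^ ?k)"
    by (intro sum_mono young_even k)
  also have "\<dots> = \<sigma> u / ?t ^ ?k + real (?k - 1) * (\<sigma> x / ?s ^ ?k)"
    by (simp add: sum.distrib power_divide sum_divide_distrib \<sigma>_def sum_distrib_left)
  also have "\<dots> = real ?k"
    unfolding N_power[symmetric] using pos k by (simp add: of_nat_diff)
  finally have "real ?k * (\<Sum>y\<in>Y. ((y \<bullet> x) / ?s) ^ (?k - 1) * ((y \<bullet> u) / ?t)) \<le> real ?k * 1"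
    by (simp add: sum_distrib_left mult.assoc)
  then have "(\<Sum>y\<in>Y. ((y \<bullet> x) / ?s) ^ (?k - 1) * ((y \<bullet> u) / ?t)) \<le> 1"
    using m by (simp only: mult_le_cancel_left_pos) 
  moreover have "(\<Sum>y\<in>Y. ((y \<bullet> x) / ?s) ^ (?k - 1) * ((y \<bullet> u) / ?t)) = (\<Sum>y\<in>Y. (y \<bullet> x) ^ (?k - 1) * (y \<bullet> u)) / (?s ^ (?k - 1) * ?t)"
    by (simp add: power_divide sum_divide_distrib)
  ultimately show ?thesis using pos by (simp add: divide_le_eq)
qed

lemma G_inner_le: "G x \<bullet> u \<le> N x * N u"
proof (cases "\<sigma> x = 0")
  case True then show ?thesis using N_nonneg by (simp add: G_def)
next
  case False
  then have s: "\<sigma> x > 0" using \<sigma>_nonneg[of x] by simp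
  have "G x \<bullet> u = \<sigma> x powr (1/m - 1) * (\<Sum>y\<in>Y. (y \<bullet> x) ^ (2 * m - 1) * (y \<bullet> u))"
    by (simp add: G_def inner_sum_left)
  also have "\<dots> \<le> \<sigma> x powr (1/m - 1) * (N x ^ (2 * m - 1) * N u)"
    by (intro mult_left_mono holder) auto
  also have "\<sigma> x powr (1/m - 1) = (N x)\<^sup>2 / N x ^ (2 * m)"
    using s unfolding N_power N_sq by (simp add: powr_diff)
  also have "(N x)\<^sup>2 / N x ^ (2 * m) * (N x ^ (2 * m - 1) * N u) = N x * N u"
  proof -
    have "N x \<noteq> 0" using s by (simp add: N_def)
    moreover have "N x ^ (2 * m) = N x * N x ^ (2 * m - 1)" using m by (cases "2 * m") auto
    ultimately show ?thesis by (simp add: power2_eq_square)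
  qed
  finally show ?thesis .
qed

lemma G_inner_self: "G x \<bullet> x = (N x)\<^sup>2"
proof (cases "\<sigma> x = 0")
  case True then show ?thesis by (simp add: G_def N_def)
next
  case False
  then have s: "\<sigma> x > 0" using \<sigma>_nonneg[of x] by simp
  have "G x \<bullet> x = \<sigma> x powr (1/m - 1) * (\<Sum>y\<in>Y. (y \<bullet> x) ^ (2 * m - 1) * (y \<bullet> x))"
    by (simp add: G_def inner_sum_left)
  also have "(\<Sum>y\<in>Y. (y \<bullet> x) ^ (2 * m - 1) * (y \<bullet> x)) = \<sigma> x"
    unfolding \<sigma>_def using m by (intro sum.cong refl) (simp add: power_Suc2[symmetric] del: power_Suc)
  also have "\<sigma> x powr (1/m - 1) * \<sigma> x = (N x)\<^sup>2" using s unfolding N_sq by (simp add: powr_diff)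
  finally show ?thesis .
qed

lemma G_hom: assumes "t > 0" shows "G (t *\<^sub>R x) = t *\<^sub>R G x"
proof (cases "\<sigma> x = 0")
  case True
  moreover have "\<sigma> (t *\<^sub>R x) = 0" using True by (simp add: \<sigma>_eq_0)
  ultimately show ?thesis by (simp add: G_def)
next
  case False
  then have s: "\<sigma> x > 0" using \<sigma>_nonneg[of x] by simp
  have "\<sigma> (t *\<^sub>R x) = t ^ (2*m) * \<sigma> x" by (simp add: \<sigma>_def power_mult_distrib sum_distrib_left)
  then have "\<sigma> (t *\<^sub>R x) powr (1/m - 1) = (t ^ (2*m)) powr (1/m - 1) * \<sigma> x powr (1/m - 1)"
    using assms s by (simp add: powr_mult)
  also have "(t ^ (2*m)) powr (1/m - 1) = t powr (real (2 * m) * (1/m - 1))"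
    using assms by (simp add: powr_realpow[symmetric] powr_powr)
  also have "real (2 * m) * (1/m - 1) = 1 - real (2 * m - 1)" using m by (simp add: of_nat_diff field_simps)
  also have "t powr (1 - real (2 * m - 1)) = t / t ^ (2 * m - 1)"
    using assms by (simp add: powr_diff powr_realpow)
  finally have 1: "\<sigma> (t *\<^sub>R x) powr (1/m - 1) = t / t ^ (2 * m - 1) * \<sigma> x powr (1/m - 1)" by simp
  have 2: "(\<Sum>y\<in>Y. (y \<bullet> (t *\<^sub>R x)) ^ (2 * m - 1) *\<^sub>R y) = t ^ (2 * m - 1) *\<^sub>R (\<Sum>y\<in>Y. (y \<bullet> x) ^ (2 * m - 1) *\<^sub>R y)"
    by (simp add: power_mult_distrib scaleR_sum_right)
  show ?thesis unfolding G_def 1 2 using assms by simp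
qed

text \<open>By Hoelder's inequality the right-hand side is at least (N x - N y)^2.\<close>

lemma G_mono: "0 \<le> (G x - G y) \<bullet> (x - y)"
proof -
  have "(G x - G y) \<bullet> (x - y) = (N x)\<^sup>2 + (N y)\<^sup>2 - G x \<bullet> y - G y \<bullet> x"
    by (simp add: inner_diff_left inner_diff_right G_inner_self)
  moreover have "G x \<bullet> y \<le> N x * N y" "G y \<bullet> x \<le> N x * N y" using G_inner_le[of x y] G_inner_le[of y x] by (simp_all add: mult.commute)
  moreover have "0 \<le> (N x - N y)\<^sup>2" by simp
  ultimately show ?thesis by (simp add: power2_diff)
qed

lemma \<sigma>_cont: "continuous_on UNIV \<sigma>"
  unfolding \<sigma>_def by (intro continuous_intros)

lemma N_cont: "continuous_on UNIV N"
  unfolding N_def using \<sigma>_cont m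
  by (intro continuous_on_powr' continuous_intros) (auto simp: \<sigma>_nonneg)

lemma G_bound: "\<exists>K. \<forall>x. norm (G x) \<le> K * N x"
proof -
  have "compact (N ` sphere 0 1)" by (intro compact_continuous_image continuous_on_subset[OF N_cont]) auto
  then obtain K where K: "\<And>x. norm x = 1 \<Longrightarrow> norm (N x) \<le> K"
    using bounded_iff[of "N ` sphere 0 1"] compact_imp_bounded by (metis dist_0_norm image_eqI mem_sphere)
  have NK: "N x \<le> K * norm x" for x
  proof (cases "x = 0")
    case True then show ?thesis using m by (simp add: N_def \<sigma>_def zero_power)
  next
    case False
    have "N x = norm x * N (x /\<^sub>R norm x)" using False N_scale[of "norm x" "x /\<^sub>R norm x"] by simp
    moreover have "N (x /\<^sub>R norm x) \<le> K" using K[of "x /\<^sub>R norm x"] False by simp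
    ultimately show ?thesis by (metis mult.commute mult_left_mono norm_ge_zero)
  qed
  have "norm (G x) \<le> K * N x" for x
  proof (cases "G x = 0")
    case True
    have "0 \<le> K" using K[of "SOME b. b \<in> Basis"] norm_Basis[OF SOME_Basis] norm_ge_zero order_trans by metis
    then show ?thesis using True N_nonneg by simp
  next
    case False
    have "norm (G x) * norm (G x) = G x \<bullet> G x" by (simp add: power2_norm_eq_inner[symmetric] power2_eq_square)
    also have "\<dots> \<le> N x * N (G x)" by (rule G_inner_le)
    also have "\<dots> \<le> N x * (K * norm (G x))" using N_nonneg NK by (intro mult_left_mono)
    finally show ?thesis using False by (simp add: mult_ac)
  qed
  then show ?thesis by blast
qed

lemma G_differentiable: assumes "\<sigma> x \<noteq> 0" shows "G differentiable (at x)"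
proof -
  have s: "\<sigma> x > 0" using assms \<sigma>_nonneg[of x] by simp
  have "(\<sigma> has_derivative (\<lambda>h. \<Sum>y\<in>Y. real (2 * m) * (y \<bullet> h) * (y \<bullet> x) ^ (2 * m - 1))) (at x)"
    unfolding \<sigma>_def by (auto intro!: derivative_eq_intros sum.cong simp: mult_ac)
  then obtain D where D: "(\<sigma> has_derivative D) (at x)" by blast
  have 1: "(\<lambda>x. \<sigma> x powr (1/m - 1)) differentiable (at x)"
    unfolding differentiable_def using has_derivative_powr[OF D has_derivative_const s, of "1/m - 1"] by auto
  have "((\<lambda>x. \<Sum>y\<in>Y. (y \<bullet> x) ^ (2 * m - 1) *\<^sub>R y) has_derivative 
     (\<lambda>h. \<Sum>y\<in>Y. (real (2 * m - 1) * (y \<bullet> h) * (y \<bullet> x) ^ (2 * m - 1 - 1)) *\<^sub>R y)) (at x)"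
    by (auto intro!: derivative_eq_intros sum.cong simp: mult_ac)
  then have 2: "(\<lambda>x. \<Sum>y\<in>Y. (y \<bullet> x) ^ (2 * m - 1) *\<^sub>R y) differentiable (at x)" unfolding differentiable_def by blast
  show ?thesis unfolding G_def using differentiable_scaleR[OF 1 2] .
qed

text \<open>Where \<sigma> vanishes, the power of \<sigma> in \<open>G\<close> can have a negative
  exponent, so the defining product says nothing about limits. There \<open>G\<close> vanishes and
  is dominated by a multiple of the continuous function \<open>N\<close>.\<close>

lemma G_cont: "continuous_on UNIV G"
proof -
  have "isCont G x" for x
  proof (cases "\<sigma> x = 0")
    case False then show ?thesis using G_differentiable differentiable_imp_continuous_within by blast
  next
    case True
    then have G0: "G x = 0" and N0: "N x = 0" by (simp_all add: G_def N_def)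
    obtain K where K: "\<And>x. norm (G x) \<le> K * N x" using G_bound by blast
    have "isCont N x" using N_cont by (simp add: continuous_on_eq_continuous_at)
    then have "((\<lambda>z. K * N z) \<longlongrightarrow> K * N x) (at x)" unfolding isCont_def by (intro tendsto_intros)
    then have "((\<lambda>z. K * N z) \<longlongrightarrow> 0) (at x)" by (simp add: N0)
    then have "(G \<longlongrightarrow> 0) (at x)" by (rule Lim_null_comparison[rotated]) (use K in auto)
    then show ?thesis unfolding isCont_def by (simp add: G0)
  qed
  then show ?thesis by (simp add: continuous_on_eq_continuous_at)
qed

end

text \<open>\<open>G\<close> is only monotone; the \<delta>-term makes it strongly monotone on the
  span of \<open>I\<close>. On the span of \<open>A\<close> the field is the identity, so these
  directions contribute pure Gaussian factors and the inequality obtained is one in dimension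
  \<open>card I\<close>.\<close>

locale bm_norm = even_norm +
  fixes A :: "'a set" and \<delta> :: real
  assumes A: "A \<subseteq> Basis" and Y_perp: "y \<in> Y \<Longrightarrow> a \<in> A \<Longrightarrow> y \<bullet> a = 0"
    and Y_nz: "\<exists>y\<in>Y. y \<noteq> 0" and \<delta>: "\<delta> > 0"
begin

abbreviation "I \<equiv> Basis - A"

definition g :: "'a \<Rightarrow> 'a" where "g x = G x + \<delta> *\<^sub>R pr I x + pr A x"
definition \<nu> :: "'a \<Rightarrow> real" where "\<nu> x = sqrt ((N x)\<^sup>2 + \<delta> * (norm (pr I x))\<^sup>2)"

lemma I: "I \<subseteq> Basis" by blast

lemma g_diff: "g x - g y = (G x - G y) + \<delta> *\<^sub>R pr I (x - y) + pr A (x - y)"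
  by (simp add: g_def linear_diff[OF linear_pr] algebra_simps)

sublocale field: monotone_field g "min \<delta> 1" "{x. \<sigma> x = 0}"
proof
  show "min \<delta> 1 > 0" using \<delta> by simp
  show "g (t *\<^sub>R x) = t *\<^sub>R g x" if "t > 0" for t x
    by (simp add: g_def G_hom[OF that] linear_scale[OF linear_pr] algebra_simps)
  show "min \<delta> 1 * (norm (x - y))\<^sup>2 \<le> (g x - g y) \<bullet> (x - y)" for x y
  proof -
    have "min \<delta> 1 * (norm (x - y))\<^sup>2 = min \<delta> 1 * (norm (pr I (x - y)))\<^sup>2 + min \<delta> 1 * (norm (pr A (x - y)))\<^sup>2"
      using norm_pr_split[OF A, of "x - y"] by (simp add: algebra_simps)
    also have "\<dots> \<le> \<delta> * (norm (pr I (x - y)))\<^sup>2 + 1 * (norm (pr A (x - y)))\<^sup>2"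
      by (intro add_mono mult_right_mono) auto
    also have "\<dots> \<le> (g x - g y) \<bullet> (x - y)"
      unfolding g_diff using G_mono[of x y] by (simp add: inner_add_left norm_pr_sq[OF A] norm_pr_sq[OF I])
    finally show ?thesis .
  qed
  show "continuous_on UNIV g" unfolding g_def
    by (intro continuous_intros G_cont linear_continuous_on linear_conv_bounded_linear[THEN iffD1] linear_pr)
  have "closed (\<sigma> -` {0})" using \<sigma>_cont by (intro closed_vimage) auto
  then show "closed {x. \<sigma> x = 0}" by (simp add: vimage_def)
  obtain y where y: "y \<in> Y" "y \<noteq> 0" using Y_nz by blast
  have "{x. \<sigma> x = 0} \<subseteq> {x. y \<bullet> x = 0}" using y by (auto simp: \<sigma>_eq_0)
  moreover have "negligible {x. y \<bullet> x = 0}" using y by (intro negligible_hyperplane) auto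
  ultimately show "negligible {x. \<sigma> x = 0}" using negligible_subset by blast
  show "t *\<^sub>R x \<in> {x. \<sigma> x = 0}" if "t > 0" "x \<in> {x. \<sigma> x = 0}" for t x using that by (simp add: \<sigma>_eq_0)
  have d1: "(\<lambda>x. \<delta> *\<^sub>R pr I x + pr A x) differentiable (at x within S)" for x S
    by (intro derivative_intros linear_imp_differentiable linear_pr)
  \<comment> \<open>On the exceptional set \<open>G\<close> is 0, so the field agrees there with a
    linear map; this gives differentiability along that set.\<close>
  have e: "g x = \<delta> *\<^sub>R pr I x + pr A x" if "\<sigma> x = 0" for x using that by (simp add: g_def G_def)
  show "g differentiable_on {x. \<sigma> x = 0}"
    unfolding differentiable_on_def
    by (intro ballI differentiable_transform_within[OF d1 zero_less_one]) (auto simp: e)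
  show "g differentiable (at x)" if "x \<notin> {x. \<sigma> x = 0}" for x
  proof -
    have "(\<lambda>x. G x + (\<delta> *\<^sub>R pr I x + pr A x)) differentiable (at x)"
      using that by (intro differentiable_add G_differentiable d1) auto
    then show ?thesis by (simp add: g_def[abs_def] add.assoc)
  qed
qed

lemma \<nu>_nonneg: "\<nu> x \<ge> 0" and \<nu>_sq: "(\<nu> x)\<^sup>2 = (N x)\<^sup>2 + \<delta> * (norm (pr I x))\<^sup>2"
  using \<delta> by (simp_all add: \<nu>_def)

text \<open>The gradient of half of \<open>\<nu>\<close> squared at x has dual norm at most
  \<open>\<nu> x\<close>. The two summands are combined by Cauchy-Schwarz in the plane.\<close>

lemma I_part_inner_le: "(G x + \<delta> *\<^sub>R pr I x) \<bullet> u \<le> \<nu> x * \<nu> u"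
proof -
  have "(G x + \<delta> *\<^sub>R pr I x) \<bullet> u = G x \<bullet> u + \<delta> * (pr I x \<bullet> pr I u)"
    by (simp add: inner_add_left pr_sym[OF I, of x, symmetric] pr_pr pr_sym[OF I, of "pr I x"])
      (metis pr_pr pr_sym I)
  also have "\<dots> \<le> N x * N u + \<delta> * (norm (pr I x) * norm (pr I u))"
    using \<delta> by (intro add_mono G_inner_le mult_left_mono norm_cauchy_schwarz) auto
  also have "\<dots> = (N x, sqrt \<delta> * norm (pr I x)) \<bullet> (N u, sqrt \<delta> * norm (pr I u))"
    using \<delta> by (simp add: algebra_simps)
  also have "\<dots> \<le> norm (N x, sqrt \<delta> * norm (pr I x)) * norm (N u, sqrt \<delta> * norm (pr I u))"
    by (rule norm_cauchy_schwarz)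
  also have "\<dots> = \<nu> x * \<nu> u"
    using \<delta> by (simp add: \<nu>_def norm_Pair power_mult_distrib)
  finally show ?thesis .
qed

lemma I_part_inner_self: "(G x + \<delta> *\<^sub>R pr I x) \<bullet> x = (\<nu> x)\<^sup>2"
  by (simp add: \<nu>_sq inner_add_left G_inner_self norm_pr_sq[OF I])

lemma \<nu>_triangle: "\<nu> (x + y) \<le> \<nu> x + \<nu> y"
proof -
  have "(\<nu> (x + y))\<^sup>2 \<le> \<nu> (x + y) * (\<nu> x + \<nu> y)"
    unfolding I_part_inner_self[symmetric] 
    using I_part_inner_le[of "x + y" x] I_part_inner_le[of "x + y" y] by (simp add: inner_add_right algebra_simps)
  then show ?thesis using \<nu>_nonneg[of "x + y"] \<nu>_nonneg[of x] \<nu>_nonneg[of y]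
    by (cases "\<nu> (x + y) = 0") (auto simp: power2_eq_square)
qed

lemma q_eq: "field.q x = 2 * ((\<nu> x)\<^sup>2 + (norm (pr A x))\<^sup>2)"
proof -
  have "g x \<bullet> x = (\<nu> x)\<^sup>2 + (norm (pr A x))\<^sup>2"
    unfolding I_part_inner_self[symmetric] by (simp add: g_def inner_add_left norm_pr_sq[OF A])
  then show ?thesis by (simp add: field.q_def inner_commute)
qed

lemma G_perp: "pr A (G x) = 0"
proof (rule euclidean_eqI)
  fix b :: 'a assume b: "b \<in> Basis"
  show "pr A (G x) \<bullet> b = 0 \<bullet> b"
    using b Y_perp by (auto simp: pr_inner_basis[OF A] G_def inner_sum_left intro!: sum.neutral)
qed

lemma pr_A_I: "pr A (pr I x) = 0" 
  by (rule euclidean_eqI) (use A in \<open>auto simp: pr_inner_basis\<close>)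

text \<open>The first component x + x' of \<open>F\<close> is bounded by the triangle inequality for
  \<open>\<nu>\<close>. The second is bounded by duality, since the \<open>I\<close>-parts of g x
  and g x' have dual norms at most \<open>\<nu> x\<close> and \<open>\<nu> x'\<close>. Both bounds
  are s = \<nu> x + \<nu> x', up to \<rho>, and s^2 <= 2 ((\<nu> x)^2 + (\<nu> x')^2). In the
  \<open>A\<close>-directions the parallelogram law gives equality.\<close>

lemma lower_bound:
  fixes p h :: "'a \<Rightarrow> real"
  assumes p: "\<And>x. p x \<le> \<nu> x" "\<And>x. 0 \<le> p x" and h0: "\<And>x. 0 \<le> h x"
    and h: "\<And>y s. 0 \<le> s \<Longrightarrow> (\<And>u. y \<bullet> pr I u \<le> s * \<nu> u) \<Longrightarrow> h y \<le> \<rho> * s" and \<rho>: "\<rho> > 0"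
  shows "(max (p (fst (field.F z))) (h (snd (field.F z)) / \<rho>))\<^sup>2 / 2
     + ((norm (pr A (fst (field.F z))))\<^sup>2 + (norm (pr A (snd (field.F z))))\<^sup>2) / 2
     \<le> (field.q (fst z) + field.q (snd z)) / 2"
proof -
  obtain x x' where z: "z = (x, x')" by (cases z)
  have F: "fst (field.F z) = x + x'" "snd (field.F z) = g x - g x'" by (simp_all add: field.F_def z)
  let ?s = "\<nu> x + \<nu> x'"
  have "pr A (g x - g x') = pr A x - pr A x'"
    by (simp add: g_diff linear_diff[OF linear_pr] linear_add[OF linear_pr]
        linear_scale[OF linear_pr] G_perp pr_A_I pr_pr[OF A])
  then have nA: "(norm (pr A (x + x')))\<^sup>2 + (norm (pr A (g x - g x')))\<^sup>2 = 2 * ((norm (pr A x))\<^sup>2 + (norm (pr A x'))\<^sup>2)"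
    by (simp add: linear_add[OF linear_pr] power2_norm_eq_inner inner_add_left inner_add_right inner_diff_left inner_diff_right)
  have "p (x + x') \<le> ?s" using p(1)[of "x + x'"] \<nu>_triangle[of x x'] by linarith
  moreover have "h (g x - g x') / \<rho> \<le> ?s"
  proof -
    have "h (g x - g x') \<le> \<rho> * ?s"
    proof (rule h)
      show "0 \<le> ?s" using \<nu>_nonneg by (simp add: add_nonneg_nonneg)
      fix u
      have "(g x - g x') \<bullet> pr I u = (G x + \<delta> *\<^sub>R pr I x) \<bullet> pr I u + (G x' + \<delta> *\<^sub>R pr I x') \<bullet> (- pr I u)"
      proof -
        have "pr A v \<bullet> pr I u = 0" for v using pr_sym[OF A, of v "pr I u"] by (simp add: pr_A_I)
        then show ?thesis by (simp add: g_def inner_add_left inner_diff_left)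
      qed
      also have "\<dots> \<le> \<nu> x * \<nu> (pr I u) + \<nu> x' * \<nu> (- pr I u)" by (intro add_mono I_part_inner_le)
      also have "\<nu> (- pr I u) = \<nu> (pr I u)" using N_scale[of "-1" "pr I u"] by (simp add: \<nu>_def linear_neg[OF linear_pr])
      also have "\<nu> (pr I u) = \<nu> u"
      proof -
        have "y \<bullet> pr I u = y \<bullet> u" if "y \<in> Y" for y
        proof -
          have "y \<bullet> pr A u = 0" using Y_perp[OF that] by (simp add: pr_def inner_sum_right)
          moreover have "y \<bullet> u = y \<bullet> pr I u + y \<bullet> pr A u" using pr_split[OF A, of u] by (metis inner_add_right)
          ultimately show ?thesis by simp
        qed
        then have "\<sigma> (pr I u) = \<sigma> u" by (simp add: \<sigma>_def)
        then show ?thesis by (simp add: \<nu>_def N_def pr_pr)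
      qed
      finally show "(g x - g x') \<bullet> pr I u \<le> ?s * \<nu> u" by (simp add: algebra_simps)
    qed
    then show ?thesis using \<rho> by (simp add: divide_le_eq mult.commute)
  qed
  ultimately have "max (p (x + x')) (h (g x - g x') / \<rho>) \<le> ?s" by simp
  moreover have "0 \<le> max (p (x + x')) (h (g x - g x') / \<rho>)" using p(2) by (simp add: le_max_iff_disj)
  ultimately have "(max (p (x + x')) (h (g x - g x') / \<rho>))\<^sup>2 \<le> ?s\<^sup>2" by (intro power_mono)
  also have "?s\<^sup>2 \<le> 2 * ((\<nu> x)\<^sup>2 + (\<nu> x')\<^sup>2)"
    using zero_le_power2[of "\<nu> x - \<nu> x'"] by (simp add: power2_sum power2_diff)
  finally have fin: "(max (p (x + x')) (h (g x - g x') / \<rho>))\<^sup>2 \<le> 2 * ((\<nu> x)\<^sup>2 + (\<nu> x')\<^sup>2)" .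
  have aux: "X / 2 + 2 * (c + d) / 2 \<le> (2 * (a + c) + 2 * (b + d)) / 2" if "X \<le> 2 * (a + b)" for X a b c d :: real
    using that by (simp add: field_simps)
  show ?thesis unfolding F nA unfolding z fst_conv snd_conv q_eq by (rule aux[OF fin])
qed

end

section \<open>Integrals of functions constant along coordinate directions\<close>

text \<open>\<open>K\<close>, the integral over the coordinates outside \<open>A\<close>, is
  quantified before \<open>k\<close> so that two weights along \<open>A\<close> can be compared with
  each other: Gaussians and indicators of the unit interval.\<close>

lemma nn_integral_split:
  fixes u :: "'a::euclidean_space \<Rightarrow> ennreal" and A :: "'a set"
  assumes A: "A \<subseteq> Basis" and u: "u \<in> borel_measurable borel" "\<And>x. u x = u (pr (Basis - A) x)"
  shows "\<exists>K. \<forall>k. (\<forall>a\<in>A. k a \<in> borel_measurable borel) \<longrightarrow>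
     (\<integral>\<^sup>+x. u x * (\<Prod>a\<in>A. k a (x \<bullet> a)) \<partial>lborel) = K * (\<Prod>a\<in>A. \<integral>\<^sup>+t. k a t \<partial>lborel)"
proof -
  interpret P: product_sigma_finite "\<lambda>_::'a. lborel :: real measure" by standard
  let ?I = "Basis - A"
  define J where "J L f = (\<Sum>b\<in>L. f b *\<^sub>R b)" for L :: "'a set" and f :: "'a \<Rightarrow> real"
  have fin: "finite A" "finite ?I" using finite_subset[OF A finite_Basis] by auto
  have Jb: "J Basis f \<bullet> a = f a" if "a \<in> Basis" for f a
    using that by (simp add: J_def inner_sum_left_Basis)
  have prJ: "pr ?I (J Basis f) = J ?I f" for f
    unfolding pr_def J_def[of ?I] by (rule sum.cong) (auto simp: Jb)
  have mJ: "J L \<in> borel_measurable (PiM L' (\<lambda>_. lborel))" if "L \<subseteq> L'" for L L'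
    unfolding J_def
  proof (rule borel_measurable_sum)
    fix b assume "b \<in> L"
    then have "(\<lambda>f. f b) \<in> measurable (PiM L' (\<lambda>_. lborel)) (lborel :: real measure)"
      using that by (intro measurable_component_singleton) auto
    then have "(\<lambda>f. f b) \<in> borel_measurable (PiM L' (\<lambda>_. lborel :: real measure))"
      by (simp only: measurable_lborel1)
    then show "(\<lambda>f. f b *\<^sub>R b) \<in> borel_measurable (PiM L' (\<lambda>_. lborel :: real measure))"
      by (rule borel_measurable_scaleR) simp
  qed
  have mu: "(\<lambda>f. u (J L f)) \<in> borel_measurable (PiM L' (\<lambda>_. lborel))" if "L \<subseteq> L'" for L L'
    by (rule measurable_compose[OF mJ[OF that] u(1)])
  note [measurable] = u(1)
  define K where "K = (\<integral>\<^sup>+x. u (J ?I x) \<partial>PiM ?I (\<lambda>_. lborel))"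
  have "(\<integral>\<^sup>+x. u x * (\<Prod>a\<in>A. k a (x \<bullet> a)) \<partial>lborel) = K * (\<Prod>a\<in>A. \<integral>\<^sup>+t. k a t \<partial>lborel)"
    if k: "\<forall>a\<in>A. k a \<in> borel_measurable borel" for k
  proof -
    have k' [measurable]: "a \<in> A \<Longrightarrow> k a \<in> borel_measurable borel" for a using k by blast
    have B: "?I \<union> A = Basis" using A by blast
    have [measurable]: "(\<lambda>x. \<Prod>a\<in>A. k a (x \<bullet> a)) \<in> borel_measurable borel"
    proof (rule borel_measurable_prod_ennreal)
      fix a assume "a \<in> A"
      from k'[OF this] show "(\<lambda>x. k a (x \<bullet> a)) \<in> borel_measurable borel"
        by (rule measurable_compose[rotated]) simp
    qed
    have mk: "(\<lambda>f. \<Prod>a\<in>A. k a (f a)) \<in> borel_measurable (PiM L (\<lambda>_. lborel))" if "A \<subseteq> L" for L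
    proof (rule borel_measurable_prod_ennreal)
      fix a assume a: "a \<in> A"
      have "(\<lambda>f. f a) \<in> measurable (PiM L (\<lambda>_. lborel)) (lborel :: real measure)"
        using that a by (intro measurable_component_singleton) auto
      moreover have "k a \<in> measurable (lborel :: real measure) borel" using k'[OF a] by (simp only: measurable_lborel2)
      ultimately show "(\<lambda>f. k a (f a)) \<in> borel_measurable (PiM L (\<lambda>_. lborel))"
        by (rule measurable_compose)
    qed
    have m: "(\<lambda>f. u (J ?I f) * (\<Prod>a\<in>A. k a (f a))) \<in> borel_measurable (PiM (?I \<union> A) (\<lambda>_. lborel))"
    proof (intro borel_measurable_times_ennreal)
      show "(\<lambda>f. u (J ?I f)) \<in> borel_measurable (PiM (?I \<union> A) (\<lambda>_. lborel))"
        by (rule mu) auto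
      show "(\<lambda>f. \<Prod>a\<in>A. k a (f a)) \<in> borel_measurable (PiM (?I \<union> A) (\<lambda>_. lborel))"
        by (rule mk) auto
    qed
    have "(\<integral>\<^sup>+x. u x * (\<Prod>a\<in>A. k a (x \<bullet> a)) \<partial>lborel) = (\<integral>\<^sup>+f. u (J Basis f) * (\<Prod>a\<in>A. k a (J Basis f \<bullet> a)) \<partial>PiM Basis (\<lambda>_. lborel))"
    proof -
      have d: "lborel = distr (PiM Basis (\<lambda>_. lborel)) borel (J Basis)"
        unfolding J_def by (rule lborel_eq)
      have Q: "(\<lambda>x. u x * (\<Prod>a\<in>A. k a (x \<bullet> a))) \<in> borel_measurable borel"
        by measurable
      have mB: "J Basis \<in> borel_measurable (PiM Basis (\<lambda>_. lborel))" by (rule mJ) simp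
      show ?thesis by (subst d, rule nn_integral_distr[OF mB]) (simp only: measurable_distr_eq1 Q)
    qed
    also have "\<dots> = (\<integral>\<^sup>+f. u (J ?I f) * (\<Prod>a\<in>A. k a (f a)) \<partial>PiM (?I \<union> A) (\<lambda>_. lborel))"
      unfolding B using A by (intro nn_integral_cong arg_cong2[where f="(*)"] prod.cong) (auto simp: Jb subset_iff u(2)[of "J Basis _"] prJ)
    also have "\<dots> = (\<integral>\<^sup>+x. (\<integral>\<^sup>+y. u (J ?I (merge ?I A (x, y))) * (\<Prod>a\<in>A. k a (merge ?I A (x, y) a)) \<partial>PiM A (\<lambda>_. lborel)) \<partial>PiM ?I (\<lambda>_. lborel))"
      by (rule P.product_nn_integral_fold[OF _ fin(2) fin(1) m]) blast
    also have "\<dots> = (\<integral>\<^sup>+x. (\<integral>\<^sup>+y. u (J ?I x) * (\<Prod>a\<in>A. k a (y a)) \<partial>PiM A (\<lambda>_. lborel)) \<partial>PiM ?I (\<lambda>_. lborel))"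
    proof -
      have "J ?I (merge ?I A (x, y)) = J ?I x" for x y unfolding J_def by (rule sum.cong) (auto simp: merge_def)
      moreover have "(\<Prod>a\<in>A. k a (merge ?I A (x, y) a)) = (\<Prod>a\<in>A. k a (y a))" for x y by (rule prod.cong) (auto simp: merge_def)
      ultimately show ?thesis by simp
    qed
    also have "\<dots> = (\<integral>\<^sup>+x. u (J ?I x) * (\<Prod>a\<in>A. \<integral>\<^sup>+t. k a t \<partial>lborel) \<partial>PiM ?I (\<lambda>_. lborel))"
    proof (rule nn_integral_cong)
      fix x
      have "(\<integral>\<^sup>+y. u (J ?I x) * (\<Prod>a\<in>A. k a (y a)) \<partial>PiM A (\<lambda>_. lborel)) = u (J ?I x) * (\<integral>\<^sup>+y. (\<Prod>a\<in>A. k a (y a)) \<partial>PiM A (\<lambda>_. lborel))"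
        by (rule nn_integral_cmult[OF mk]) simp
      also have "(\<integral>\<^sup>+y. (\<Prod>a\<in>A. k a (y a)) \<partial>PiM A (\<lambda>_. lborel)) = (\<Prod>a\<in>A. \<integral>\<^sup>+t. k a t \<partial>lborel)"
        by (rule P.product_nn_integral_prod[OF fin(1)]) (simp only: measurable_lborel2 k')
      finally show "(\<integral>\<^sup>+y. u (J ?I x) * (\<Prod>a\<in>A. k a (y a)) \<partial>PiM A (\<lambda>_. lborel)) = u (J ?I x) * (\<Prod>a\<in>A. \<integral>\<^sup>+t. k a t \<partial>lborel)" .
    qed
    also have "\<dots> = K * (\<Prod>a\<in>A. \<integral>\<^sup>+t. k a t \<partial>lborel)"
      unfolding K_def by (rule nn_integral_multc) (rule mu, simp)
    finally show ?thesis .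
  qed
  then show ?thesis by blast
qed

definition slab :: "'a::euclidean_space set \<Rightarrow> 'a set" where
  "slab A = {x. \<forall>a\<in>A. 0 \<le> x \<bullet> a \<and> x \<bullet> a < 1}"

lemma slab_borel [measurable]: assumes "A \<subseteq> Basis" shows "slab A \<in> sets borel"
proof -
  have "finite A" using finite_subset[OF assms finite_Basis] .
  then have "{x \<in> space borel. \<forall>a\<in>A. 0 \<le> x \<bullet> a \<and> x \<bullet> a < 1} \<in> sets (borel :: 'a measure)" by measurable
  then show ?thesis by (simp add: slab_def)
qed

lemma nn_integral_gauss_slab:
  fixes U :: "'a::euclidean_space set"
  assumes A: "A \<subseteq> Basis" and U: "U \<in> sets borel" "\<And>x. x \<in> U \<longleftrightarrow> pr (Basis - A) x \<in> U"
  shows "(\<integral>\<^sup>+x. indicator U x * ennreal (exp (- (norm (pr A x))\<^sup>2 / 2)) \<partial>lborel)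
     = ennreal (sqrt (2 * pi) ^ card A) * emeasure lborel (U \<inter> slab A)"
proof -
  have fin: "finite A" using finite_subset[OF A finite_Basis] .
  obtain K where K: "\<And>k. (\<forall>a\<in>A. k a \<in> borel_measurable borel) \<Longrightarrow>
     (\<integral>\<^sup>+x. indicator U x * (\<Prod>a\<in>A. k a (x \<bullet> a)) \<partial>lborel) = K * (\<Prod>a\<in>A. \<integral>\<^sup>+t. k a t \<partial>lborel)"
    using nn_integral_split[OF A, of "indicator U"] U by (auto simp: indicator_def)
  have e: "ennreal (exp (- (norm (pr A x))\<^sup>2 / 2)) = (\<Prod>a\<in>A. ennreal (exp (- (x \<bullet> a)\<^sup>2 / (2 * 1\<^sup>2))))" for x
  proof -
    have "(norm (pr A x))\<^sup>2 = (\<Sum>a\<in>A. (x \<bullet> a)\<^sup>2)"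
      unfolding norm_pr_sq[OF A] pr_inner[OF A] by (simp add: power2_eq_square)
    then have "- (norm (pr A x))\<^sup>2 / 2 = (\<Sum>a\<in>A. - (x \<bullet> a)\<^sup>2 / (2 * 1\<^sup>2))"
      by (simp add: sum_negf sum_divide_distrib)
    then show ?thesis by (simp add: exp_sum fin prod_ennreal)
  qed
  have "(\<integral>\<^sup>+x. indicator U x * ennreal (exp (- (norm (pr A x))\<^sup>2 / 2)) \<partial>lborel) = K * (\<Prod>a\<in>A. \<integral>\<^sup>+t. ennreal (exp (- t\<^sup>2 / (2 * 1\<^sup>2))) \<partial>lborel)"
    unfolding e by (rule K) auto
  also have "\<dots> = K * ennreal (sqrt (2 * pi) ^ card A)"
    by (subst nn_integral_gaussian_real) (auto simp: ennreal_power)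
  finally have 1: "(\<integral>\<^sup>+x. indicator U x * ennreal (exp (- (norm (pr A x))\<^sup>2 / 2)) \<partial>lborel) = K * ennreal (sqrt (2 * pi) ^ card A)" .
  have "emeasure lborel (U \<inter> slab A) = (\<integral>\<^sup>+x. indicator (U \<inter> slab A) x \<partial>lborel)"
    using U slab_borel[OF A] by simp
  also have "\<dots> = (\<integral>\<^sup>+x. indicator U x * (\<Prod>a\<in>A. indicator {0..<1} (x \<bullet> a)) \<partial>lborel)"
  proof (intro nn_integral_cong)
    fix x
    have "(\<Prod>a\<in>A. indicator {0..<1} (x \<bullet> a)) = (indicator (slab A) x :: ennreal)"
      using fin by (auto simp: slab_def indicator_def prod_zero_iff)
    then show "indicator (U \<inter> slab A) x = indicator U x * (\<Prod>a\<in>A. indicator {0..<1} (x \<bullet> a) :: ennreal)"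
      by (simp add: indicator_inter_arith)
  qed
  also have "\<dots> = K * (\<Prod>a\<in>A. \<integral>\<^sup>+t. indicator {0..<1::real} t \<partial>lborel)"
    by (rule K) auto
  also have "\<dots> = K" by simp
  finally show ?thesis using 1 by (simp add: mult.commute)
qed

locale cyl_gauge =
  fixes A :: "'a::euclidean_space set" and p :: "'a \<Rightarrow> real"
  assumes A: "A \<subseteq> Basis" and pm [measurable]: "p \<in> borel_measurable borel"
    and p0: "0 \<le> p x" and ph: "t > 0 \<Longrightarrow> p (t *\<^sub>R x) = t * p x" and pI: "p x = p (pr (Basis - A) x)"
begin

lemma less_borel: "{x. p x < r} \<in> sets borel"
proof -
  have "p -` {..<r} \<inter> space borel = {x. p x < r}" by auto
  moreover have "p -` {..<r} \<inter> space borel \<in> sets borel" using pm by (rule measurable_sets) simp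
  ultimately show ?thesis by (simp only:)
qed

definition V where "V r = emeasure lborel ({x. p x < r} \<inter> slab A)"

lemma V_scale: assumes r: "r > 0" shows "V r = ennreal (r ^ card (Basis - A)) * V 1"
proof -
  let ?I = "Basis - A"
  define c where "c b = (if b \<in> A then 1 else r)" for b :: 'a
  define T where "T x = 0 + (\<Sum>j\<in>Basis. (c j * (x \<bullet> j)) *\<^sub>R j)" for x :: 'a
  have Tb: "T x \<bullet> b = c b * (x \<bullet> b)" if "b \<in> Basis" for x b
    using that by (simp add: T_def inner_sum_left_Basis)
  have mT [measurable]: "T \<in> borel_measurable borel" unfolding T_def by measurable
  have X: "{x. p x < r} \<inter> slab A \<in> sets borel"
    using slab_borel[OF A] less_borel by (rule sets.Int[rotated])
  have prT: "pr ?I (T x) = r *\<^sub>R pr ?I x" for x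
    by (rule euclidean_eqI) (auto simp: pr_inner_basis Tb c_def)
  have pT: "p (T x) = r * p x" for x
    using pI[of "T x"] pI[of x] ph[OF r] by (simp add: prT)
  have "V r = emeasure (density (distr lborel borel T) (\<lambda>_. (\<Prod>j\<in>Basis. \<bar>c j\<bar>))) ({x. p x < r} \<inter> slab A)"
  proof -
    have "lborel = density (distr lborel borel T) (\<lambda>_. ennreal (\<Prod>j\<in>Basis. \<bar>c j\<bar>))"
      unfolding T_def[abs_def] using r by (intro lborel_affine_euclidean) (simp add: c_def)
    then show ?thesis unfolding V_def by (rule arg_cong2[where f=emeasure]) (rule refl)
  qed
  also have "\<dots> = ennreal (\<Prod>j\<in>Basis. \<bar>c j\<bar>) * emeasure (distr lborel borel T) ({x. p x < r} \<inter> slab A)"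
    by (rule emeasure_density_const) (simp only: sets_distr X)
  also have "ennreal (\<Prod>j\<in>Basis. \<bar>c j\<bar>) = (\<Prod>j\<in>Basis. ennreal \<bar>c j\<bar>)" by (simp only: prod_ennreal abs_ge_zero)
  also have "(\<Prod>j\<in>Basis. ennreal \<bar>c j\<bar>) = ennreal (r ^ card ?I)"
  proof -
    have "(\<Prod>j\<in>Basis. \<bar>c j\<bar>) = (\<Prod>j\<in>?I. \<bar>c j\<bar>) * (\<Prod>j\<in>A. \<bar>c j\<bar>)"
      using prod.subset_diff[OF A finite_Basis] by blast
    also have "\<dots> = r ^ card ?I" using r by (simp add: c_def)
    finally show ?thesis by (simp add: prod_ennreal)
  qed
  also have "emeasure (distr lborel borel T) ({x. p x < r} \<inter> slab A) = emeasure lborel (T -` ({x. p x < r} \<inter> slab A))"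
  proof -
    have "T \<in> measurable lborel borel" using mT by (simp only: measurable_lborel2)
    from emeasure_distr[OF this X] show ?thesis by simp
  qed
  also have "T -` ({x. p x < r} \<inter> slab A) = {x. p x < 1} \<inter> slab A"
    using r A by (auto simp: pT slab_def Tb subset_iff c_def)
  finally show ?thesis by (simp add: V_def)
qed

lemma gauss_V: "(\<integral>\<^sup>+x. indicator {x. p x < r} x * ennreal (exp (- (norm (pr A x))\<^sup>2 / 2)) \<partial>lborel)
     = ennreal (sqrt (2 * pi) ^ card A) * V r"
  unfolding V_def by (rule nn_integral_gauss_slab[OF A less_borel]) (simp only: mem_Collect_eq pI[symmetric])

end

text \<open>Write exp (- M^2 / 2) as the integral of exp (- \<tau>) over \<tau> > M^2 / 2. For the
  maximum M of two gauges this condition splits into one condition for each, so the integral over z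
  factors. The two gauge balls of radius sqrt (2 \<tau>) contribute (2 \<tau>)^j together, and
  integrating \<tau>^j exp (- \<tau>) yields j!.\<close>

lemma nn_integral_max:
  fixes A :: "'a::euclidean_space set"
  assumes "cyl_gauge A p" "cyl_gauge A h"
  defines "j \<equiv> card (Basis - A)"
  shows "(\<integral>\<^sup>+z. ennreal (exp (- ((max (p (fst z)) (h (snd z)))\<^sup>2 / 2 + ((norm (pr A (fst z)))\<^sup>2 + (norm (pr A (snd z)))\<^sup>2) / 2))) \<partial>lborel)
     = ennreal ((2 * pi) ^ card A * 2 ^ j * fact j) * (cyl_gauge.V A p 1 * cyl_gauge.V A h 1)"
proof -
  interpret p: cyl_gauge A p by fact
  interpret h: cyl_gauge A h by fact
  define a where "a \<tau> x = indicator {x. p x < sqrt (2 * \<tau>)} x * ennreal (exp (- (norm (pr A x))\<^sup>2 / 2))" for \<tau> x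
  define b where "b \<tau> x = indicator {x. h x < sqrt (2 * \<tau>)} x * ennreal (exp (- (norm (pr A x))\<^sup>2 / 2))" for \<tau> x
  have [measurable]: "pr A \<in> borel_measurable borel"
    by (intro borel_measurable_continuous_onI linear_continuous_on linear_conv_bounded_linear[THEN iffD1] linear_pr)
  have m: "(\<lambda>(z, \<tau>). ennreal (exp (- \<tau>)) * (a \<tau> (fst z) * b \<tau> (snd z)) * indicator {0..} \<tau>) \<in> borel_measurable ((lborel \<Otimes>\<^sub>M lborel) \<Otimes>\<^sub>M lborel)"
    unfolding a_def b_def indicator_def by measurable
  have e: "ennreal (exp (- ((max u v)\<^sup>2 / 2 + c))) = (\<integral>\<^sup>+\<tau>. ennreal (exp (- \<tau>)) * (indicator {t. u < sqrt (2*t)} \<tau> * indicator {t. v < sqrt (2*t)} \<tau>) * ennreal (exp (- c)) * indicator {0..} \<tau> \<partial>lborel)"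
    if uv: "0 \<le> u" "0 \<le> v" for u v c :: real
  proof -
    define M where "M = max u v"
    have M: "M \<ge> 0" using uv by (simp add: M_def)
    have iff: "u < sqrt (2*t) \<and> v < sqrt (2*t) \<longleftrightarrow> M\<^sup>2 / 2 < t" for t
    proof -
      have "u < sqrt (2*t) \<and> v < sqrt (2*t) \<longleftrightarrow> M < sqrt (2*t)" by (auto simp: M_def)
      also have "\<dots> \<longleftrightarrow> M\<^sup>2 < 2 * t" using M by (metis real_less_rsqrt real_sqrt_less_iff real_sqrt_unique)
      finally show ?thesis by auto
    qed
    have "(\<integral>\<^sup>+\<tau>. ennreal (exp (- \<tau>)) * (indicator {t. u < sqrt (2*t)} \<tau> * indicator {t. v < sqrt (2*t)} \<tau>) * ennreal (exp (- c)) * indicator {0..} \<tau> \<partial>lborel)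
       = (\<integral>\<^sup>+\<tau>. ennreal (exp (- c)) * (ennreal (exp (- \<tau>)) * indicator {M\<^sup>2/2<..} \<tau>) \<partial>lborel)"
    proof (intro nn_integral_cong)
      fix \<tau> :: real
      have "M\<^sup>2 / 2 < \<tau> \<Longrightarrow> 0 \<le> \<tau>" using zero_le_power2[of M] by linarith
      then show "ennreal (exp (- \<tau>)) * (indicator {t. u < sqrt (2*t)} \<tau> * indicator {t. v < sqrt (2*t)} \<tau>) * ennreal (exp (- c)) * indicator {0..} \<tau>
        = ennreal (exp (- c)) * (ennreal (exp (- \<tau>)) * indicator {M\<^sup>2/2<..} \<tau>)"
        using iff[of \<tau>] by (auto simp: indicator_def mult.commute)
    qed
    also have "\<dots> = ennreal (exp (- c)) * (\<integral>\<^sup>+\<tau>. ennreal (exp (- \<tau>)) * indicator {M\<^sup>2/2<..} \<tau> \<partial>lborel)"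
      by (rule nn_integral_cmult) auto
    also have "(\<integral>\<^sup>+\<tau>. ennreal (exp (- \<tau>)) * indicator {M\<^sup>2/2<..} \<tau> \<partial>lborel) = (\<integral>\<^sup>+\<tau>. ennreal (exp (- \<tau>)) * indicator {M\<^sup>2/2..} \<tau> \<partial>lborel)"
    proof (rule nn_integral_cong_AE)
      have "AE \<tau> in lborel. \<tau> \<noteq> M\<^sup>2/2" by (rule AE_lborel_singleton)
      then show "AE \<tau> in lborel. ennreal (exp (- \<tau>)) * indicator {M\<^sup>2/2<..} \<tau> = ennreal (exp (- \<tau>)) * indicator {M\<^sup>2/2..} \<tau>"
        by (rule eventually_mono) (auto simp: indicator_def)
    qed
    also have "\<dots> = ennreal (0 - (- exp (- (M\<^sup>2/2))))"
      by (rule nn_integral_FTC_atLeast) (auto intro!: derivative_eq_intros simp: filterlim_uminus_at_top[symmetric] tendsto_minus_cancel_left[symmetric] intro: filterlim_compose[OF exp_at_bot] filterlim_uminus_at_bot_at_top tendsto_eq_intros)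
    also have "ennreal (exp (- c)) * ennreal (0 - (- exp (- (M\<^sup>2/2)))) = ennreal (exp (- ((max u v)\<^sup>2 / 2 + c)))"
      by (simp add: ennreal_mult[symmetric] exp_add[symmetric] M_def add.commute)
    finally show ?thesis by simp
  qed
  have "(\<integral>\<^sup>+z. ennreal (exp (- ((max (p (fst z)) (h (snd z)))\<^sup>2 / 2 + ((norm (pr A (fst z)))\<^sup>2 + (norm (pr A (snd z)))\<^sup>2) / 2))) \<partial>lborel)
     = (\<integral>\<^sup>+z. (\<integral>\<^sup>+\<tau>. ennreal (exp (- \<tau>)) * (a \<tau> (fst z) * b \<tau> (snd z)) * indicator {0..} \<tau> \<partial>lborel) \<partial>(lborel \<Otimes>\<^sub>M lborel))"
    unfolding lborel_prod e[OF p.p0 h.p0] a_def b_def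
  proof (intro nn_integral_cong)
    fix z \<tau>
    have "ennreal (exp (- (((norm (pr A (fst z)))\<^sup>2 + (norm (pr A (snd z)))\<^sup>2) / 2))) = 
        ennreal (exp (- (norm (pr A (fst z)))\<^sup>2 / 2)) * ennreal (exp (- (norm (pr A (snd z)))\<^sup>2 / 2))"
      by (simp add: ennreal_mult[symmetric] exp_add[symmetric] add_divide_distrib)
    then show "ennreal (exp (- \<tau>)) * (indicator {t. p (fst z) < sqrt (2*t)} \<tau> * indicator {t. h (snd z) < sqrt (2*t)} \<tau>) * ennreal (exp (- (((norm (pr A (fst z)))\<^sup>2 + (norm (pr A (snd z)))\<^sup>2) / 2))) * indicator {0..} \<tau>
      = ennreal (exp (- \<tau>)) * (indicator {x. p x < sqrt (2 * \<tau>)} (fst z) * ennreal (exp (- (norm (pr A (fst z)))\<^sup>2 / 2)) * (indicator {x. h x < sqrt (2 * \<tau>)} (snd z) * ennreal (exp (- (norm (pr A (snd z)))\<^sup>2 / 2)))) * indicator {0..} \<tau>"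
      by (simp add: indicator_def)
  qed
  also have "\<dots> = (\<integral>\<^sup>+\<tau>. (\<integral>\<^sup>+z. ennreal (exp (- \<tau>)) * (a \<tau> (fst z) * b \<tau> (snd z)) * indicator {0..} \<tau> \<partial>(lborel \<Otimes>\<^sub>M lborel)) \<partial>lborel)"
  proof -
    interpret pair_sigma_finite "lborel \<Otimes>\<^sub>M lborel :: ('a \<times> 'a) measure" "lborel :: real measure"
      unfolding lborel_prod by standard
    show ?thesis using Fubini'[OF m] by simp
  qed
  also have "\<dots> = (\<integral>\<^sup>+\<tau>. ennreal (exp (- \<tau>)) * ((\<integral>\<^sup>+x. a \<tau> x \<partial>lborel) * (\<integral>\<^sup>+x. b \<tau> x \<partial>lborel)) * indicator {0..} \<tau> \<partial>lborel)"
  proof (intro nn_integral_cong)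
    fix \<tau> :: real
    have [measurable]: "a \<tau> \<in> borel_measurable borel" "b \<tau> \<in> borel_measurable borel"
      unfolding a_def b_def by measurable
    have "(\<integral>\<^sup>+z. a \<tau> (fst z) * b \<tau> (snd z) \<partial>(lborel \<Otimes>\<^sub>M lborel)) = (\<integral>\<^sup>+x. \<integral>\<^sup>+y. a \<tau> x * b \<tau> y \<partial>lborel \<partial>lborel)"
      by (subst lborel.nn_integral_fst[symmetric]) auto
    also have "\<dots> = (\<integral>\<^sup>+x. a \<tau> x * (\<integral>\<^sup>+y. b \<tau> y \<partial>lborel) \<partial>lborel)"
      by (intro nn_integral_cong nn_integral_cmult) auto
    also have "\<dots> = (\<integral>\<^sup>+x. a \<tau> x \<partial>lborel) * (\<integral>\<^sup>+x. b \<tau> x \<partial>lborel)" by (rule nn_integral_multc) auto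
    finally have 1: "(\<integral>\<^sup>+z. a \<tau> (fst z) * b \<tau> (snd z) \<partial>(lborel \<Otimes>\<^sub>M lborel)) = (\<integral>\<^sup>+x. a \<tau> x \<partial>lborel) * (\<integral>\<^sup>+x. b \<tau> x \<partial>lborel)" .
    have "(\<integral>\<^sup>+z. ennreal (exp (- \<tau>)) * (a \<tau> (fst z) * b \<tau> (snd z)) * indicator {0..} \<tau> \<partial>(lborel \<Otimes>\<^sub>M lborel)) 
       = (\<integral>\<^sup>+z. ennreal (exp (- \<tau>)) * indicator {0..} \<tau> * (a \<tau> (fst z) * b \<tau> (snd z)) \<partial>(lborel \<Otimes>\<^sub>M lborel))"
      by (simp add: mult_ac)
    also have "\<dots> = ennreal (exp (- \<tau>)) * indicator {0..} \<tau> * (\<integral>\<^sup>+z. a \<tau> (fst z) * b \<tau> (snd z) \<partial>(lborel \<Otimes>\<^sub>M lborel))"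
      by (rule nn_integral_cmult) measurable
    finally show "(\<integral>\<^sup>+z. ennreal (exp (- \<tau>)) * (a \<tau> (fst z) * b \<tau> (snd z)) * indicator {0..} \<tau> \<partial>(lborel \<Otimes>\<^sub>M lborel))
       = ennreal (exp (- \<tau>)) * ((\<integral>\<^sup>+x. a \<tau> x \<partial>lborel) * (\<integral>\<^sup>+x. b \<tau> x \<partial>lborel)) * indicator {0..} \<tau>"
      unfolding 1 by (simp add: mult_ac)
  qed
  also have "\<dots> = (\<integral>\<^sup>+\<tau>. ennreal ((2 * pi) ^ card A * 2 ^ j) * (p.V 1 * h.V 1) * (ennreal (\<tau> ^ j * exp (- \<tau>)) * indicator {0..} \<tau>) \<partial>lborel)"
  \<comment> \<open>At \<tau> = 0 the radius is 0, where \<open>V_scale\<close> does not apply;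
    hence the equality almost everywhere.\<close>
  proof (intro nn_integral_cong_AE AE_I'[of "{0}"] subsetI)
    fix \<tau> :: real assume "\<tau> \<in> {\<tau> \<in> space lborel. \<not> ennreal (exp (- \<tau>)) * ((\<integral>\<^sup>+x. a \<tau> x \<partial>lborel) * (\<integral>\<^sup>+x. b \<tau> x \<partial>lborel)) * indicator {0..} \<tau> =
       ennreal ((2 * pi) ^ card A * 2 ^ j) * (p.V 1 * h.V 1) * (ennreal (\<tau> ^ j * exp (- \<tau>)) * indicator {0..} \<tau>)}"
    moreover have "ennreal (exp (- \<tau>)) * ((\<integral>\<^sup>+x. a \<tau> x \<partial>lborel) * (\<integral>\<^sup>+x. b \<tau> x \<partial>lborel)) * indicator {0..} \<tau> =
       ennreal ((2 * pi) ^ card A * 2 ^ j) * (p.V 1 * h.V 1) * (ennreal (\<tau> ^ j * exp (- \<tau>)) * indicator {0..} \<tau>)" if "\<tau> > 0"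
    proof -
      have r: "sqrt (2 * \<tau>) > 0" using that by simp
      have "(\<integral>\<^sup>+x. a \<tau> x \<partial>lborel) * (\<integral>\<^sup>+x. b \<tau> x \<partial>lborel) = 
         ennreal (sqrt (2 * pi) ^ card A * sqrt (2 * \<tau>) ^ j) * ennreal (sqrt (2 * pi) ^ card A * sqrt (2 * \<tau>) ^ j) * (p.V 1 * h.V 1)"
        unfolding a_def b_def p.gauss_V h.gauss_V p.V_scale[OF r] h.V_scale[OF r] j_def[symmetric]
        using that by (simp add: ennreal_mult mult_ac)
      also have "ennreal (sqrt (2 * pi) ^ card A * sqrt (2 * \<tau>) ^ j) * ennreal (sqrt (2 * pi) ^ card A * sqrt (2 * \<tau>) ^ j) = ennreal ((2 * pi) ^ card A * (2 * \<tau>) ^ j)"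
      proof -
        have "sqrt (2 * pi) ^ card A * sqrt (2 * \<tau>) ^ j * (sqrt (2 * pi) ^ card A * sqrt (2 * \<tau>) ^ j) = (sqrt (2 * pi) * sqrt (2 * pi)) ^ card A * (sqrt (2 * \<tau>) * sqrt (2 * \<tau>)) ^ j"
          unfolding power_mult_distrib by (simp only: mult_ac)
        also have "\<dots> = (2 * pi) ^ card A * (2 * \<tau>) ^ j" using that by simp
        finally show ?thesis using that by (simp add: ennreal_mult[symmetric])
      qed
      also have "ennreal ((2 * pi) ^ card A * (2 * \<tau>) ^ j) = ennreal ((2 * pi) ^ card A * 2 ^ j) * ennreal (\<tau> ^ j)"
        using that by (simp add: ennreal_mult[symmetric] power_mult_distrib mult_ac)
      finally show ?thesis using that by (simp add: ennreal_mult mult_ac)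
    qed
    ultimately show "\<tau> \<in> {0}" by (cases "\<tau> > 0"; cases "\<tau> = 0") auto
  qed auto
  also have "\<dots> = ennreal ((2 * pi) ^ card A * 2 ^ j) * (p.V 1 * h.V 1) * ennreal (fact j)"
    by (subst nn_integral_cmult) (auto simp: nn_intergal_power_times_exp_Ici)
  finally show ?thesis by (simp add: ennreal_mult mult_ac)
qed


section \<open>Polar gauges and the Bourgain-Milman inequality\<close>

lemma pr_perp:
  assumes A: "A \<subseteq> Basis" and "\<And>a. a \<in> A \<Longrightarrow> y \<bullet> a = 0" shows "y \<bullet> pr (Basis - A) x = y \<bullet> x"
proof -
  have "y \<bullet> pr A x = 0" using assms(2) by (simp add: pr_def inner_sum_right)
  moreover have "y \<bullet> x = y \<bullet> pr (Basis - A) x + y \<bullet> pr A x" using pr_split[OF A, of x] by (metis inner_add_right)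
  ultimately show ?thesis by simp
qed

lemma
  assumes D: "bounded D" "D \<noteq> {}"
  shows le_sup_abs_inner: "c \<in> D \<Longrightarrow> \<bar>c \<bullet> y\<bar> \<le> (SUP c\<in>D. \<bar>c \<bullet> y\<bar>)"
    and sup_abs_inner_leI: "(\<And>c. c \<in> D \<Longrightarrow> \<bar>c \<bullet> y\<bar> \<le> b) \<Longrightarrow> (SUP c\<in>D. \<bar>c \<bullet> y\<bar>) \<le> b"
proof -
  obtain R where R: "R > 0" "\<And>c. c \<in> D \<Longrightarrow> norm c \<le> R" using D(1) bounded_pos by blast
  have bdd: "bdd_above ((\<lambda>c. \<bar>c \<bullet> y\<bar>) ` D)"
  proof (rule bdd_aboveI2)
    fix c assume "c \<in> D"
    then show "\<bar>c \<bullet> y\<bar> \<le> R * norm y" using R Cauchy_Schwarz_ineq2[of c y] by (meson mult_right_mono norm_ge_zero order_trans)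
  qed
  show "c \<in> D \<Longrightarrow> \<bar>c \<bullet> y\<bar> \<le> (SUP c\<in>D. \<bar>c \<bullet> y\<bar>)" by (rule cSUP_upper[OF _ bdd])
  show "(\<And>c. c \<in> D \<Longrightarrow> \<bar>c \<bullet> y\<bar> \<le> b) \<Longrightarrow> (SUP c\<in>D. \<bar>c \<bullet> y\<bar>) \<le> b" by (rule cSUP_least[OF D(2)])
qed

lemma cyl_gauge_sup:
  assumes A: "A \<subseteq> Basis" and D: "bounded D" "D \<noteq> {}" "\<And>c a. c \<in> D \<Longrightarrow> a \<in> A \<Longrightarrow> c \<bullet> a = 0" and \<rho>: "\<rho> > 0"
  shows "cyl_gauge A (\<lambda>y. (SUP c\<in>D. \<bar>c \<bullet> y\<bar>) / \<rho>)"
proof -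
  let ?I = "Basis - A"
  define h where "h y = (SUP c\<in>D. \<bar>c \<bullet> y\<bar>)" for y
  obtain R where R: "R > 0" "\<And>c. c \<in> D \<Longrightarrow> norm c \<le> R" using D(1) bounded_pos by blast
  have hle: "\<bar>c \<bullet> y\<bar> \<le> h y" if "c \<in> D" for c y unfolding h_def by (rule le_sup_abs_inner[OF D(1,2) that])
  have h_leI: "h y \<le> B" if "\<And>c. c \<in> D \<Longrightarrow> \<bar>c \<bullet> y\<bar> \<le> B" for y B unfolding h_def by (rule sup_abs_inner_leI[OF D(1,2) that])
  have h0: "0 \<le> h y" for y using D(2) hle[of _ y] abs_ge_zero order_trans by blast
  have hlip: "h y - h y' \<le> R * norm (y - y')" for y y'
  proof -
    have "h y \<le> h y' + R * norm (y - y')"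
    proof (rule h_leI)
      fix c assume c: "c \<in> D"
      have "\<bar>c \<bullet> y\<bar> \<le> \<bar>c \<bullet> y'\<bar> + \<bar>c \<bullet> (y - y')\<bar>" by (simp add: inner_diff_right)
      also have "\<dots> \<le> h y' + R * norm (y - y')"
        using hle[OF c] R(2)[OF c] Cauchy_Schwarz_ineq2[of c "y - y'"] by (meson add_mono mult_right_mono norm_ge_zero order_trans)
      finally show "\<bar>c \<bullet> y\<bar> \<le> h y' + R * norm (y - y')" .
    qed
    then show ?thesis by simp
  qed
  have "R-lipschitz_on UNIV h"
  proof (rule lipschitz_onI)
    fix y y'
    show "dist (h y) (h y') \<le> R * dist y y'"
      using hlip[of y y'] hlip[of y' y] by (simp add: dist_norm abs_le_iff norm_minus_commute[of y'])
  qed (use R(1) in simp)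
  then have hm: "h \<in> borel_measurable borel" 
    by (intro borel_measurable_continuous_onI lipschitz_on_continuous_on)
  have hhom: "h (t *\<^sub>R y) = t * h y" if t: "t > 0" for t y
  proof (rule antisym)
    show "h (t *\<^sub>R y) \<le> t * h y" using t hle by (intro h_leI) (simp add: abs_mult)
    have "h y \<le> h (t *\<^sub>R y) / t"
    proof (rule h_leI)
      fix c assume "c \<in> D"
      from hle[OF this, of "t *\<^sub>R y"] show "\<bar>c \<bullet> y\<bar> \<le> h (t *\<^sub>R y) / t" using t by (simp add: abs_mult field_simps)
    qed
    then show "t * h y \<le> h (t *\<^sub>R y)" using t by (simp add: field_simps)
  qed
  have hI: "h y = h (pr ?I y)" for y unfolding h_def by (rule SUP_cong) (auto simp: pr_perp[OF A] D(3))
  show ?thesis unfolding h_def[symmetric]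
    using A hm h0 hhom hI \<rho> by unfold_locales auto
qed

text \<open>The slab has unit thickness along \<open>A\<close>, so \<open>V1 * V2\<close> is the volume product of two polar bodies in the
  \<open>j\<close>-dimensional complement. Kuperberg's constant \<open>\<pi>^j / j!\<close> arises from \<open>two_pi_power_le\<close> with \<open>\<Theta>\<close> the
  half square of the maximum of the two gauges.\<close>

theorem bourgain_milman:
  fixes A Y D :: "'a::euclidean_space set"
  assumes A: "A \<subseteq> Basis" and Y: "finite Y" "\<exists>y\<in>Y. y \<noteq> 0" "\<And>y a. y \<in> Y \<Longrightarrow> a \<in> A \<Longrightarrow> y \<bullet> a = 0"
    and D: "bounded D" "D \<noteq> {}" "\<And>c a. c \<in> D \<Longrightarrow> a \<in> A \<Longrightarrow> c \<bullet> a = 0"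
    and YD: "\<And>y c. y \<in> Y \<Longrightarrow> c \<in> D \<Longrightarrow> \<bar>y \<bullet> c\<bar> \<le> 1"
  defines "j \<equiv> card (Basis - A)"
    and "V1 \<equiv> emeasure lborel ({x. (SUP y\<in>Y. \<bar>y \<bullet> x\<bar>) < 1} \<inter> slab A)"
    and "V2 \<equiv> emeasure lborel ({y. (SUP c\<in>D. \<bar>c \<bullet> y\<bar>) < 1} \<inter> slab A)"
  shows "ennreal (pi ^ j) \<le> ennreal (fact j) * (V1 * V2)"
proof -
  let ?I = "Basis - A"
  define p where "p x = (SUP y\<in>Y. \<bar>y \<bullet> x\<bar>)" for x
  define h where "h y = (SUP c\<in>D. \<bar>c \<bullet> y\<bar>)" for y
  obtain R where R: "R > 0" "\<And>c. c \<in> D \<Longrightarrow> norm c \<le> R" using D(1) bounded_pos by blast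
  have Yne: "Y \<noteq> {}" using Y by blast
  have hle: "\<bar>c \<bullet> y\<bar> \<le> h y" if "c \<in> D" for c y unfolding h_def by (rule le_sup_abs_inner[OF D(1,2) that])
  have h_leI: "h y \<le> B" if "\<And>c. c \<in> D \<Longrightarrow> \<bar>c \<bullet> y\<bar> \<le> B" for y B unfolding h_def by (rule sup_abs_inner_leI[OF D(1,2) that])
  have hcyl: "cyl_gauge A (\<lambda>y. h y / \<rho>)" if "\<rho> > 0" for \<rho>
    unfolding h_def by (rule cyl_gauge_sup[OF A D that])
  have bY: "bounded Y" using Y(1) by (rule finite_imp_bounded)
  have p_leI: "p x \<le> B" if "\<And>y. y \<in> Y \<Longrightarrow> \<bar>y \<bullet> x\<bar> \<le> B" for x B
    unfolding p_def by (rule sup_abs_inner_leI[OF bY Yne that])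
  have pcyl: "cyl_gauge A p" using cyl_gauge_sup[OF A bY Yne Y(3), of 1] by (simp add: p_def[abs_def])
  interpret p: cyl_gauge A p by (rule pcyl)
  interpret h: cyl_gauge A h using hcyl[of 1] by simp
  \<comment> \<open>The slack \<rho> pays for two approximations: the smooth norm \<open>N\<close>
    replaces the maximum over \<open>Y\<close>, and the \<delta>-term is added. It is removed by
    letting \<rho> tend to 1.\<close>
  have main: "ennreal (pi ^ j) \<le> ennreal (fact j * \<rho> ^ j) * (V1 * V2)" if \<rho>: "\<rho> > 1" for \<rho>
  proof -
    have lim: "(\<lambda>m. real (card Y) powr (1 / real m)) \<longlonglongrightarrow> real (card Y) powr 0"
      using Yne Y(1) by (intro tendsto_intros lim_1_over_n) auto
    have "real (card Y) powr 0 < (1 + \<rho>\<^sup>2) / 2" using \<rho> Yne Y(1) by (simp add: one_less_power)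
    then have "eventually (\<lambda>m. real (card Y) powr (1 / real m) < (1 + \<rho>\<^sup>2) / 2) sequentially"
      using lim by (rule order_tendstoD(2)[rotated])
    then have "eventually (\<lambda>m. real (card Y) powr (1 / real m) < (1 + \<rho>\<^sup>2) / 2 \<and> m > 0) sequentially"
      using eventually_gt_at_top by (rule eventually_conj)
    then obtain m where m: "m > 0" "real (card Y) powr (1 / real m) < (1 + \<rho>\<^sup>2) / 2"
      by (metis (mono_tags, lifting) eventually_happens trivial_limit_sequentially)
    \<comment> \<open>With \<open>m\<close> as chosen, the square of \<open>N\<close> on
      \<open>D\<close> is at most 1 plus half of \<rho>^2 - 1; the other half is left for the
      \<delta>-term, \<open>D\<close> having radius at most \<open>R\<close>. Together they give
      \<open>\<nu>\<close> <= \<rho> on \<open>D\<close>.\<close>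
    define \<delta> where "\<delta> = (\<rho>\<^sup>2 - 1) / (2 * R\<^sup>2)"
    have \<delta>: "\<delta> > 0" using \<rho> R(1) by (simp add: \<delta>_def one_less_power)
    interpret b: bm_norm Y m A \<delta> using Y A m \<delta> by unfold_locales auto
    have \<nu>D: "b.\<nu> c \<le> \<rho>" if c: "c \<in> D" for c
    proof -
      have "(b.N c)\<^sup>2 \<le> (1 + \<rho>\<^sup>2) / 2" using b.N_le[of c] YD c m by force
      moreover have "\<delta> * (norm (pr ?I c))\<^sup>2 \<le> (\<rho>\<^sup>2 - 1) / 2"
      proof -
        have "(norm (pr ?I c))\<^sup>2 \<le> (norm c)\<^sup>2" using norm_pr_split[OF A, of c] by simp
        also have "\<dots> \<le> R\<^sup>2" using R(2)[OF c] by (simp add: power_mono)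
        finally have "\<delta> * (norm (pr ?I c))\<^sup>2 \<le> \<delta> * R\<^sup>2" using \<delta> by (simp add: mult_left_mono)
        also have "\<dots> = (\<rho>\<^sup>2 - 1) / 2" using R(1) by (simp add: \<delta>_def)
        finally show ?thesis .
      qed
      ultimately have "(b.\<nu> c)\<^sup>2 \<le> \<rho>\<^sup>2" unfolding b.\<nu>_sq by (simp add: field_simps)
      then show ?thesis by (rule power2_le_imp_le) (use \<rho> in simp)
    qed
    define \<Theta> where "\<Theta> z = (max (p (fst z)) (h (snd z) / \<rho>))\<^sup>2 / 2 + ((norm (pr A (fst z)))\<^sup>2 + (norm (pr A (snd z)))\<^sup>2) / 2" for z
    have [measurable]: "pr A \<in> borel_measurable borel"
      by (intro borel_measurable_continuous_onI linear_continuous_on linear_conv_bounded_linear[THEN iffD1] linear_pr)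
    have \<Theta>m: "\<Theta> \<in> borel_measurable borel" unfolding \<Theta>_def[abs_def] borel_prod[symmetric] by measurable
    have "ennreal ((2 * pi) ^ DIM('a)) \<le> (\<integral>\<^sup>+z. ennreal (exp (- \<Theta> z)) \<partial>lborel)"
    proof (rule b.field.two_pi_power_le[OF \<Theta>m])
      fix t :: real and z :: "'a \<times> 'a" assume t: "t > 0"
      have m1: "max (t * x) (t * y) = t * max x y" for x y :: real using t by (simp add: max_mult_distrib_left)
      have m2: "p (fst (t *\<^sub>R z)) = t * p (fst z)" "h (snd (t *\<^sub>R z)) / \<rho> = t * (h (snd z) / \<rho>)"
        using t by (simp_all add: p.ph h.ph)
      have m3: "(norm (pr A (fst (t *\<^sub>R z))))\<^sup>2 = t\<^sup>2 * (norm (pr A (fst z)))\<^sup>2" 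
        "(norm (pr A (snd (t *\<^sub>R z))))\<^sup>2 = t\<^sup>2 * (norm (pr A (snd z)))\<^sup>2"
        by (simp_all add: linear_scale[OF linear_pr] power_mult_distrib)
      have alg: "t\<^sup>2 * a / 2 + (t\<^sup>2 * b + t\<^sup>2 * c) / 2 = t\<^sup>2 * (a / 2 + (b + c) / 2)" for a b c :: real
        by (simp add: field_simps)
      show "\<Theta> (t *\<^sub>R z) = t\<^sup>2 * \<Theta> z"
        unfolding \<Theta>_def m2 m1 m3 power_mult_distrib by (rule alg)
    next
      fix z
      show "\<Theta> (b.field.F z) \<le> (b.field.q (fst z) + b.field.q (snd z)) / 2"
        unfolding \<Theta>_def
      proof (rule b.lower_bound)
        show "p x \<le> b.\<nu> x" for x
        proof (rule p_leI)
          fix y assume "y \<in> Y"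
          then have "\<bar>y \<bullet> x\<bar> \<le> b.N x" by (rule b.inner_le_N)
          also have "\<dots> \<le> b.\<nu> x" unfolding b.\<nu>_def using \<delta> b.N_nonneg by (intro real_le_rsqrt) auto
          finally show "\<bar>y \<bullet> x\<bar> \<le> b.\<nu> x" .
        qed
        fix y s assume s: "0 \<le> s" and u: "\<And>u. y \<bullet> pr ?I u \<le> s * b.\<nu> u"
        show "h y \<le> \<rho> * s"
        proof (rule h_leI)
          fix c assume c: "c \<in> D"
          have prc: "pr ?I c = c"
          proof -
            have "pr A c = 0" using D(3)[OF c] by (simp add: pr_def)
            then show ?thesis using pr_split[OF A, of c] by simp
          qed
          have "s * b.\<nu> c \<le> s * \<rho>" using \<nu>D[OF c] s by (rule mult_left_mono)
          moreover have "b.\<nu> (- c) = b.\<nu> c" using b.N_scale[of "-1" c] by (simp add: b.\<nu>_def linear_neg[OF linear_pr])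
          ultimately show "\<bar>c \<bullet> y\<bar> \<le> \<rho> * s"
            using u[of c] u[of "- c"] by (simp add: prc linear_neg[OF linear_pr] inner_commute mult.commute abs_le_iff)
        qed
      qed (use p.p0 h.p0 \<rho> in auto)
    qed
    also have "\<dots> = ennreal ((2 * pi) ^ card A * 2 ^ j * fact j) * (p.V 1 * cyl_gauge.V A (\<lambda>y. h y / \<rho>) 1)"
      unfolding \<Theta>_def j_def by (rule nn_integral_max[OF pcyl hcyl]) (use \<rho> in auto)
    also have "cyl_gauge.V A (\<lambda>y. h y / \<rho>) 1 = h.V \<rho>"
      unfolding cyl_gauge.V_def[OF hcyl[of \<rho>]] h.V_def using \<rho> by (simp add: cyl_gauge.V_def[OF hcyl] divide_less_eq)
    also have "h.V \<rho> = ennreal (\<rho> ^ j) * V2"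
    proof -
      have "h.V 1 = V2" unfolding h.V_def V2_def h_def ..
      then show ?thesis using h.V_scale[of \<rho>] \<rho> unfolding j_def by simp
    qed
    also have "p.V 1 = V1" unfolding p.V_def V1_def p_def ..
    finally have "ennreal ((2 * pi) ^ DIM('a)) \<le> ennreal ((2 * pi) ^ card A * 2 ^ j) * (ennreal (fact j * \<rho> ^ j) * (V1 * V2))"
      using \<rho> by (simp add: ennreal_mult mult_ac)
    \<comment> \<open>The factor 2 \<pi> of each \<open>A\<close>-direction and the factor 2 of each
      other direction cancel, leaving \<pi>^j against j!.\<close>
    moreover have "ennreal ((2 * pi) ^ DIM('a)) = ennreal ((2 * pi) ^ card A * 2 ^ j) * ennreal (pi ^ j)"
    proof -
      have "DIM('a) = card A + j" unfolding j_def using A by (metis card_Diff_subset card_mono finite_Basis finite_subset le_add_diff_inverse)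
      then show ?thesis by (simp add: ennreal_mult[symmetric] power_add power_mult_distrib)
    qed
    ultimately have "ennreal ((2 * pi) ^ card A * 2 ^ j) * ennreal (pi ^ j) \<le> ennreal ((2 * pi) ^ card A * 2 ^ j) * (ennreal (fact j * \<rho> ^ j) * (V1 * V2))"
      by (simp only:)
    moreover have "ennreal ((2 * pi) ^ card A * 2 ^ j) \<noteq> 0" by (simp add: not_le)
    ultimately show ?thesis using ennreal_mult_le_mult_iff by (metis ennreal_neq_top)
  qed
  have "((\<lambda>\<rho>. ennreal (fact j * \<rho> ^ j) * (V1 * V2)) \<longlongrightarrow> ennreal (fact j * 1 ^ j) * (V1 * V2)) (at_right 1)"
    by (rule tendsto_mult_ennreal[OF tendsto_ennrealI tendsto_const]) (auto intro!: tendsto_eq_intros)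
  moreover have "eventually (\<lambda>\<rho>. ennreal (pi ^ j) \<le> ennreal (fact j * \<rho> ^ j) * (V1 * V2)) (at_right 1)"
    by (rule eventually_mono[OF eventually_at_right_less]) (rule main)
  ultimately have "ennreal (pi ^ j) \<le> ennreal (fact j * 1 ^ j) * (V1 * V2)"
    by (intro tendsto_lowerbound) auto
  then show ?thesis by simp
qed

section \<open>Lattices and transference\<close>

definition Zn :: "'a::euclidean_space set" where
  "Zn = {x. \<forall>b\<in>Basis. x \<bullet> b \<in> \<int>}"

lemma Zn_add: "x \<in> Zn \<Longrightarrow> y \<in> Zn \<Longrightarrow> x + y \<in> Zn"
  and Zn_diff: "x \<in> Zn \<Longrightarrow> y \<in> Zn \<Longrightarrow> x - y \<in> Zn"
  and Zn_0: "0 \<in> Zn"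
  by (auto simp: Zn_def inner_add_left inner_diff_left)

lemma Zn_Basis: "b \<in> Basis \<Longrightarrow> b \<in> Zn"
  by (auto simp: Zn_def inner_Basis)

lemma Zn_scale: "x \<in> Zn \<Longrightarrow> of_int k *\<^sub>R x \<in> Zn"
  by (auto simp: Zn_def)

lemma countable_Zn: "countable (Zn :: 'a::euclidean_space set)"
proof -
  have "countable ((\<lambda>f. \<Sum>b\<in>Basis. of_int (f b) *\<^sub>R b) ` ((Basis :: 'a set) \<rightarrow>\<^sub>E (UNIV :: int set)))"
    by (intro countable_image countable_PiE) auto
  moreover have "Zn \<subseteq> (\<lambda>f. \<Sum>b\<in>Basis. of_int (f b) *\<^sub>R b) ` ((Basis :: 'a set) \<rightarrow>\<^sub>E (UNIV :: int set))"
  proof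
    fix x :: 'a assume x: "x \<in> Zn"
    define f where "f = restrict (\<lambda>b. \<lfloor>x \<bullet> b\<rfloor>) Basis"
    have "x = (\<Sum>b\<in>Basis. (x \<bullet> b) *\<^sub>R b)" by (simp add: euclidean_representation)
    also have "\<dots> = (\<Sum>b\<in>Basis. of_int (f b) *\<^sub>R b)"
      using x by (intro sum.cong refl) (auto simp: f_def Zn_def elim!: Ints_cases)
    finally have "x = (\<Sum>b\<in>Basis. of_int (f b) *\<^sub>R b)" .
    then show "x \<in> (\<lambda>f. \<Sum>b\<in>Basis. of_int (f b) *\<^sub>R b) ` ((Basis :: 'a set) \<rightarrow>\<^sub>E (UNIV :: int set))"
      by (intro image_eqI[of _ _ f]) (auto simp: f_def)
  qed
  ultimately show ?thesis using countable_subset by blast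
qed

lemma infinite_Zn: "infinite (Zn :: 'a::euclidean_space set)"
proof
  assume fin: "finite (Zn :: 'a set)"
  obtain b :: 'a where b: "b \<in> Basis" using nonempty_Basis by blast
  have "real n *\<^sub>R b \<in> Zn" for n :: nat using Zn_scale[OF Zn_Basis[OF b], of "int n"] by simp
  then have "range (\<lambda>n::nat. real n *\<^sub>R b) \<subseteq> Zn" by blast
  then have "finite (range (\<lambda>n::nat. real n *\<^sub>R b))" using fin finite_subset by blast
  moreover have "inj (\<lambda>n::nat. real n *\<^sub>R b)" using b by (auto simp: inj_def)
  ultimately show False using finite_imageD by blast
qed

lemma finite_Zn_bounded: assumes "bounded S" shows "finite (Zn \<inter> S)"
proof -
  obtain R where R: "\<And>x. x \<in> S \<Longrightarrow> norm x \<le> R" using assms bounded_iff by blast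
  have "finite ((\<lambda>f. \<Sum>b\<in>Basis. of_int (f b) *\<^sub>R b) ` ((Basis :: 'a set) \<rightarrow>\<^sub>E {-\<lceil>R\<rceil>..\<lceil>R\<rceil>}))"
    by (intro finite_imageI finite_PiE) auto
  moreover have "Zn \<inter> S \<subseteq> (\<lambda>f. \<Sum>b\<in>Basis. of_int (f b) *\<^sub>R b) ` ((Basis :: 'a set) \<rightarrow>\<^sub>E {-\<lceil>R\<rceil>..\<lceil>R\<rceil>})"
  proof
    fix x :: 'a assume x: "x \<in> Zn \<inter> S"
    define f where "f = restrict (\<lambda>b. \<lfloor>x \<bullet> b\<rfloor>) Basis"
    have f: "of_int (f b) = x \<bullet> b" if "b \<in> Basis" for b using x that by (auto simp: f_def Zn_def elim!: Ints_cases)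
    have "x = (\<Sum>b\<in>Basis. (x \<bullet> b) *\<^sub>R b)" by (simp add: euclidean_representation)
    also have "\<dots> = (\<Sum>b\<in>Basis. of_int (f b) *\<^sub>R b)" by (intro sum.cong refl) (auto simp: f)
    finally have e: "x = (\<Sum>b\<in>Basis. of_int (f b) *\<^sub>R b)" .
    have "f b \<in> {-\<lceil>R\<rceil>..\<lceil>R\<rceil>}" if b: "b \<in> Basis" for b
    proof -
      have "\<bar>x \<bullet> b\<bar> \<le> R" using Basis_le_norm[OF b, of x] R[of x] x by auto
      then have "\<bar>of_int (f b)\<bar> \<le> (of_int \<lceil>R\<rceil> :: real)" using f[OF b] by linarith
      then show ?thesis by (simp only: of_int_abs[symmetric] of_int_le_iff) auto
    qed
    moreover have "f \<in> extensional Basis" by (simp add: f_def)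
    ultimately have "f \<in> (Basis :: 'a set) \<rightarrow>\<^sub>E {-\<lceil>R\<rceil>..\<lceil>R\<rceil>}" by (simp add: PiE_iff)
    with e show "x \<in> (\<lambda>f. \<Sum>b\<in>Basis. of_int (f b) *\<^sub>R b) ` ((Basis :: 'a set) \<rightarrow>\<^sub>E {-\<lceil>R\<rceil>..\<lceil>R\<rceil>})"
      by (rule image_eqI)
  qed
  ultimately show ?thesis using finite_subset by blast
qed

text \<open>Cut \<open>E\<close> into the pieces that translation by a given element of
  \<open>M\<close> carries into \<open>C\<close>. By \<open>cover\<close> the pieces exhaust
  \<open>E\<close>; by \<open>pack\<close> their translates inside \<open>C\<close> are
  disjoint.\<close>

lemma emeasure_packing_le_covering:
  fixes M E C :: "'a::euclidean_space set"
  assumes M: "countable M" "infinite M" and E: "E \<in> sets borel" and C: "C \<in> sets borel"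
    and pack: "\<And>x y m m'. x \<in> E \<Longrightarrow> y \<in> E \<Longrightarrow> m \<in> M \<Longrightarrow> m' \<in> M \<Longrightarrow> x - m = y - m' \<Longrightarrow> m = m'"
    and cover: "\<And>x. x \<in> E \<Longrightarrow> \<exists>m\<in>M. x - m \<in> C"
  shows "emeasure lborel E \<le> emeasure lborel C"
proof -
  define e where "e = from_nat_into M"
  have e: "bij_betw e UNIV M" unfolding e_def by (rule bij_betw_from_nat_into[OF M])
  define X where "X n = E \<inter> (\<lambda>x. x - e n) -` C" for n
  define X' where "X' n = (\<lambda>x. x + e n) -` X n" for n
  have C': "(\<lambda>x. x - e n) -` C \<in> sets borel" for n
    using measurable_sets[of "\<lambda>x. x - e n" borel borel C] C by simp
  have X: "X n \<in> sets borel" for n unfolding X_def using E C' by blast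
  have X'b: "X' n \<in> sets borel" for n
    unfolding X'_def using measurable_sets[of "\<lambda>x. x + e n" borel borel "X n"] X by simp
  have eX: "emeasure lborel (X' n) = emeasure lborel (X n)" for n
  proof -
    have "emeasure lborel (X n) = emeasure (distr lborel borel ((+) (e n))) (X n)"
      by (simp add: lborel_distr_plus)
    also have "\<dots> = emeasure lborel (X' n)"
    proof -
      have "(+) (e n) = (\<lambda>x. x + e n)" by (simp add: fun_eq_iff add.commute)
      then show ?thesis using X[of n] by (subst emeasure_distr) (auto simp: X'_def)
    qed
    finally show ?thesis ..
  qed
  have E_sub: "E \<subseteq> (\<Union>n. X n)"
  proof
    fix x assume x: "x \<in> E"
    then obtain m where "m \<in> M" "x - m \<in> C" using cover by blast
    moreover obtain n where "m = e n" using e \<open>m \<in> M\<close> by (metis bij_betw_imp_surj_on rangeE)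
    ultimately show "x \<in> (\<Union>n. X n)" using x by (auto simp: X_def)
  qed
  have "emeasure lborel E \<le> emeasure lborel (\<Union>n. X n)"
    using X by (intro emeasure_mono[OF E_sub]) auto
  also have "\<dots> \<le> (\<Sum>n. emeasure lborel (X n))" using X by (intro emeasure_subadditive_countably) auto
  also have "\<dots> = (\<Sum>n. emeasure lborel (X' n))" by (simp add: eX)
  also have "\<dots> = emeasure lborel (\<Union>n. X' n)"
  proof (rule suminf_emeasure)
    show "disjoint_family X'"
      unfolding disjoint_family_on_def
    proof (intro ballI impI equals0I)
      fix n k :: nat and x assume nk: "n \<noteq> k" and "x \<in> X' n \<inter> X' k"
      then have "x + e n \<in> E" "x + e k \<in> E" by (auto simp: X'_def X_def)
      then have "e n = e k" using pack[of "x + e n" "x + e k" "e n" "e k"] e by (simp add: bij_betw_apply)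
      then show False using nk e by (auto simp: bij_betw_def inj_on_def)
    qed
  qed (use X'b in auto)
  also have "\<dots> \<le> emeasure lborel C"
    using C by (intro emeasure_mono) (auto simp: X'_def X_def)
  finally show ?thesis .
qed

lemma linear_image_borel:
  fixes f :: "'a::euclidean_space \<Rightarrow> 'a"
  assumes "linear f" "bij f" "S \<in> sets borel" shows "f ` S \<in> sets borel"
proof -
  have "linear (inv f)" using assms by (simp add: inj_linear_imp_inv_linear bij_is_inj)
  then have "inv f \<in> borel_measurable borel" 
    by (intro borel_measurable_continuous_onI linear_continuous_on) (simp add: linear_linear)
  then have "inv f -` S \<inter> space borel \<in> sets borel" using assms(3) by (rule measurable_sets)
  moreover have "inv f -` S = f ` S" using assms(2) by (metis bij_imp_bij_inv bij_vimage_eq_inv_image inv_inv_eq)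
  ultimately show ?thesis by simp
qed

definition ldet :: "('a::euclidean_space \<Rightarrow> 'a) \<Rightarrow> real" where
  "ldet f = \<bar>det (matrix (lin_vec f))\<bar>"

lemma ldet_nonneg [simp]: "ldet f \<ge> 0" by (simp add: ldet_def)

lemma emeasure_ldet:
  assumes "linear f" "bij f" "S \<in> sets borel" "emeasure lborel S < \<infinity>"
  shows "emeasure lborel (f ` S) = ennreal (ldet f) * emeasure lborel S"
  unfolding ldet_def using assms by (intro emeasure_linear_image linear_image_borel)

lemma ldet_comp: "linear f \<Longrightarrow> linear g \<Longrightarrow> ldet (f \<circ> g) = ldet f * ldet g"
proof -
  assume l: "linear f" "linear g"
  have "lin_vec (f \<circ> g) = lin_vec f \<circ> lin_vec g" by (simp add: lin_vec_def fun_eq_iff)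
  then show ?thesis by (simp add: ldet_def matrix_compose linear_lin_vec l det_mul abs_mult)
qed

lemma ldet_id: "ldet (\<lambda>x. x) = 1"
proof -
  have "lin_vec (\<lambda>x::'a. x) = id" by (simp add: lin_vec_def fun_eq_iff)
  then show ?thesis by (simp add: ldet_def matrix_id)
qed

lemma ldet_adjoint:
  fixes f :: "'a::euclidean_space \<Rightarrow> 'a" assumes "linear f" shows "ldet (adjoint f) = ldet f"
  using emeasure_adjoint_image_cube[OF assms] assms
  by (simp add: emeasure_linear_image_cube adjoint_linear ldet_def)

lemma emeasure_slab: "emeasure lborel (slab Basis :: 'a::euclidean_space set) = 1"
proof (rule antisym)
  have sub: "box 0 One \<subseteq> (slab Basis :: 'a set)" "(slab Basis :: 'a set) \<subseteq> cbox 0 One"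
    by (auto simp: slab_def mem_box less_imp_le)
  have s: "(slab Basis :: 'a set) \<in> sets borel" by (rule slab_borel) simp
  show "emeasure lborel (slab Basis :: 'a set) \<le> 1"
    using emeasure_mono[OF sub(2), of lborel] emeasure_unit_cube[where ?'a='a] by (simp add: unit_cube_def)
  have "emeasure lborel (box 0 One :: 'a set) = 1" by (subst emeasure_lborel_box) auto
  then show "1 \<le> emeasure lborel (slab Basis :: 'a set)" using emeasure_mono[OF sub(1), of lborel] s by simp
qed

text \<open>Recording a lattice by a linear bijection from the integer lattice makes linear images
  and duals of lattices into compositions and adjoints of maps.\<close>

locale lattice_iso =
  fixes P :: "'a::euclidean_space \<Rightarrow> 'a" and M :: "'a set"
  assumes P: "linear P" "bij P" and M: "M = P ` Zn"
begin

definition cell where "cell = P ` slab Basis"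

lemma M_add: "x \<in> M \<Longrightarrow> y \<in> M \<Longrightarrow> x + y \<in> M"
  and M_diff: "x \<in> M \<Longrightarrow> y \<in> M \<Longrightarrow> x - y \<in> M"
  and M_0: "0 \<in> M"
  and M_scale: "x \<in> M \<Longrightarrow> of_int k *\<^sub>R x \<in> M"
  unfolding M using P(1)
  by (auto simp: image_iff linear_add[symmetric] linear_diff[symmetric] linear_scale[symmetric] linear_0 intro: Zn_add Zn_diff Zn_scale)
    (metis Zn_0 linear_0)

lemma M_countable: "countable M" and M_infinite: "infinite M"
proof -
  show "countable M" unfolding M by (intro countable_image countable_Zn)
  have "inj_on P Zn" using P(2) by (meson bij_is_inj inj_on_subset subset_UNIV)
  then show "infinite M" unfolding M using infinite_Zn finite_imageD by blast
qed

lemma cell_borel: "cell \<in> sets borel" and emeasure_cell: "emeasure lborel cell = ennreal (ldet P)"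
  unfolding cell_def using P by (auto intro!: linear_image_borel slab_borel simp: emeasure_ldet emeasure_slab slab_borel)

lemma cell_cover: "\<exists>m\<in>M. x - m \<in> cell"
proof -
  define y where "y = inv P x"
  have y: "P y = x" using P(2) by (simp add: y_def bij_is_surj surj_f_inv_f)
  define n where "n = (\<Sum>b\<in>Basis. of_int \<lfloor>y \<bullet> b\<rfloor> *\<^sub>R b)"
  have n: "n \<bullet> b = of_int \<lfloor>y \<bullet> b\<rfloor>" if "b \<in> Basis" for b using that by (simp add: n_def inner_sum_left_Basis)
  have "n \<in> Zn" by (auto simp: Zn_def n)
  moreover have "y - n \<in> slab Basis" by (auto simp: slab_def n inner_diff_left) linarith
  moreover have "x - P n = P (y - n)" using y by (simp add: linear_diff[OF P(1)])
  ultimately show ?thesis unfolding M cell_def by blast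
qed

lemma cell_pack: assumes "x \<in> cell" "y \<in> cell" "x - y \<in> M" shows "x = y"
proof -
  obtain u v n where u: "u \<in> slab Basis" "x = P u" "v \<in> slab Basis" "y = P v" "n \<in> Zn" "x - y = P n"
    using assms unfolding cell_def M by blast
  have "P (u - v) = P n" using u by (simp add: linear_diff[OF P(1)])
  then have n: "n = u - v" using P(2) by (simp add: bij_def inj_eq)
  have "u \<bullet> b = v \<bullet> b" if b: "b \<in> Basis" for b
  proof -
    have "(u - v) \<bullet> b \<in> \<int>" using u(5) b by (simp add: n Zn_def)
    then obtain k where k: "(u - v) \<bullet> b = of_int k" by (elim Ints_cases)
    have "0 \<le> u \<bullet> b" "u \<bullet> b < 1" "0 \<le> v \<bullet> b" "v \<bullet> b < 1" using u(1,3) b by (auto simp: slab_def)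
    then have "\<bar>(u - v) \<bullet> b\<bar> < 1" unfolding inner_diff_left by linarith
    then have "k = 0" unfolding k by linarith
    then show ?thesis using k by (simp add: inner_diff_left)
  qed
  then have "u = v" by (rule euclidean_eqI)
  then show ?thesis using u by simp
qed

lemma packing_le:
  assumes "E \<in> sets borel" "\<And>x y. x \<in> E \<Longrightarrow> y \<in> E \<Longrightarrow> x - y \<in> M \<Longrightarrow> x = y"
  shows "emeasure lborel E \<le> ennreal (ldet P)"
  unfolding emeasure_cell[symmetric]
proof (rule emeasure_packing_le_covering[OF M_countable M_infinite assms(1) cell_borel])
  fix x y m m' assume *: "x \<in> E" "y \<in> E" "m \<in> M" "m' \<in> M" "x - m = y - m'"
  then have "x - y = m - m'" by (simp add: algebra_simps)
  then have "x = y" using assms(2)[of x y] * M_diff by metis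
  then show "m = m'" using * by simp
qed (rule cell_cover)

lemma covering_ge:
  assumes "C \<in> sets borel" "\<And>x. \<exists>m\<in>M. x - m \<in> C"
  shows "ennreal (ldet P) \<le> emeasure lborel C"
  unfolding emeasure_cell[symmetric]
proof (rule emeasure_packing_le_covering[OF M_countable M_infinite cell_borel assms(1)])
  fix x y m m' assume *: "x \<in> cell" "y \<in> cell" "m \<in> M" "m' \<in> M" "x - m = y - m'"
  then have "x - y = m - m'" by (simp add: algebra_simps)
  then have "x = y" using cell_pack[of x y] * M_diff by metis
  then show "m = m'" using * by simp
qed (rule assms(2))

lemma linear_inv_P: "linear (inv P)"
  using P by (simp add: inj_linear_imp_inv_linear bij_is_inj)

lemma finite_M_bounded: assumes "bounded S" shows "finite (M \<inter> S)"
proof -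
  have "bounded (inv P ` S)" using linear_inv_P assms by (simp add: bounded_linear_image linear_linear)
  then have "finite (P ` (Zn \<inter> inv P ` S))" using finite_Zn_bounded by blast
  moreover have "M \<inter> S \<subseteq> P ` (Zn \<inter> inv P ` S)"
  proof
    fix y assume "y \<in> M \<inter> S"
    then obtain x where x: "x \<in> Zn" "y = P x" "P x \<in> S" unfolding M by blast
    have "inv P (P x) = x" using P(2) by (simp add: bij_is_inj)
    then have "x \<in> inv P ` S" using x(3) by (metis image_eqI)
    then show "y \<in> P ` (Zn \<inter> inv P ` S)" using x by blast
  qed
  ultimately show ?thesis using finite_subset by blast
qed

lemma dual_iso: "lattice_iso (adjoint (inv P)) {y. \<forall>m\<in>M. y \<bullet> m \<in> \<int>}"
  and ldet_dual: "ldet (adjoint (inv P)) * ldet P = 1"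
proof -
  have PP: "P (inv P x) = x" "inv P (P x) = x" for x using P(2) by (simp_all add: bij_is_surj surj_f_inv_f bij_is_inj)
  have aP: "adjoint P (adjoint (inv P) x) = x" "adjoint (inv P) (adjoint P x) = x" for x
  proof -
    have "adjoint P (adjoint (inv P) x) \<bullet> y = x \<bullet> y" for y
      using adjoint_works[OF P(1), of "adjoint (inv P) x" y] adjoint_works[OF linear_inv_P, of x "P y"]
      by (simp add: inner_commute PP adjoint_clauses P linear_inv_P)
    then show "adjoint P (adjoint (inv P) x) = x" by (metis vector_eq_rdot)
    have "adjoint (inv P) (adjoint P x) \<bullet> y = x \<bullet> y" for y
      by (simp add: adjoint_clauses P linear_inv_P PP)
    then show "adjoint (inv P) (adjoint P x) = x" by (metis vector_eq_rdot)
  qed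
  have l1: "linear (adjoint (inv P))" by (rule adjoint_linear[OF linear_inv_P])
  have l2: "bij (adjoint (inv P))" using aP by (metis bijI')
  have l3: "{y. \<forall>m\<in>M. y \<bullet> m \<in> \<int>} = adjoint (inv P) ` Zn"
  proof -
    have "(\<forall>m\<in>M. y \<bullet> m \<in> \<int>) \<longleftrightarrow> adjoint P y \<in> Zn" for y
    proof
      assume "\<forall>m\<in>M. y \<bullet> m \<in> \<int>"
      then show "adjoint P y \<in> Zn" using Zn_Basis by (auto simp: Zn_def M adjoint_clauses P)
    next
      assume *: "adjoint P y \<in> Zn"
      show "\<forall>m\<in>M. y \<bullet> m \<in> \<int>"
      proof
        fix m assume "m \<in> M"
        then obtain n where n: "n \<in> Zn" "m = P n" by (auto simp: M)
        have "y \<bullet> m = adjoint P y \<bullet> n" by (simp add: n adjoint_clauses P)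
        also have "\<dots> = (\<Sum>b\<in>Basis. (adjoint P y \<bullet> b) * (n \<bullet> b))" by (rule euclidean_inner)
        also have "\<dots> \<in> \<int>" using * n(1) by (intro Ints_sum Ints_mult) (auto simp: Zn_def)
        finally show "y \<bullet> m \<in> \<int>" .
      qed
    qed
    then have "{y. \<forall>m\<in>M. y \<bullet> m \<in> \<int>} = adjoint P -` Zn" by blast
    also have "\<dots> = adjoint (inv P) ` Zn"
    proof (intro equalityI subsetI)
      fix y assume "y \<in> adjoint P -` Zn"
      then show "y \<in> adjoint (inv P) ` Zn" using aP(2)[of y] by (metis image_eqI vimageD)
    qed (use aP(1) in auto)
    finally show ?thesis .
  qed
  show "lattice_iso (adjoint (inv P)) {y. \<forall>m\<in>M. y \<bullet> m \<in> \<int>}"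
    by (rule lattice_iso.intro) (fact l1 l2 l3)+
  have "ldet (inv P) * ldet P = 1"
    using ldet_comp[OF linear_inv_P P(1)] ldet_id[where ?'a='a] by (simp add: o_def PP)
  then show "ldet (adjoint (inv P)) * ldet P = 1" by (simp add: ldet_adjoint linear_inv_P)
qed

lemma ldet_pos: "ldet P > 0"
proof -
  have "ldet P \<noteq> 0" using ldet_dual by auto
  then show ?thesis using ldet_nonneg[of P] by linarith
qed

text \<open>The half-size gauge balls pack the projection of \<open>M\<close> along \<open>span A\<close> and its dual lattice, whose
  determinants multiply to 1; the volume product is bounded below by \<open>bourgain_milman\<close>.\<close>

lemma transference:
  assumes A: "A \<subseteq> Basis" "A \<subseteq> M" "\<And>m a. m \<in> M \<Longrightarrow> pr (Basis - A) m = 0 \<Longrightarrow> a \<in> A \<Longrightarrow> m \<bullet> a \<in> \<int>"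
    and Y: "finite Y" "Y \<noteq> {}" "\<And>y a. y \<in> Y \<Longrightarrow> a \<in> A \<Longrightarrow> y \<bullet> a = 0"
    and D: "bounded D" "D \<noteq> {}" "\<And>c a. c \<in> D \<Longrightarrow> a \<in> A \<Longrightarrow> c \<bullet> a = 0"
    and YD: "\<And>y c. y \<in> Y \<Longrightarrow> c \<in> D \<Longrightarrow> \<bar>y \<bullet> c\<bar> \<le> 1"
    and hl: "\<And>m. m \<in> M \<Longrightarrow> pr (Basis - A) m \<noteq> 0 \<Longrightarrow> \<exists>y\<in>Y. l \<le> \<bar>y \<bullet> m\<bar>"
    and hw: "\<And>y. (\<forall>m\<in>M. y \<bullet> m \<in> \<int>) \<Longrightarrow> y \<noteq> 0 \<Longrightarrow> (\<forall>a\<in>A. y \<bullet> a = 0) \<Longrightarrow> \<exists>c\<in>D. w \<le> \<bar>c \<bullet> y\<bar>"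
    and lw: "l > 0" "w > 0" and ne: "\<exists>y\<in>Y. y \<noteq> 0"
  defines "j \<equiv> card (Basis - A)"
  shows "(l * w * pi) ^ j \<le> 4 ^ j * fact j"
proof -
  let ?I = "Basis - A"
  have bY: "bounded Y" using Y(1) by (rule finite_imp_bounded)
  define p where "p x = (SUP y\<in>Y. \<bar>y \<bullet> x\<bar>)" for x
  define h where "h x = (SUP c\<in>D. \<bar>c \<bullet> x\<bar>)" for x
  interpret p: cyl_gauge A p using cyl_gauge_sup[OF A(1) bY Y(2,3), of 1] by (simp add: p_def[abs_def])
  interpret h: cyl_gauge A h using cyl_gauge_sup[OF A(1) D, of 1] by (simp add: h_def[abs_def])
  interpret dual: lattice_iso "adjoint (inv P)" "{y. \<forall>m\<in>M. y \<bullet> m \<in> \<int>}" by (rule dual_iso)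
  have ple: "\<bar>y \<bullet> x\<bar> \<le> p x" if "y \<in> Y" for x y unfolding p_def by (rule le_sup_abs_inner[OF bY Y(2) that])
  have hle: "\<bar>c \<bullet> x\<bar> \<le> h x" if "c \<in> D" for x c unfolding h_def by (rule le_sup_abs_inner[OF D(1,2) that])
  have slab_eq: "(x - y) \<bullet> a = 0" if xy: "x \<in> slab A" "y \<in> slab A" "a \<in> A" and int: "(x - y) \<bullet> a \<in> \<int>" for x y a
  proof -
    obtain k where k: "(x - y) \<bullet> a = of_int k" using int by (elim Ints_cases)
    have "0 \<le> x \<bullet> a" "x \<bullet> a < 1" "0 \<le> y \<bullet> a" "y \<bullet> a < 1" using xy by (auto simp: slab_def)
    then have "\<bar>(x - y) \<bullet> a\<bar> < 1" unfolding inner_diff_left by linarith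
    then have "k = 0" unfolding k by linarith
    then show ?thesis using k by simp
  qed
  have "p.V (l/2) \<le> ennreal (ldet P)"
    unfolding p.V_def
  proof (rule packing_le)
    show "{x. p x < l/2} \<inter> slab A \<in> sets borel" using p.less_borel slab_borel[OF A(1)] by blast
    fix x y assume *: "x \<in> {x. p x < l/2} \<inter> slab A" "y \<in> {x. p x < l/2} \<inter> slab A" "x - y \<in> M"
    have pr0: "pr ?I (x - y) = 0"
    proof (rule ccontr)
      assume "pr ?I (x - y) \<noteq> 0"
      then obtain u where u: "u \<in> Y" "l \<le> \<bar>u \<bullet> (x - y)\<bar>" using hl[OF *(3)] by blast
      have "\<bar>u \<bullet> (x - y)\<bar> \<le> \<bar>u \<bullet> x\<bar> + \<bar>u \<bullet> y\<bar>" by (simp add: inner_diff_right)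
      then show False using u(2) ple[OF u(1), of x] ple[OF u(1), of y] * by auto
    qed
    have "(x - y) \<bullet> b = 0" if b: "b \<in> Basis" for b
    proof (cases "b \<in> A")
      case True
      show ?thesis by (rule slab_eq[of x y b]) (use * True A(3)[OF *(3) pr0] in auto)
    next
      case False
      then show ?thesis using pr_inner_basis[of ?I b "x - y"] b by (simp add: pr0)
    qed
    then show "x = y" by (metis eq_iff_diff_eq_0 euclidean_all_zero_iff)
  qed
  moreover have "h.V (w/2) \<le> ennreal (ldet (adjoint (inv P)))"
    unfolding h.V_def
  proof (rule dual.packing_le)
    show "{x. h x < w/2} \<inter> slab A \<in> sets borel" using h.less_borel slab_borel[OF A(1)] by blast
    fix x y assume *: "x \<in> {x. h x < w/2} \<inter> slab A" "y \<in> {x. h x < w/2} \<inter> slab A" "x - y \<in> {y. \<forall>m\<in>M. y \<bullet> m \<in> \<int>}"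
    \<comment> \<open>Because \<open>A\<close> lies in \<open>M\<close>, a dual vector is integral
      on \<open>A\<close>; a difference of two points of the slab then vanishes there.\<close>
    have 0: "\<forall>a\<in>A. (x - y) \<bullet> a = 0" using slab_eq[of x y] * A(2) by blast
    show "x = y"
    proof (rule ccontr)
      assume "x \<noteq> y"
      then obtain u where u: "u \<in> D" "w \<le> \<bar>u \<bullet> (x - y)\<bar>" using hw[of "x - y"] * 0 by auto
      have "\<bar>u \<bullet> (x - y)\<bar> \<le> \<bar>u \<bullet> x\<bar> + \<bar>u \<bullet> y\<bar>" by (simp add: inner_diff_right)
      then show False using u(2) hle[OF u(1), of x] hle[OF u(1), of y] * by auto
    qed
  qed
  ultimately have "p.V (l/2) * h.V (w/2) \<le> ennreal (ldet P) * ennreal (ldet (adjoint (inv P)))"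
    by (rule mult_mono) auto
  also have "\<dots> = 1" using ldet_dual by (simp add: ennreal_mult[symmetric] mult.commute)
  finally have 1: "ennreal ((l/2) ^ j) * p.V 1 * (ennreal ((w/2) ^ j) * h.V 1) \<le> 1"
    using p.V_scale[of "l/2"] h.V_scale[of "w/2"] lw by (simp add: j_def)
  have "ennreal (pi ^ j) \<le> ennreal (fact j) * (p.V 1 * h.V 1)"
    unfolding p.V_def h.V_def p_def h_def j_def by (rule bourgain_milman) (use A Y D YD ne in auto)
  then have "ennreal ((l/2) ^ j * (w/2) ^ j) * ennreal (pi ^ j) \<le> ennreal ((l/2) ^ j * (w/2) ^ j) * (ennreal (fact j) * (p.V 1 * h.V 1))"
    by (rule mult_left_mono) auto
  also have "\<dots> = ennreal (fact j) * (ennreal ((l/2) ^ j) * p.V 1 * (ennreal ((w/2) ^ j) * h.V 1))"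
    using lw by (simp add: ennreal_mult mult_ac)
  also have "\<dots> \<le> ennreal (fact j) * 1" using 1 by (rule mult_left_mono) auto
  finally have "ennreal ((l/2) ^ j * (w/2) ^ j * pi ^ j) \<le> ennreal (fact j)"
    using lw by (simp add: ennreal_mult)
  then have "(l/2) ^ j * (w/2) ^ j * pi ^ j \<le> fact j" by simp
  then have "4 ^ j * ((l/2) ^ j * (w/2) ^ j * pi ^ j) \<le> 4 ^ j * fact j" by simp
  moreover have "4 ^ j * ((l/2) ^ j * (w/2) ^ j * pi ^ j) = (l * w * pi) ^ j"
    by (simp add: power_mult_distrib[symmetric])
  ultimately show ?thesis by simp
qed

end

section \<open>Finite nets in the polar body\<close>

text \<open>\<open>Y\<close> is a finite subset of the polar of \<open>D\<close> inside the
  orthogonal complement of \<open>A\<close> that recovers the gauge of \<open>D\<close> up to the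
  factor 1 - \<epsilon>. Finiteness lets the gauge enter the power sums of \<open>even_norm\<close>.
  The condition on s and c says that the gauge of x is at least t without naming the gauge.\<close>

definition polar_net :: "'a::euclidean_space set \<Rightarrow> 'a set \<Rightarrow> real \<Rightarrow> 'a set \<Rightarrow> bool" where
  "polar_net A D \<epsilon> Y \<longleftrightarrow> finite Y \<and> (\<exists>y\<in>Y. y \<noteq> 0) \<and> (\<forall>y\<in>Y. \<forall>a\<in>A. y \<bullet> a = 0) \<and> (\<forall>y\<in>Y. \<forall>c\<in>D. \<bar>y \<bullet> c\<bar> \<le> 1)
    \<and> (\<forall>x t. t > 0 \<longrightarrow> (\<forall>a\<in>A. x \<bullet> a = 0) \<longrightarrow> (\<forall>s c. 0 \<le> s \<longrightarrow> s < t \<longrightarrow> c \<in> D \<longrightarrow> x \<noteq> s *\<^sub>R c) \<longrightarrow> (\<exists>y\<in>Y. (1 - \<epsilon>) * t \<le> \<bar>y \<bullet> x\<bar>))"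

text \<open>The points of bounded norm outside the interior of the body form a compact set. Each is
  detected up to the factor 1 - \<epsilon> by some polar functional, on an open half-space, so
  finitely many functionals suffice. Points of larger norm are pulled back radially.\<close>

lemma finite_polar_net:
  fixes A D :: "'a::euclidean_space set"
  assumes A: "A \<subset> Basis" and D: "compact D" "convex D" "\<And>c. c \<in> D \<Longrightarrow> - c \<in> D" "\<And>c a. c \<in> D \<Longrightarrow> a \<in> A \<Longrightarrow> c \<bullet> a = 0"
    and r: "r > 0" "\<And>x. (\<And>a. a \<in> A \<Longrightarrow> x \<bullet> a = 0) \<Longrightarrow> norm x \<le> r \<Longrightarrow> x \<in> D"
    and \<epsilon>: "0 < \<epsilon>" "\<epsilon> < 1"
  shows "\<exists>Y. polar_net A D \<epsilon> Y"
proof -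
  let ?I = "Basis - A"
  have A': "A \<subseteq> Basis" using A by blast
  have I: "?I \<subseteq> Basis" by blast
  have pr_perp_id: "pr ?I x = x" if "\<And>a. a \<in> A \<Longrightarrow> x \<bullet> a = 0" for x
    by (rule euclidean_eqI) (use that in \<open>auto simp: pr_inner_basis[OF I]\<close>)
  \<comment> \<open>\<open>D\<close> lies in a subspace that is proper if \<open>A\<close> is
    nonempty; the cylinder over \<open>D\<close> has interior points, as the shrinking argument
    requires.\<close>
  define Dc where "Dc = {x. pr ?I x \<in> D}"
  have D0: "0 \<in> D" using r by (simp add: r(2))
  have cont_pr: "continuous_on UNIV (pr ?I)" by (intro linear_continuous_on linear_conv_bounded_linear[THEN iffD1] linear_pr)
  have Dc_closed: "closed Dc"
    using closed_vimage[OF compact_imp_closed[OF D(1)] cont_pr] by (simp add: Dc_def vimage_def)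
  have Dc_convex: "convex Dc"
    using convex_linear_vimage[OF linear_pr D(2), of ?I] by (simp add: Dc_def vimage_def)
  have "ball 0 r \<subseteq> Dc"
  proof
    fix x :: 'a assume x: "x \<in> ball 0 r"
    have "(norm (pr ?I x))\<^sup>2 \<le> (norm x)\<^sup>2" using norm_pr_split[OF A', of x] by simp
    then have "norm (pr ?I x) \<le> norm x" by simp
    then show "x \<in> Dc" unfolding Dc_def using x A' by (auto intro!: r(2) simp: pr_inner_basis[OF I] subset_iff)
  qed
  then have int0: "0 \<in> interior Dc" using r(1) by (meson centre_in_ball interiorI open_ball)
  obtain R where R: "R > 0" "D \<subseteq> ball 0 R" using bounded_subset_ballD[OF compact_imp_bounded[OF D(1)], of 0] by auto
  define X where "X = ({x. \<forall>a\<in>A. x \<bullet> a = 0} \<inter> cball 0 R) - interior Dc"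
  have "closed {x. \<forall>a\<in>A. x \<bullet> a = 0}"
  proof -
    have "{x. \<forall>a\<in>A. x \<bullet> a = 0} = (\<Inter>a\<in>A. {x. a \<bullet> x = 0})" by (auto simp: inner_commute)
    then show ?thesis using closed_hyperplane by (auto intro!: closed_INT)
  qed
  then have X: "compact X" unfolding X_def by (intro compact_diff closed_Int_compact) auto
  define \<Y> where "\<Y> = {y. (\<forall>a\<in>A. y \<bullet> a = 0) \<and> (\<forall>c\<in>D. \<bar>y \<bullet> c\<bar> \<le> 1)}"
  have X_cov: "\<exists>y\<in>\<Y>. 1 - \<epsilon> < y \<bullet> x" if x: "x \<in> X" for x
  proof -
    \<comment> \<open>Enlarging x by 1 / (1 - \<epsilon>) moves it strictly outside the cylinder:
      otherwise shrinking back towards the interior point 0 would put x into the interior.\<close>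
    define z where "z = (1 / (1 - \<epsilon>)) *\<^sub>R x"
    have zA: "z \<bullet> a = 0" if "a \<in> A" for a using x that by (simp add: X_def z_def)
    have "z \<notin> Dc"
    proof
      assume "z \<in> Dc"
      then have "z - \<epsilon> *\<^sub>R (z - 0) \<in> interior Dc"
        by (intro mem_interior_convex_shrink[OF Dc_convex int0]) (use \<epsilon> in auto)
      moreover have "z - \<epsilon> *\<^sub>R (z - 0) = (1 - \<epsilon>) *\<^sub>R z" by (simp add: algebra_simps)
      ultimately have "x \<in> interior Dc" using \<epsilon> by (simp add: z_def)
      then show False using x by (simp add: X_def)
    qed
    then have "z \<notin> D" using pr_perp_id[OF zA] by (simp add: Dc_def)
    then obtain a b where ab: "a \<bullet> z < b" "\<And>c. c \<in> D \<Longrightarrow> b < a \<bullet> c"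
      using separating_hyperplane_closed_point[OF D(2) compact_imp_closed[OF D(1)]] by blast
    \<comment> \<open>Since 0 lies in \<open>D\<close>, the separating level is negative. Dividing
      by it reverses the inequalities and normalises the functional to at most 1 on \<open>D\<close>
      and more than 1 at z.\<close>
    have b: "b < 0" using ab(2)[OF D0] by simp
    define y where "y = (1 / b) *\<^sub>R pr ?I a"
    have yv: "y \<bullet> v = (a \<bullet> v) / b" if "\<And>a. a \<in> A \<Longrightarrow> v \<bullet> a = 0" for v
      using pr_sym[OF I, of a v] pr_perp_id[OF that] by (simp add: y_def)
    have le: "y \<bullet> c \<le> 1" if "c \<in> D" for c
      using ab(2)[OF that] b by (simp add: yv[OF D(4)[OF that]] divide_le_eq)
    have "\<bar>y \<bullet> c\<bar> \<le> 1" if "c \<in> D" for c using le[OF that] le[OF D(3)[OF that]] by (simp add: abs_le_iff)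
    moreover have "y \<bullet> a' = 0" if "a' \<in> A" for a' using that A' by (simp add: y_def pr_inner_basis[OF I] subset_iff)
    ultimately have "y \<in> \<Y>" by (simp add: \<Y>_def)
    moreover have "1 < y \<bullet> z" using ab(1) b by (simp add: yv[OF zA] less_divide_eq)
    then have "1 - \<epsilon> < y \<bullet> x" using \<epsilon> by (simp add: z_def less_divide_eq)
    ultimately show ?thesis by blast
  qed
  have "X \<subseteq> (\<Union>y\<in>\<Y>. {x. 1 - \<epsilon> < y \<bullet> x})" using X_cov by blast
  moreover have "open {x. 1 - \<epsilon> < y \<bullet> x}" for y by (rule open_halfspace_gt[of "1 - \<epsilon>" y, simplified])
  ultimately obtain Y where Y: "Y \<subseteq> \<Y>" "finite Y" "X \<subseteq> (\<Union>y\<in>Y. {x. 1 - \<epsilon> < y \<bullet> x})"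
    using compactE_image[OF X, of \<Y> "\<lambda>y. {x. 1 - \<epsilon> < y \<bullet> x}"] by metis
  have notint: "x \<in> X" if "\<And>a. a \<in> A \<Longrightarrow> x \<bullet> a = 0" "norm x = R" for x
  proof -
    have "x \<notin> D" using R(2) that(2) by auto
    then have "x \<notin> Dc" using pr_perp_id[OF that(1)] by (simp add: Dc_def)
    then show ?thesis using that interior_subset by (auto simp: X_def)
  qed
  obtain b where b: "b \<in> Basis" "b \<notin> A" using A by blast
  have "R *\<^sub>R b \<in> X" using b R(1) A' by (intro notint) (auto simp: inner_Basis subset_iff)
  then obtain y where y: "y \<in> Y" "1 - \<epsilon> < y \<bullet> (R *\<^sub>R b)" using Y(3) by blast
  then have "y \<noteq> 0" using \<epsilon> by auto
  with y(1) have nz: "\<exists>y\<in>Y. y \<noteq> 0" by blast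
  have fin: "\<exists>y\<in>Y. (1 - \<epsilon>) * t \<le> \<bar>y \<bullet> x\<bar>" if t: "t > 0" and xA: "\<forall>a\<in>A. x \<bullet> a = 0"
    and out: "\<forall>s c. 0 \<le> s \<longrightarrow> s < t \<longrightarrow> c \<in> D \<longrightarrow> x \<noteq> s *\<^sub>R c" for x t
  proof -
    define x' where "x' = (1/t) *\<^sub>R x"
    have x'A: "x' \<bullet> a = 0" if "a \<in> A" for a using xA that by (simp add: x'_def)
    have x0: "x \<noteq> 0" using out t D0 by (metis order_refl scaleR_zero_right)
    have "\<exists>y\<in>Y. 1 - \<epsilon> \<le> y \<bullet> x'"
    proof (cases "norm x' \<le> R")
      case True
      have "x' \<notin> interior Dc"
      proof
        assume "x' \<in> interior Dc"
        then obtain e where e: "e > 0" "cball x' e \<subseteq> Dc" by (meson mem_interior_cball)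
        \<comment> \<open>The hypothesis \<open>out\<close> excludes only factors strictly below t.
          An interior point may be enlarged slightly within \<open>D\<close>, which produces such a
          smaller factor.\<close>
        define \<eta> where "\<eta> = e / norm x'"
        have nx: "norm x' > 0" using x0 t by (simp add: x'_def)
        have \<eta>: "\<eta> > 0" using e nx by (simp add: \<eta>_def)
        have "(1 + \<eta>) *\<^sub>R x' \<in> cball x' e"
          using nx e by (simp add: dist_norm algebra_simps \<eta>_def)
        then have "pr ?I ((1 + \<eta>) *\<^sub>R x') \<in> D" using e by (auto simp: Dc_def)
        moreover have "pr ?I ((1 + \<eta>) *\<^sub>R x') = (1 + \<eta>) *\<^sub>R x'" by (rule pr_perp_id) (simp add: x'A)
        ultimately have "(1 + \<eta>) *\<^sub>R x' \<in> D" by simp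
        moreover have "x = (t / (1 + \<eta>)) *\<^sub>R ((1 + \<eta>) *\<^sub>R x')" using t \<eta> by (simp add: x'_def)
        moreover have "0 \<le> t / (1 + \<eta>)" "t / (1 + \<eta>) < t" using t \<eta> by (auto simp: field_simps)
        ultimately show False using out by blast
      qed
      then have "x' \<in> X" using True x'A by (simp add: X_def)
      then show ?thesis using Y(3) by (auto intro: less_imp_le)
    next
      case False
      then have n: "norm x' > R" by simp
      have "(R / norm x') *\<^sub>R x' \<in> X" using n R(1) x'A by (intro notint) auto
      then obtain y where y: "y \<in> Y" "1 - \<epsilon> < y \<bullet> ((R / norm x') *\<^sub>R x')" using Y(3) by blast
      have "0 < norm x'" using n R(1) by linarith
      then have "R / norm x' \<le> 1" "0 < R / norm x'" using n R(1) by (simp_all add: divide_le_eq)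
      have pos: "0 < y \<bullet> x'"
      proof -
        have "0 < (R / norm x') * (y \<bullet> x')" using y(2) \<epsilon> by simp
        then show ?thesis using \<open>0 < R / norm x'\<close> by (simp only: zero_less_mult_pos)
      qed
      have "(R / norm x') * (y \<bullet> x') \<le> 1 * (y \<bullet> x')" using pos \<open>R / norm x' \<le> 1\<close> by (intro mult_right_mono) auto
      then have "1 - \<epsilon> \<le> y \<bullet> x'" using y(2) by simp
      then show ?thesis using y(1) by blast
    qed
    then obtain y where y: "y \<in> Y" "1 - \<epsilon> \<le> y \<bullet> x'" by blast
    then have "(1 - \<epsilon>) * t \<le> y \<bullet> x" using t by (simp add: x'_def field_simps)
    then show ?thesis using y(1) by (intro bexI[of _ y]) auto
  qed
  show ?thesis
    unfolding polar_net_def using Y(1,2) nz fin by (intro exI[of _ Y] conjI) (auto simp: \<Y>_def)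
qed

text \<open>The inequality of arithmetic and geometric means for 1, ..., j. The induction step uses
  2 <= (1 + 1 / (j + 1))^(j + 1), an instance of Bernoulli's inequality.\<close>

lemma fact_mult_power_le: "fact j * 2 ^ j \<le> (real j + 1) ^ j"
proof (induction j)
  case (Suc j)
  have "fact (Suc j) * 2 ^ Suc j = 2 * (real j + 1) * (fact j * 2 ^ j)" by (simp add: algebra_simps)
  also have "\<dots> \<le> 2 * (real j + 1) * (real j + 1) ^ j" by (intro mult_left_mono Suc.IH) auto
  also have "\<dots> = (real j + 1) ^ Suc j * 2" by simp
  also have "\<dots> \<le> (real j + 1) ^ Suc j * (1 + 1 / (real j + 1)) ^ Suc j"
  proof (intro mult_left_mono)
    have "1 + real (Suc j) * (1 / (real j + 1)) \<le> (1 + 1 / (real j + 1)) ^ Suc j"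
      by (rule Bernoulli_inequality) (simp add: field_simps)
    then show "2 \<le> (1 + 1 / (real j + 1)) ^ Suc j" by (simp add: field_simps)
  qed auto
  also have "\<dots> = (real (Suc j) + 1) ^ Suc j"
    unfolding power_mult_distrib[symmetric] by (rule arg_cong[where f="\<lambda>x. x ^ Suc j"]) (simp add: field_simps)
  finally show ?case .
qed simp

text \<open>Bounding j! reduces this to 2 (j + 1) < j \<pi>, which holds because 2 (j + 1) <= 3 j
  for j >= 2. The strict sign is what contradicts the limiting inequality in
  \<open>short_vector\<close>.\<close>

lemma fact_less_pi: assumes "j \<ge> 2" shows "4 ^ j * fact j < (real j * pi) ^ j"
proof -
  have "4 ^ j * fact j = 2 ^ j * (fact j * 2 ^ j :: real)" by (simp add: power_mult_distrib[symmetric])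
  also have "\<dots> \<le> 2 ^ j * (real j + 1) ^ j" by (intro mult_left_mono fact_mult_power_le) auto
  also have "\<dots> = (2 * (real j + 1)) ^ j" by (rule power_mult_distrib[symmetric])
  also have "\<dots> < (real j * pi) ^ j"
  proof (rule power_strict_mono)
    have "real j * 3 < real j * pi" using assms pi_gt3 by (intro mult_strict_left_mono) auto
    moreover have "2 * (real j + 1) \<le> real j * 3" using assms by simp
    ultimately show "2 * (real j + 1) < real j * pi" by (rule le_less_trans[rotated])
  qed (use assms in auto)
  finally show ?thesis .
qed

section \<open>A lattice basis with long chords\<close>

definition zspan :: "'a::real_vector set \<Rightarrow> 'a set" where
  "zspan V = {m. \<exists>z. m = (\<Sum>v\<in>V. of_int (z v) *\<^sub>R v)}"

locale lattice_body = lattice_iso P M for P :: "'a::euclidean_space \<Rightarrow> 'a" and M +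
  fixes C :: "'a set" and w :: real
  assumes C: "compact C" "convex C" "\<And>c. c \<in> C \<Longrightarrow> - c \<in> C" "0 \<in> interior C"
    and w: "w > 0"
    and width: "\<And>\<phi>. linear \<phi> \<Longrightarrow> (\<And>m. m \<in> M \<Longrightarrow> \<phi> m \<in> \<int>) \<Longrightarrow> (\<exists>x. \<phi> x \<noteq> 0) \<Longrightarrow> \<exists>c\<in>C. w \<le> \<phi> c"
begin

text \<open>A linear map turns \<open>V\<close> into a set \<open>A\<close> of coordinate vectors,
  so that \<open>transference\<close> applies. If every lattice vector outside the span had gauge at
  least j / w modulo the span, then letting l in \<open>transference\<close> increase to j / w would
  give (j \<pi>)^j <= 4^j j!.\<close>

lemma short_vector:
  assumes V: "independent V" "V \<subseteq> M" "M \<inter> span V \<subseteq> zspan V"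
    and j: "card V + j = DIM('a)" "j \<ge> 2"
  shows "\<exists>m\<in>M - span V. \<exists>t c. 0 \<le> t \<and> t < j / w \<and> c \<in> C \<and> m - t *\<^sub>R c \<in> span V"
proof (rule ccontr)
  assume no: "\<not> ?thesis"
  obtain B' where B': "V \<subseteq> B'" "independent B'" "span B' = UNIV"
    using maximal_independent_subset_extend[OF subset_UNIV V(1)] by (metis top.extremum_unique)
  have finB: "finite B'" using B'(2) independent_imp_finite by blast
  have "card B' = DIM('a)" using B' by (metis dim_UNIV dim_eq_card_independent dim_span)
  then obtain F where F: "bij_betw F B' (Basis :: 'a set)" using finB by (metis bij_betw_iff_card finite_Basis)
  obtain \<Psi> where \<Psi>: "linear \<Psi>" "\<And>x. x \<in> B' \<Longrightarrow> \<Psi> x = F x" using linear_independent_extend[OF B'(2)] by blast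
  have \<Psi>B: "\<Psi> ` B' = Basis" using F \<Psi>(2) by (metis bij_betw_imp_surj_on image_cong)
  have "surj \<Psi>" using linear_span_image[OF \<Psi>(1), of B'] B'(3) \<Psi>B by simp
  then have bij: "bij \<Psi>" using linear_surjective_imp_injective[OF \<Psi>(1)] by (simp add: bij_def)
  define A where "A = \<Psi> ` V"
  have A: "A \<subseteq> Basis" using B'(1) \<Psi>B by (auto simp: A_def)
  have injV: "inj_on \<Psi> V" using bij by (meson bij_is_inj inj_on_subset subset_UNIV)
  have cA: "card (Basis - A) = j"
  proof -
    have "card A = card V" using injV by (simp add: A_def card_image)
    then show ?thesis using A j by (simp add: card_Diff_subset finite_subset)
  qed
  let ?I = "Basis - A"
  have I: "?I \<subseteq> Basis" by blast
  have A_proper: "A \<subset> Basis" using A cA j by (metis Diff_cancel card.empty not_numeral_le_zero psubsetI)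
  have spanA: "x \<in> span A \<longleftrightarrow> pr ?I x = 0" for x
  proof
    assume "x \<in> span A"
    then show "pr ?I x = 0"
    proof (induction rule: span_induct_alt)
      case base then show ?case by (simp add: linear_0[OF linear_pr])
    next
      case (step c a y)
      have "pr ?I a = 0" by (rule euclidean_eqI) (use step A in \<open>auto simp: pr_inner_basis[OF I] inner_Basis subset_iff\<close>)
      then show ?case using step by (simp add: linear_add[OF linear_pr] linear_scale[OF linear_pr])
    qed
  next
    assume "pr ?I x = 0"
    then have "x = pr A x" using pr_split[OF A, of x] by simp
    also have "\<dots> \<in> span A" unfolding pr_def by (intro span_sum span_scale span_base)
    finally show "x \<in> span A" .
  qed
  have \<Psi>span: "\<Psi> x \<in> span A \<longleftrightarrow> x \<in> span V" for x
    using linear_span_image[OF \<Psi>(1), of V] bij by (auto simp: A_def bij_def inj_image_mem_iff)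
  have N1: "linear (\<Psi> \<circ> P)" by (rule linear_compose[OF P(1) \<Psi>(1)])
  have N2: "bij (\<Psi> \<circ> P)" by (rule bij_comp[OF P(2) bij])
  have N3: "\<Psi> ` M = (\<Psi> \<circ> P) ` Zn" by (simp add: M image_comp)
  interpret N: lattice_iso "\<Psi> \<circ> P" "\<Psi> ` M" by (rule lattice_iso.intro) (fact N1 N2 N3)+
  \<comment> \<open>The orthogonal complement of \<open>A\<close> represents the quotient by the
    span of \<open>V\<close>, and \<open>D\<close> represents the image of \<open>C\<close> in
    it.\<close>
  define D where "D = (pr ?I \<circ> \<Psi>) ` C"
  have lin: "linear (pr ?I \<circ> \<Psi>)" using linear_compose[OF \<Psi>(1) linear_pr] .
  have D1: "compact D" "convex D" "\<And>c. c \<in> D \<Longrightarrow> - c \<in> D" "\<And>c a. c \<in> D \<Longrightarrow> a \<in> A \<Longrightarrow> c \<bullet> a = 0"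
  proof -
    show "compact D" unfolding D_def 
      by (intro compact_continuous_image C linear_continuous_on linear_conv_bounded_linear[THEN iffD1] lin)
    show "convex D" unfolding D_def by (rule convex_linear_image[OF lin C(2)])
    show "- c \<in> D" if "c \<in> D" for c
      using that C(3) linear_neg[OF lin] unfolding D_def by (metis (no_types, lifting) image_iff)
    show "c \<bullet> a = 0" if "c \<in> D" "a \<in> A" for c a
      using that A by (auto simp: D_def pr_inner_basis[OF I] subset_iff)
  qed
  have "linear (inv \<Psi>)" using \<Psi>(1) bij by (simp add: inj_linear_imp_inv_linear bij_is_inj)
  then obtain K where K: "K > 0" "\<And>x. norm (inv \<Psi> x) \<le> K * norm x" by (metis linear_bounded_pos)
  obtain \<rho> where \<rho>: "\<rho> > 0" "cball 0 \<rho> \<subseteq> C" using C(4) by (meson mem_interior_cball)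
  have r: "\<rho> / K > 0" using K \<rho> by simp
  have rD: "x \<in> D" if "\<And>a. a \<in> A \<Longrightarrow> x \<bullet> a = 0" "norm x \<le> \<rho> / K" for x
  proof -
    have "norm (inv \<Psi> x) \<le> K * (\<rho> / K)" using K that(2) by (meson mult_left_mono order_trans less_imp_le)
    then have "inv \<Psi> x \<in> C" using K \<rho> by (intro subsetD[OF \<rho>(2)]) simp
    moreover have "pr ?I x = x" by (rule euclidean_eqI) (use that in \<open>auto simp: pr_inner_basis[OF I]\<close>)
    ultimately show ?thesis unfolding D_def using bij 
      by (intro image_eqI[of _ _ "inv \<Psi> x"]) (auto simp: bij_is_surj surj_f_inv_f)
  qed
  have jw: "j / w > 0" using j w by simp
  have main: "((1 - \<epsilon>) * (j / w) * w * pi) ^ j \<le> 4 ^ j * fact j" if \<epsilon>: "0 < \<epsilon>" "\<epsilon> < 1" for \<epsilon>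
  proof -
    obtain Y where net: "polar_net A D \<epsilon> Y"
      using finite_polar_net[OF A_proper D1(1,2) _ _ r _ \<epsilon>] D1(3,4) rD by blast
    have Y: "finite Y" "\<exists>y\<in>Y. y \<noteq> 0" "\<And>y a. y \<in> Y \<Longrightarrow> a \<in> A \<Longrightarrow> y \<bullet> a = 0" "\<And>y c. y \<in> Y \<Longrightarrow> c \<in> D \<Longrightarrow> \<bar>y \<bullet> c\<bar> \<le> 1"
      using net unfolding polar_net_def by blast+
    have Yt: "\<exists>y\<in>Y. (1 - \<epsilon>) * t \<le> \<bar>y \<bullet> x\<bar>"
      if "t > 0" "\<forall>a\<in>A. x \<bullet> a = 0" "\<And>s c. 0 \<le> s \<Longrightarrow> s < t \<Longrightarrow> c \<in> D \<Longrightarrow> x \<noteq> s *\<^sub>R c" for x t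
      using net that unfolding polar_net_def by blast
    show ?thesis unfolding cA[symmetric]
    proof (rule N.transference[OF A _ _ Y(1) _ Y(3) _ _ D1(4) Y(4) _ _ _ w Y(2)])
      show "A \<subseteq> \<Psi> ` M" using V(2) by (auto simp: A_def)
      show "Y \<noteq> {}" using Y(2) by blast
      show "bounded D" by (rule compact_imp_bounded[OF D1(1)])
      show "D \<noteq> {}" using C(4) interior_subset by (auto simp: D_def)
      show "(1 - \<epsilon>) * (real (card (Basis - A)) / w) > 0" unfolding cA using jw \<epsilon> by (intro mult_pos_pos) auto
    next
      fix m' a assume m': "m' \<in> \<Psi> ` M" "pr ?I m' = 0" and a: "a \<in> A"
      then obtain m where m: "m \<in> M" "m' = \<Psi> m" by blast
      then have "m \<in> zspan V" using V(3) m'(2) by (auto simp: spanA[symmetric] \<Psi>span)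
      then obtain z where z: "m = (\<Sum>v\<in>V. of_int (z v) *\<^sub>R v)" by (auto simp: zspan_def)
      have "m' = (\<Sum>v\<in>V. of_int (z v) *\<^sub>R \<Psi> v)" unfolding m z by (simp add: linear_sum[OF \<Psi>(1)] linear_scale[OF \<Psi>(1)])
      moreover have "\<Psi> v \<bullet> a \<in> \<int>" if "v \<in> V" for v 
      proof -
        have "\<Psi> v \<in> Basis" "a \<in> Basis" using that a A by (auto simp: A_def)
        then show ?thesis by (auto simp: inner_Basis)
      qed
      ultimately show "m' \<bullet> a \<in> \<int>" by (auto simp: inner_sum_left intro!: Ints_sum Ints_mult)
    next
      fix m' assume m': "m' \<in> \<Psi> ` M" "pr ?I m' \<noteq> 0"
      then obtain m where m: "m \<in> M" "m' = \<Psi> m" by blast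
      have mV: "m \<notin> span V" using m' m by (simp add: spanA[symmetric] \<Psi>span)
      have "\<exists>y\<in>Y. (1 - \<epsilon>) * (j / w) \<le> \<bar>y \<bullet> pr ?I m'\<bar>"
      proof (rule Yt[OF jw])
        show "\<forall>a\<in>A. pr ?I m' \<bullet> a = 0" using A by (auto simp: pr_inner_basis[OF I] subset_iff)
        fix s d assume s: "0 \<le> s" "s < j / w" "d \<in> D"
        then obtain c where c: "c \<in> C" "d = pr ?I (\<Psi> c)" by (auto simp: D_def)
        show "pr ?I m' \<noteq> s *\<^sub>R d"
        proof
          assume "pr ?I m' = s *\<^sub>R d"
          then have "pr ?I (\<Psi> (m - s *\<^sub>R c)) = 0"
            by (simp add: m c linear_diff[OF \<Psi>(1)] linear_scale[OF \<Psi>(1)] linear_diff[OF linear_pr] linear_scale[OF linear_pr])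
          then have "m - s *\<^sub>R c \<in> span V" by (simp add: spanA[symmetric] \<Psi>span)
          then show False using no m(1) mV s c(1) by blast
        qed
      qed
      then show "\<exists>y\<in>Y. (1 - \<epsilon>) * (real (card (Basis - A)) / w) \<le> \<bar>y \<bullet> m'\<bar>"
        using pr_perp[OF A Y(3)] by (simp add: cA)
    next
      fix y assume y: "\<forall>m\<in>\<Psi> ` M. y \<bullet> m \<in> \<int>" "y \<noteq> 0" "\<forall>a\<in>A. y \<bullet> a = 0"
      have "\<exists>c\<in>C. w \<le> y \<bullet> \<Psi> c"
      proof (rule width)
        show "linear (\<lambda>x. y \<bullet> \<Psi> x)" using linear_compose[OF \<Psi>(1)] by (intro linearI) (auto simp: linear_add[OF \<Psi>(1)] linear_scale[OF \<Psi>(1)] inner_add_right)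
        show "\<exists>x. y \<bullet> \<Psi> x \<noteq> 0" using y(2) \<open>surj \<Psi>\<close> by (metis inner_eq_zero_iff surjD)
      qed (use y in auto)
      then obtain c where "c \<in> C" "w \<le> y \<bullet> \<Psi> c" by blast
      moreover have "y \<bullet> pr ?I (\<Psi> c) = y \<bullet> \<Psi> c" using y by (intro pr_perp[OF A]) auto
      ultimately show "\<exists>c\<in>D. w \<le> \<bar>c \<bullet> y\<bar>" unfolding D_def by (intro bexI[of _ "pr ?I (\<Psi> c)"]) (auto simp: inner_commute)
    qed
  qed
  have "(\<lambda>n. ((1 - inverse (real (Suc (Suc n)))) * (j / w) * w * pi) ^ j) \<longlonglongrightarrow> ((1 - 0) * (j / w) * w * pi) ^ j"
    by (rule tendsto_power tendsto_mult tendsto_diff tendsto_const LIMSEQ_Suc[OF LIMSEQ_inverse_real_of_nat])+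
  then have "((1 - 0) * (j / w) * w * pi) ^ j \<le> 4 ^ j * fact j"
  proof (rule LIMSEQ_le_const2, intro exI allI impI)
    fix n :: nat
    show "((1 - inverse (real (Suc (Suc n)))) * (j / w) * w * pi) ^ j \<le> 4 ^ j * fact j"
      by (rule main) (auto simp: inverse_less_1_iff)
  qed
  then show False using fact_less_pi[OF j(2)] w by simp
qed

text \<open>The short vector m need not extend \<open>V\<close> to a basis of the lattice in the
  enlarged span. A lattice vector v with the smallest positive m-coordinate \<tau> does, and since
  \<tau> <= 1, a chord measured in multiples of v is at least as long as one measured in multiples
  of m.\<close>

lemma next_vector:
  assumes V: "independent V" "V \<subseteq> M" "M \<inter> span V \<subseteq> zspan V"
    and j: "card V + j = DIM('a)" "j > 0"
  shows "\<exists>v\<in>M - span V. M \<inter> span (insert v V) \<subseteq> zspan (insert v V) \<and> (\<exists>l\<ge>w / j. \<exists>c\<in>C. c - l *\<^sub>R v \<in> span V)"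
proof -
  have finV: "finite V" using V(1) independent_imp_finite by blast
  have "M - span V \<noteq> {}"
  proof
    assume "M - span V = {}"
    then have "span M \<subseteq> span V" by (metis Diff_eq_empty_iff span_mono span_span)
    moreover have "span M = UNIV"
      unfolding M using linear_span_image[OF P(1), of Zn] span_mono[of Basis Zn] Zn_Basis P(2) 
      by (metis bij_is_surj span_Basis subsetI top.extremum_unique)
    ultimately have "dim V = DIM('a)" by (metis dim_UNIV dim_span top.extremum_unique)
    then show False using j dim_eq_card_independent[OF V(1)] by simp
  qed
  then obtain m0 where m0: "m0 \<in> M - span V" by blast
  \<comment> \<open>For j = 1 any lattice vector outside the span serves as m.\<close>
  have "\<exists>m\<in>M - span V. j \<ge> 2 \<longrightarrow> (\<exists>t c. 0 \<le> t \<and> t < j / w \<and> c \<in> C \<and> m - t *\<^sub>R c \<in> span V)"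
    using short_vector[OF V j(1)] m0 by blast
  then obtain m where m: "m \<in> M" "m \<notin> span V" and mt: "j \<ge> 2 \<Longrightarrow> \<exists>t c. 0 \<le> t \<and> t < j / w \<and> c \<in> C \<and> m - t *\<^sub>R c \<in> span V"
    by blast
  have indm: "independent (insert m V)" using V(1) m(2) by (simp add: independent_insert)
  have mV: "m \<notin> V" using m(2) span_base by blast
  obtain \<psi> :: "'a \<Rightarrow> real" where \<psi>: "linear \<psi>" "\<And>x. x \<in> insert m V \<Longrightarrow> \<psi> x = (if x = m then 1 else 0)"
    using linear_independent_extend[OF indm, of "\<lambda>x. if x = m then 1 else 0"] by blast
  have \<psi>m: "\<psi> m = 1" using \<psi>(2) by simp
  have \<psi>V: "\<psi> x = 0" if "x \<in> span V" for x
    using that by (rule linear_eq_0_on_span[OF \<psi>(1), rotated]) (use \<psi>(2) mV in auto)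
  have dec: "x - \<psi> x *\<^sub>R m \<in> span V" if xs: "x \<in> span (insert m V)" for x
  proof -
    obtain k where k: "x - k *\<^sub>R m \<in> span V" using span_breakdown_eq[of x m V] xs by blast
    then have "\<psi> (x - k *\<^sub>R m) = 0" by (rule \<psi>V)
    then have "\<psi> x = k" by (simp add: linear_diff[OF \<psi>(1)] linear_scale[OF \<psi>(1)] \<psi>m)
    then show ?thesis using k by simp
  qed
  \<comment> \<open>Subtracting integer combinations of \<open>V\<close> moves every lattice vector
    with m-coordinate in [0, 1] into the bounded set \<open>S\<close>. Hence only finitely many such
    coordinates occur and the least positive one exists.\<close>
  define S where "S = (\<lambda>(\<tau>, s). \<tau> *\<^sub>R m + (\<Sum>v\<in>V. s v *\<^sub>R v)) ` ({0..1::real} \<times> (V \<rightarrow>\<^sub>E {0..1}))"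
  have "bounded S"
  proof -
    have "norm y \<le> norm m + (\<Sum>v\<in>V. norm v)" if yS: "y \<in> S" for y
    proof -
      obtain \<tau> s where ts: "\<tau> \<in> {0..1}" "s \<in> V \<rightarrow>\<^sub>E {0..1}" "y = \<tau> *\<^sub>R m + (\<Sum>v\<in>V. s v *\<^sub>R v)" using yS by (auto simp: S_def)
      have "norm y \<le> norm (\<tau> *\<^sub>R m) + norm (\<Sum>v\<in>V. s v *\<^sub>R v)" unfolding ts(3) by (rule norm_triangle_ineq)
      also have "\<dots> \<le> 1 * norm m + (\<Sum>v\<in>V. 1 * norm v)"
        using ts(1,2) by (intro add_mono order_trans[OF norm_sum] sum_mono) (auto simp: PiE_iff mult_left_le_one_le)
      finally show ?thesis by simp
    qed
    then show ?thesis by (auto simp: bounded_iff)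
  qed
  have finMS: "finite (M \<inter> S)" by (rule finite_M_bounded[OF \<open>bounded S\<close>])
  have red: "\<exists>x'\<in>M \<inter> S. \<psi> x' = \<psi> x" if x: "x \<in> M" "x \<in> span (insert m V)" "0 \<le> \<psi> x" "\<psi> x \<le> 1" for x
  proof -
    obtain s where s: "x - \<psi> x *\<^sub>R m = (\<Sum>v\<in>V. s v *\<^sub>R v)" using dec[OF x(2)] span_finite[OF finV] by auto
    define x' where "x' = x - (\<Sum>v\<in>V. of_int \<lfloor>s v\<rfloor> *\<^sub>R v)"
    have "(\<Sum>v\<in>V. of_int \<lfloor>s v\<rfloor> *\<^sub>R v) \<in> M"
    proof -
      have "(\<Sum>v\<in>V'. of_int \<lfloor>s v\<rfloor> *\<^sub>R v) \<in> M" if "finite V'" "V' \<subseteq> V" for V'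
        using that V(2) by (induction V' rule: finite_induct) (auto intro!: M_0 M_add M_scale)
      then show ?thesis using finV by blast
    qed
    then have "x' \<in> M" using x(1) by (simp add: x'_def M_diff)
    moreover have "x' \<in> S"
    proof -
      have "x' = \<psi> x *\<^sub>R m + (\<Sum>v\<in>V. restrict (\<lambda>v. frac (s v)) V v *\<^sub>R v)"
      proof -
        have "x = \<psi> x *\<^sub>R m + (\<Sum>v\<in>V. s v *\<^sub>R v)" using s by (simp add: algebra_simps)
        then have "x' = \<psi> x *\<^sub>R m + ((\<Sum>v\<in>V. s v *\<^sub>R v) - (\<Sum>v\<in>V. of_int \<lfloor>s v\<rfloor> *\<^sub>R v))" by (simp add: x'_def)
        also have "(\<Sum>v\<in>V. s v *\<^sub>R v) - (\<Sum>v\<in>V. of_int \<lfloor>s v\<rfloor> *\<^sub>R v) = (\<Sum>v\<in>V. restrict (\<lambda>v. frac (s v)) V v *\<^sub>R v)"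
          by (simp add: sum_subtractf[symmetric] frac_def scaleR_diff_left)
        finally show ?thesis .
      qed
      then show ?thesis unfolding S_def using x(3,4)
        by (intro image_eqI[of _ _ "(\<psi> x, restrict (\<lambda>v. frac (s v)) V)"]) (auto simp: frac_lt_1 less_imp_le)
    qed
    moreover have "\<psi> x' = \<psi> x"
    proof -
      have "(\<Sum>v\<in>V. of_int \<lfloor>s v\<rfloor> *\<^sub>R v) \<in> span V" by (intro span_sum span_scale span_base)
      then show ?thesis using \<psi>V by (simp add: x'_def linear_diff[OF \<psi>(1)])
    qed
    ultimately show ?thesis by blast
  qed
  define Q where "Q = \<psi> ` {x \<in> M \<inter> S. \<psi> x > 0}"
  have finQ: "finite Q" unfolding Q_def by (intro finite_imageI finite_subset[OF _ finMS]) auto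
  have "1 \<in> Q" using red[OF m(1) span_base] \<psi>m by (force simp: Q_def)
  define \<tau> where "\<tau> = Min Q"
  have "\<tau> \<in> Q" using finQ \<open>1 \<in> Q\<close> by (auto simp: \<tau>_def intro!: Min_in)
  then obtain v where v: "v \<in> M" "v \<in> S" "\<psi> v = \<tau>" "\<tau> > 0" by (auto simp: Q_def)
  have \<tau>1: "\<tau> \<le> 1" using finQ \<open>1 \<in> Q\<close> by (simp add: \<tau>_def)
  have minQ: "\<tau> \<le> \<psi> x" if xx: "x \<in> M" "x \<in> span (insert m V)" "\<psi> x > 0" "\<psi> x \<le> 1" for x
  proof -
    obtain x' where x': "x' \<in> M \<inter> S" "\<psi> x' = \<psi> x" using red[OF xx(1,2) less_imp_le[OF xx(3)] xx(4)] by blast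
    have "\<psi> x \<in> Q" unfolding Q_def using x' xx(3) by (intro image_eqI[of _ _ x']) auto
    then show ?thesis unfolding \<tau>_def by (rule Min_le[OF finQ])
  qed
  have vsp: "v \<in> span (insert m V)"
  proof -
    obtain \<tau>' s where "v = \<tau>' *\<^sub>R m + (\<Sum>v\<in>V. s v *\<^sub>R v)" using v(2) by (auto simp: S_def)
    then show ?thesis by (auto intro!: span_add span_sum span_scale intro: span_base)
  qed
  have vm: "v - \<tau> *\<^sub>R m \<in> span V" using dec[OF vsp] v(3) by simp
  have vV: "v \<notin> span V" using \<psi>V v(3,4) by force
  have sub: "span (insert v V) \<subseteq> span (insert m V)"
    by (rule span_minimal) (auto intro: vsp span_base)
  have key: "\<exists>k::int. \<psi> x = k * \<tau> \<and> x - of_int k *\<^sub>R v \<in> span V" if x: "x \<in> M" "x \<in> span (insert m V)" for x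
  proof -
    define k where "k = \<lfloor>\<psi> x / \<tau>\<rfloor>"
    define x' where "x' = x - of_int k *\<^sub>R v"
    have fl: "of_int k \<le> \<psi> x / \<tau>" "\<psi> x / \<tau> < of_int k + 1" unfolding k_def by linarith+
    have px': "\<psi> x' = \<psi> x - of_int k * \<tau>" unfolding x'_def linear_diff[OF \<psi>(1)] linear_scale[OF \<psi>(1)] v(3) by simp
    have "of_int k * \<tau> \<le> \<psi> x" using fl(1) pos_le_divide_eq[OF v(4)] by blast
    moreover have "\<psi> x < (of_int k + 1) * \<tau>" using fl(2) pos_divide_less_eq[OF v(4)] by blast
    ultimately have ps: "0 \<le> \<psi> x'" "\<psi> x' < \<tau>" unfolding px' by (simp_all add: distrib_right)
    have x'M: "x' \<in> M" "x' \<in> span (insert m V)" using x v(1) vsp by (auto simp: x'_def intro!: M_diff M_scale span_diff span_scale)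
    have "\<not> 0 < \<psi> x'" using minQ[OF x'M] ps(2) \<tau>1 by linarith
    then have "\<psi> x' = 0" using ps(1) by linarith
    then have "x' \<in> span V" using dec[OF x'M(2)] by simp
    moreover have "\<psi> x = of_int k * \<tau>" using \<open>\<psi> x' = 0\<close> px' by linarith
    ultimately show ?thesis unfolding x'_def by blast
  qed
  have prim: "M \<inter> span (insert v V) \<subseteq> zspan (insert v V)"
  proof
    fix x assume x: "x \<in> M \<inter> span (insert v V)"
    then obtain k :: int where k: "x - of_int k *\<^sub>R v \<in> span V" using key[of x] sub by blast
    then have "x - of_int k *\<^sub>R v \<in> zspan V" using V(3) x v(1) by (auto intro!: M_diff M_scale)
    then obtain z where z: "x - of_int k *\<^sub>R v = (\<Sum>u\<in>V. of_int (z u) *\<^sub>R u)" by (auto simp: zspan_def)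
    have vnV: "v \<notin> V" using vV span_base by blast
    have "x = (\<Sum>u\<in>insert v V. of_int ((z(v := k)) u) *\<^sub>R u)"
    proof -
      have "(\<Sum>u\<in>insert v V. of_int ((z(v := k)) u) *\<^sub>R u) = of_int k *\<^sub>R v + (\<Sum>u\<in>V. of_int ((z(v := k)) u) *\<^sub>R u)"
        using finV vnV by simp
      also have "(\<Sum>u\<in>V. of_int ((z(v := k)) u) *\<^sub>R u) = (\<Sum>u\<in>V. of_int (z u) *\<^sub>R u)"
        using vnV by (intro sum.cong) auto
      finally show ?thesis using z by (simp add: algebra_simps)
    qed
    then show "x \<in> zspan (insert v V)" unfolding zspan_def by blast
  qed
  \<comment> \<open>\<open>fact_less_pi\<close> fails for \<open>j = 1\<close>, where the width itself gives the chord\<close>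
  have "\<exists>l\<ge>w / j. \<exists>c\<in>C. c - l *\<^sub>R v \<in> span V"
  proof (cases "j \<ge> 2")
    case True
    then obtain t c where tc: "0 \<le> t" "t < j / w" "c \<in> C" "m - t *\<^sub>R c \<in> span V" using mt by blast
    have t: "t > 0" using tc m(2) by (cases "t = 0") auto
    \<comment> \<open>Modulo the span of \<open>V\<close>, m is t c and v is \<tau> m, so c is v
      divided by \<tau> t.\<close>
    define l where "l = 1 / (\<tau> * t)"
    have "w / j \<le> 1 / t" using tc(2) t w j(2) by (simp add: field_simps)
    also have "\<dots> \<le> l" using t v(4) \<tau>1 by (simp add: l_def divide_simps mult_left_le_one_le)
    finally have "w / j \<le> l" .
    moreover have "c - l *\<^sub>R v \<in> span V"
    proof -
      have "c - l *\<^sub>R v = - (1/t) *\<^sub>R (m - t *\<^sub>R c) - l *\<^sub>R (v - \<tau> *\<^sub>R m)"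
        using t v(4) by (simp add: l_def algebra_simps)
      also have "\<dots> \<in> span V" by (rule span_diff[OF span_scale[OF tc(4)] span_scale[OF vm]])
      finally show ?thesis .
    qed
    ultimately show ?thesis using tc(3) by blast
  next
    case False
    then have j1: "j = 1" using j(2) by simp
    have "span (insert m V) = UNIV"
    proof -
      have "card (insert m V) = DIM('a)" using finV mV j j1 by simp
      then have "dim (insert m V) = DIM('a)" using dim_eq_card_independent[OF indm] by simp
      then show ?thesis using dim_eq_full by blast
    qed
    then have all: "x \<in> span (insert m V)" for x by simp
    \<comment> \<open>The quotient has rank one and is generated by v, so the v-coordinate is an
      integral functional and the definition of the width applies to it.\<close>
    define \<phi> where "\<phi> x = \<psi> x / \<tau>" for x
    have \<phi>: "linear \<phi>" unfolding \<phi>_def by (intro linearI) (auto simp: linear_add[OF \<psi>(1)] linear_scale[OF \<psi>(1)] add_divide_distrib)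
    have "\<exists>c\<in>C. w \<le> \<phi> c"
    proof (rule width[OF \<phi>])
      show "\<phi> x \<in> \<int>" if "x \<in> M" for x using key[OF that all] v(4) by (auto simp: \<phi>_def)
      show "\<exists>x. \<phi> x \<noteq> 0" using v by (intro exI[of _ v]) (simp add: \<phi>_def)
    qed
    then obtain c where c: "c \<in> C" "w \<le> \<phi> c" by blast
    have "c - \<phi> c *\<^sub>R v = (c - \<psi> c *\<^sub>R m) - \<phi> c *\<^sub>R (v - \<tau> *\<^sub>R m)"
      using v(4) by (simp add: \<phi>_def algebra_simps)
    also have "\<dots> \<in> span V" by (rule span_diff[OF dec[OF all] span_scale[OF vm]])
    finally show ?thesis using c j1 by (intro exI[of _ "\<phi> c"]) auto
  qed
  then show ?thesis using v(1) vV prim by blast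
qed

lemma chain:
  "i \<le> DIM('a) \<Longrightarrow> \<exists>v :: nat \<Rightarrow> 'a. inj_on v {..<i} \<and> independent (v ` {..<i}) \<and> v ` {..<i} \<subseteq> M \<and> M \<inter> span (v ` {..<i}) \<subseteq> zspan (v ` {..<i}) \<and>
     (\<forall>k<i. \<exists>l\<ge>w / real (DIM('a) - k). \<exists>c\<in>C. c - l *\<^sub>R v k \<in> span (v ` {..<k}))"
proof (induction i)
  case 0
  then show ?case by (auto simp: zspan_def independent_empty)
next
  case (Suc i)
  then obtain v :: "nat \<Rightarrow> 'a" where v: "inj_on v {..<i}" "independent (v ` {..<i})" "v ` {..<i} \<subseteq> M" "M \<inter> span (v ` {..<i}) \<subseteq> zspan (v ` {..<i})"
    "\<forall>k<i. \<exists>l\<ge>w / real (DIM('a) - k). \<exists>c\<in>C. c - l *\<^sub>R v k \<in> span (v ` {..<k})" by auto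
  have "card (v ` {..<i}) + (DIM('a) - i) = DIM('a)" using v(1) Suc.prems by (simp add: card_image)
  from next_vector[OF v(2-4) this] Suc.prems
  obtain x where x: "x \<in> M - span (v ` {..<i})" "M \<inter> span (insert x (v ` {..<i})) \<subseteq> zspan (insert x (v ` {..<i}))"
    "\<exists>l\<ge>w / real (DIM('a) - i). \<exists>c\<in>C. c - l *\<^sub>R x \<in> span (v ` {..<i})" by auto
  define v' where "v' = v(i := x)"
  have im: "v' ` {..<k} = v ` {..<k}" if "k \<le> i" for k using that by (auto simp: v'_def image_iff)
  have im': "v' ` {..<Suc i} = insert x (v ` {..<i})" by (simp add: lessThan_Suc im) (simp add: v'_def)
  have xn: "x \<notin> v ` {..<i}" using x(1) span_base[of x "v ` {..<i}"] by blast
  have "inj_on v' {..<Suc i}"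
  proof -
    have "inj_on v' {..<i} = inj_on v {..<i}" by (rule inj_on_cong) (simp add: v'_def)
    moreover have "v' i \<notin> v' ` {..<i}" using xn im[of i] by (simp add: v'_def)
    ultimately show ?thesis using v(1) by (simp add: lessThan_Suc)
  qed
  moreover have "independent (v' ` {..<Suc i})" unfolding im' using v(2) x(1) by (simp add: independent_insert)
  moreover have "\<forall>k<Suc i. \<exists>l\<ge>w / real (DIM('a) - k). \<exists>c\<in>C. c - l *\<^sub>R v' k \<in> span (v' ` {..<k})"
  proof (intro allI impI)
    fix k assume "k < Suc i"
    then show "\<exists>l\<ge>w / real (DIM('a) - k). \<exists>c\<in>C. c - l *\<^sub>R v' k \<in> span (v' ` {..<k})"
      using v(5) x(3) by (cases "k = i") (auto simp: im v'_def)
  qed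
  moreover have "v' ` {..<Suc i} \<subseteq> M" unfolding im' using v(3) x(1) by blast
  moreover have "M \<inter> span (v' ` {..<Suc i}) \<subseteq> zspan (v' ` {..<Suc i})" unfolding im' by (rule x(2))
  ultimately show ?case by blast
qed

end

section \<open>Lattice points in the interior\<close>

lemma emeasure_affine:
  fixes S :: "'a::euclidean_space set"
  assumes c: "c \<noteq> 0" and S: "S \<in> sets borel"
  shows "(\<lambda>x. t + c *\<^sub>R x) ` S \<in> sets borel"
    and "emeasure lborel ((\<lambda>x. t + c *\<^sub>R x) ` S) = ennreal (\<bar>c\<bar> ^ DIM('a)) * emeasure lborel S"
proof -
  let ?T = "\<lambda>x. t + c *\<^sub>R x"
  have im: "?T ` S = (\<lambda>x. (1/c) *\<^sub>R (x - t)) -` S"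
  proof (intro equalityI subsetI)
    fix x assume "x \<in> (\<lambda>x. (1/c) *\<^sub>R (x - t)) -` S"
    then have "(1/c) *\<^sub>R (x - t) \<in> S" "x = ?T ((1/c) *\<^sub>R (x - t))" using c by auto
    then show "x \<in> ?T ` S" by blast
  qed (use c in auto)
  have "(\<lambda>x. (1/c) *\<^sub>R (x - t)) -` S \<inter> space borel \<in> sets borel"
    by (rule measurable_sets[OF _ S]) simp
  then show b: "?T ` S \<in> sets borel" by (simp add: im)
  have "emeasure lborel (?T ` S) = emeasure (density (distr lborel borel ?T) (\<lambda>_. ennreal (\<bar>c\<bar> ^ DIM('a)))) (?T ` S)"
    using lborel_affine[OF c, of t] by (simp add: ennreal_power)
  also have "\<dots> = ennreal (\<bar>c\<bar> ^ DIM('a)) * emeasure (distr lborel borel ?T) (?T ` S)"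
    by (rule emeasure_density_const) (simp add: b)
  also have "emeasure (distr lborel borel ?T) (?T ` S) = emeasure lborel (?T -` ?T ` S)"
    using b by (subst emeasure_distr) auto
  also have "?T -` ?T ` S = S" using c by auto
  finally show "emeasure lborel (?T ` S) = ennreal (\<bar>c\<bar> ^ DIM('a)) * emeasure lborel S" .
qed

lemma sum_rev_real: "(\<Sum>k<n. real (n - k)) = real n * (real n + 1) / 2"
proof (induction n)
  case (Suc n)
  have "(\<Sum>k<Suc n. real (Suc n - k)) = (\<Sum>k<n. real (Suc n - k)) + 1" by simp
  also have "(\<Sum>k<n. real (Suc n - k)) = (\<Sum>k<n. real (n - k) + 1)" by (rule sum.cong) (auto simp: Suc_diff_le)
  also have "\<dots> = real n * (real n + 1) / 2 + n" using Suc by (simp add: sum.distrib)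
  finally show ?case by (simp add: field_simps)
qed simp

locale lattice_convex = lattice_iso P M for P :: "'a::euclidean_space \<Rightarrow> 'a" and M +
  fixes K :: "'a set" and w :: real
  assumes K: "compact K" "convex K" "interior K \<noteq> {}"
    and w: "w > 0"
    and widthK: "\<And>\<phi>. linear \<phi> \<Longrightarrow> (\<And>m. m \<in> M \<Longrightarrow> \<phi> m \<in> \<int>) \<Longrightarrow> (\<exists>x. \<phi> x \<noteq> 0) \<Longrightarrow> \<exists>a\<in>K. \<exists>b\<in>K. w \<le> \<phi> b - \<phi> a"
begin

lemma lattice_body: "lattice_body P M {b - a |b a. b \<in> K \<and> a \<in> K} w"
proof
  let ?C = "{b - a |b a. b \<in> K \<and> a \<in> K}"
  have eq: "?C = (\<Union>x\<in>K. \<Union>y\<in>K. {x - y})" by blast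
  show "compact ?C" using compact_differences[OF K(1) K(1)] .
  show "convex ?C" using convex_differences[OF K(2) K(2)] unfolding eq .
  show "- c \<in> ?C" if "c \<in> ?C" for c using that by force
  obtain c0 e where e: "e > 0" "ball c0 e \<subseteq> K" using K(3) by (meson ex_in_conv mem_interior)
  have "ball 0 e \<subseteq> ?C"
  proof
    fix x :: 'a assume "x \<in> ball 0 e"
    then have "c0 + x \<in> K" "c0 \<in> K" using e by (auto simp: dist_norm intro!: subsetD[OF e(2)])
    moreover have "x = (c0 + x) - c0" by simp
    ultimately show "x \<in> ?C" by blast
  qed
  then show "0 \<in> interior ?C" using e(1) by (meson centre_in_ball interiorI open_ball)
  show "w > 0" by (rule w)
  fix \<phi> :: "'a \<Rightarrow> real" assume \<phi>: "linear \<phi>" "\<And>m. m \<in> M \<Longrightarrow> \<phi> m \<in> \<int>" "\<exists>x. \<phi> x \<noteq> 0"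
  obtain a b where "a \<in> K" "b \<in> K" "w \<le> \<phi> b - \<phi> a" using widthK[OF \<phi>] by blast
  then show "\<exists>c\<in>?C. w \<le> \<phi> c" by (intro bexI[of _ "b - a"]) (auto simp: linear_diff[OF \<phi>(1)])
qed

end

text \<open>The data that \<open>chain\<close> yields for the difference body of \<open>K\<close>,
  with each element of that body written as a difference of two points of \<open>K\<close>.\<close>

locale chain_body = lattice_convex P M K w for P :: "'a::euclidean_space \<Rightarrow> 'a" and M K w +
  fixes v a b :: "nat \<Rightarrow> 'a" and l :: "nat \<Rightarrow> real"
  assumes v: "inj_on v {..<DIM('a)}" "independent (v ` {..<DIM('a)})" "v ` {..<DIM('a)} \<subseteq> M" "M \<inter> span (v ` {..<DIM('a)}) \<subseteq> zspan (v ` {..<DIM('a)})"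
    and ab: "k < DIM('a) \<Longrightarrow> a k \<in> K" "k < DIM('a) \<Longrightarrow> b k \<in> K"
    and l: "k < DIM('a) \<Longrightarrow> w / real (DIM('a) - k) \<le> l k"
    and tri: "k < DIM('a) \<Longrightarrow> b k - a k - l k *\<^sub>R v k \<in> span (v ` {..<k})"
begin

definition u where "u k = (1 / l k) *\<^sub>R (b k - a k)"

lemma l_pos: "k < DIM('a) \<Longrightarrow> l k > 0"
  using l[of k] w by (meson divide_pos_pos less_le_trans of_nat_0_less_iff zero_less_diff)

lemma u_v: "k < DIM('a) \<Longrightarrow> u k - v k \<in> span (v ` {..<k})"
proof -
  assume k: "k < DIM('a)"
  have "u k - v k = (1 / l k) *\<^sub>R (b k - a k - l k *\<^sub>R v k)" using l_pos[OF k] by (simp add: u_def algebra_simps)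
  then show ?thesis using tri[OF k] by (simp add: span_scale)
qed

lemma span_mono_v: "k \<le> i \<Longrightarrow> span (v ` {..<k}) \<subseteq> span (v ` {..<i})"
  by (intro span_mono image_mono) auto

lemma u_span: assumes "k < i" "k < DIM('a)" shows "u k \<in> span (v ` {..<i})"
proof -
  have "v k \<in> span (v ` {..<i})" using assms by (intro span_base) auto
  moreover have "u k - v k \<in> span (v ` {..<i})" using u_v[OF assms(2)] span_mono_v[of k i] assms by auto
  ultimately have "(u k - v k) + v k \<in> span (v ` {..<i})" by (rule span_add[rotated])
  then show ?thesis by simp
qed

lemma span_all: "span (v ` {..<DIM('a)}) = UNIV"
proof -
  have "card (v ` {..<DIM('a)}) = DIM('a)" using v(1) by (simp add: card_image)
  then have "dim (v ` {..<DIM('a)}) = DIM('a)" using dim_eq_card_independent[OF v(2)] by simp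
  then show ?thesis by (simp add: dim_eq_full)
qed

text \<open>Since u k equals v k modulo the earlier basis vectors, the coefficients can be chosen
  one at a time from the top: each has a unit interval to choose from, which makes its v-coordinate
  integral, and the error falls into the earlier directions. The lower ends of the intervals are
  free.\<close>

lemma lattice_fit:
  "i \<le> DIM('a) \<Longrightarrow> x \<in> span (v ` {..<i}) \<Longrightarrow> \<exists>t. (\<forall>k<i. lo k \<le> t k \<and> t k < lo k + 1) \<and> x + (\<Sum>k<i. t k *\<^sub>R u k) \<in> M"
proof (induction i arbitrary: x)
  case 0
  then show ?case by (simp add: M_0)
next
  case (Suc i)
  have "v ` {..<Suc i} = insert (v i) (v ` {..<i})" by (simp add: lessThan_Suc)
  then obtain \<tau> where \<tau>: "x - \<tau> *\<^sub>R v i \<in> span (v ` {..<i})" using Suc.prems(2) span_breakdown_eq[of x "v i"] by auto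
  \<comment> \<open>\<open>z\<close> becomes the coefficient of v i in the lattice point. Replacing
    v i by u i costs ti (u i - v i), which \<open>x'\<close> passes on to the lower
    directions.\<close>
  define z where "z = \<lceil>\<tau> + lo i\<rceil>"
  define ti where "ti = of_int z - \<tau>"
  have ti: "lo i \<le> ti" "ti < lo i + 1" unfolding ti_def z_def by linarith+
  define x' where "x' = x - \<tau> *\<^sub>R v i + ti *\<^sub>R (u i - v i)"
  have "x' \<in> span (v ` {..<i})" unfolding x'_def using \<tau> u_v[of i] Suc.prems by (intro span_add span_scale) auto
  then obtain t where t: "\<forall>k<i. lo k \<le> t k \<and> t k < lo k + 1" "x' + (\<Sum>k<i. t k *\<^sub>R u k) \<in> M"
    using Suc.IH[of x'] Suc.prems by auto
  have "v i \<in> M" using v(3) Suc.prems by auto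
  then have "x' + (\<Sum>k<i. t k *\<^sub>R u k) + of_int z *\<^sub>R v i \<in> M" by (rule M_add[OF t(2) M_scale])
  moreover have "x' + (\<Sum>k<i. t k *\<^sub>R u k) + of_int z *\<^sub>R v i = x + (\<Sum>k<Suc i. (t(i := ti)) k *\<^sub>R u k)"
  proof -
    have "(\<Sum>k<i. (t(i := ti)) k *\<^sub>R u k) = (\<Sum>k<i. t k *\<^sub>R u k)" by (rule sum.cong) auto
    moreover have "x' + of_int z *\<^sub>R v i = x + ti *\<^sub>R u i" by (simp add: x'_def ti_def algebra_simps)
    ultimately show ?thesis by (simp add: algebra_simps)
  qed
  ultimately have "x + (\<Sum>k<Suc i. (t(i := ti)) k *\<^sub>R u k) \<in> M" by simp
  moreover have "\<forall>k<Suc i. lo k \<le> (t(i := ti)) k \<and> (t(i := ti)) k < lo k + 1" using t(1) ti by (auto simp: less_Suc_eq)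
  ultimately show ?case by blast
qed

lemma coordinate_functional:
  assumes i: "i < DIM('a)"
  shows "\<exists>\<psi>. linear \<psi> \<and> (\<forall>k<DIM('a). \<psi> (v k) = (if k = i then 1 else (0::real))) \<and> (\<forall>m\<in>M. \<psi> m \<in> \<int>)"
proof -
  obtain \<psi> :: "'a \<Rightarrow> real" where \<psi>: "linear \<psi>" "\<And>x. x \<in> v ` {..<DIM('a)} \<Longrightarrow> \<psi> x = (if x = v i then 1 else 0)"
    using linear_independent_extend[OF v(2), of "\<lambda>x. if x = v i then 1 else 0"] by blast
  have vk: "\<psi> (v k) = (if k = i then 1 else 0)" if "k < DIM('a)" for k
    using \<psi>(2)[of "v k"] that i v(1) by (auto simp: inj_on_def)
  moreover have "\<psi> m \<in> \<int>" if "m \<in> M" for m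
  proof -
    have "m \<in> zspan (v ` {..<DIM('a)})" using v(4) that span_all by blast
    then obtain z where z: "m = (\<Sum>x\<in>v ` {..<DIM('a)}. of_int (z x) *\<^sub>R x)" by (auto simp: zspan_def)
    show ?thesis unfolding z using \<psi>(2) by (auto simp: linear_sum[OF \<psi>(1)] linear_scale[OF \<psi>(1)] intro!: Ints_sum Ints_mult)
  qed
  ultimately show ?thesis using \<psi>(1) by blast
qed

text \<open>The coordinate functional of the top basis vector is integral on \<open>M\<close>, kills
  the earlier u k and is 1 on the last one. So the last coefficient is an integer of absolute value
  below 1.\<close>

lemma lattice_pack:
  "i \<le> DIM('a) \<Longrightarrow> (\<Sum>k<i. s k *\<^sub>R u k) \<in> M \<Longrightarrow> (\<And>k. k < i \<Longrightarrow> \<bar>s k\<bar> < 1) \<Longrightarrow> \<forall>k<i. s k = 0"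
proof (induction i)
  case (Suc i)
  obtain \<psi> where \<psi>: "linear \<psi>" "\<forall>k<DIM('a). \<psi> (v k) = (if k = i then 1 else (0::real))" "\<forall>m\<in>M. \<psi> m \<in> \<int>"
    using coordinate_functional[of i] Suc.prems(1) by auto
  have \<psi>0: "\<psi> x = 0" if "x \<in> span (v ` {..<i})" for x
    by (rule linear_eq_0_on_span[OF \<psi>(1) _ that]) (use \<psi>(2) Suc.prems(1) in auto)
  have "\<psi> (\<Sum>k<i. s k *\<^sub>R u k) = 0"
    using Suc.prems(1) by (intro \<psi>0 span_sum span_scale u_span) auto
  moreover have "\<psi> (u i) = 1"
  proof -
    have "\<psi> (u i - v i) = 0" using u_v[of i] Suc.prems(1) by (intro \<psi>0) auto
    then show ?thesis using \<psi>(2) Suc.prems(1) by (simp add: linear_diff[OF \<psi>(1)])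
  qed
  ultimately have "\<psi> (\<Sum>k<Suc i. s k *\<^sub>R u k) = s i" by (simp add: linear_add[OF \<psi>(1)] linear_scale[OF \<psi>(1)])
  then have "s i \<in> \<int>" using \<psi>(3) Suc.prems(2) by metis
  moreover have "\<bar>s i\<bar> < 1" using Suc.prems(3) by simp
  ultimately have si: "s i = 0" using Ints_nonzero_abs_ge1 by force
  then have "\<forall>k<i. s k = 0" using Suc.prems by (intro Suc.IH) auto
  then show ?case using si by (simp add: less_Suc_eq)
qed simp

text \<open>The half-open parallelepiped of the vectors u k both packs by
  \<open>lattice_pack\<close> and covers by \<open>lattice_fit\<close>; the two volume comparisons
  give equality of the determinants.\<close>

lemma ex_chord_coordinates: "\<exists>U e. linear U \<and> bij U \<and> bij_betw e {..<DIM('a)} (Basis :: 'a set) \<and> (\<forall>x. U x = (\<Sum>k<DIM('a). (x \<bullet> e k) *\<^sub>R u k)) \<and> ldet U = ldet P"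
proof -
  obtain e where e: "bij_betw e {..<DIM('a)} (Basis :: 'a set)"
    using ex_bij_betw_nat_finite[OF finite_Basis] by (metis atLeast0LessThan)
  define U where "U x = (\<Sum>k<DIM('a). (x \<bullet> e k) *\<^sub>R u k)" for x
  have U: "linear U" unfolding U_def by (intro linearI) (auto simp: inner_add_left scaleR_add_left sum.distrib scaleR_sum_right)
  have "inj U"
    unfolding linear_injective_0[OF U]
  proof (intro allI impI)
    fix x assume x: "U x = 0"
    \<comment> \<open>Dividing by 1 + norm x makes the coefficients smaller than 1, so that
      \<open>lattice_pack\<close>, a statement about lattice points, also proves linear
      independence.\<close>
    define s where "s k = (x \<bullet> e k) / (1 + norm x)" for k
    have "(\<Sum>k<DIM('a). s k *\<^sub>R u k) = (1 / (1 + norm x)) *\<^sub>R U x" by (simp add: s_def U_def scaleR_sum_right)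
    then have "(\<Sum>k<DIM('a). s k *\<^sub>R u k) \<in> M" using x M_0 by simp
    moreover have "\<bar>s k\<bar> < 1" if "k < DIM('a)" for k
    proof -
      have "e k \<in> Basis" using e that by (auto simp: bij_betw_def)
      then have "\<bar>x \<bullet> e k\<bar> \<le> norm x" by (rule Basis_le_norm)
      then show ?thesis by (simp add: s_def divide_less_eq add_pos_nonneg)
    qed
    ultimately have "\<forall>k<DIM('a). s k = 0" by (intro lattice_pack) auto
    then have "\<forall>k<DIM('a). x \<bullet> e k = 0" using norm_ge_zero[of x] by (auto simp: s_def add_nonneg_eq_0_iff)
    moreover have "\<exists>k<DIM('a). c = e k" if "c \<in> Basis" for c using e that by (auto simp: bij_betw_def)
    ultimately show "x = 0" by (metis euclidean_all_zero_iff)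
  qed
  then have bij: "bij U" using linear_injective_imp_surjective[OF U] by (simp add: bij_def)
  have sb: "(slab Basis :: 'a set) \<in> sets borel" by (rule slab_borel) simp
  have F: "U ` slab Basis \<in> sets borel" by (rule linear_image_borel[OF U bij sb])
  have eF: "emeasure lborel (U ` slab Basis) = ennreal (ldet U)"
    using emeasure_ldet[OF U bij sb] by (simp add: emeasure_slab)
  have eB: "e k \<in> Basis" if "k < DIM('a)" for k using e that by (auto simp: bij_betw_def)
  have "ennreal (ldet U) \<le> ennreal (ldet P)"
    unfolding eF[symmetric]
  proof (rule packing_le[OF F])
    fix x y assume "x \<in> U ` slab Basis" "y \<in> U ` slab Basis" and xy: "x - y \<in> M"
    then obtain p q where p: "p \<in> slab Basis" "x = U p" and q: "q \<in> slab Basis" "y = U q" by blast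
    have d: "x - y = (\<Sum>k<DIM('a). (p \<bullet> e k - q \<bullet> e k) *\<^sub>R u k)"
      unfolding p q U_def by (simp add: sum_subtractf scaleR_diff_left)
    have "\<forall>k<DIM('a). p \<bullet> e k - q \<bullet> e k = 0"
    proof (rule lattice_pack)
      show "(\<Sum>k<DIM('a). (p \<bullet> e k - q \<bullet> e k) *\<^sub>R u k) \<in> M" using xy d by simp
      fix k assume "k < DIM('a)"
      then have "0 \<le> p \<bullet> e k" "p \<bullet> e k < 1" "0 \<le> q \<bullet> e k" "q \<bullet> e k < 1" using p(1) q(1) eB by (auto simp: slab_def)
      then show "\<bar>p \<bullet> e k - q \<bullet> e k\<bar> < 1" by linarith
    qed simp
    then have "x - y = 0" unfolding d by simp
    then show "x = y" by simp
  qed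
  moreover have "ennreal (ldet P) \<le> ennreal (ldet U)"
    unfolding eF[symmetric]
  proof (rule covering_ge[OF F])
    fix x
    \<comment> \<open>\<open>lattice_fit\<close> adds the combination whereas a covering subtracts a
      lattice point; hence the sign of x.\<close>
    obtain t where t: "\<forall>k<DIM('a). 0 \<le> t k \<and> t k < 1" "- x + (\<Sum>k<DIM('a). t k *\<^sub>R u k) \<in> M"
      using lattice_fit[of "DIM('a)" "- x" "\<lambda>_. 0"] span_all by auto
    define p where "p = (\<Sum>k<DIM('a). t k *\<^sub>R e k)"
    have p: "p \<bullet> e k = t k" if k: "k < DIM('a)" for k
    proof -
      have "p \<bullet> e k = (\<Sum>i<DIM('a). t i * (e i \<bullet> e k))" by (simp add: p_def inner_sum_left)
      also have "\<dots> = (\<Sum>i<DIM('a). if i = k then t k else 0)"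
        using e k eB by (intro sum.cong) (auto simp: inner_Basis bij_betw_def inj_on_def)
      finally show ?thesis using k by simp
    qed
    have "0 \<le> p \<bullet> c \<and> p \<bullet> c < 1" if "c \<in> Basis" for c
    proof -
      obtain k where "k < DIM('a)" "c = e k" using e \<open>c \<in> Basis\<close> by (auto simp: bij_betw_def)
      then show ?thesis using p[of k] t(1) by simp
    qed
    then have "p \<in> slab Basis" by (simp add: slab_def)
    moreover have "U p = (\<Sum>k<DIM('a). t k *\<^sub>R u k)" unfolding U_def by (rule sum.cong) (auto simp: p)
    ultimately have "(\<Sum>k<DIM('a). t k *\<^sub>R u k) \<in> U ` slab Basis" by (metis image_eqI)
    moreover have "0 - (- x + (\<Sum>k<DIM('a). t k *\<^sub>R u k)) \<in> M" by (rule M_diff[OF M_0 t(2)])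
    ultimately show "\<exists>m\<in>M. x - m \<in> U ` slab Basis"
      by (intro bexI[of _ "x - (\<Sum>k<DIM('a). t k *\<^sub>R u k)"]) auto
  qed
  ultimately have "ldet U = ldet P" by simp
  then show ?thesis using U bij e unfolding U_def by blast
qed

lemma interior_combination:
  assumes c: "c \<in> interior K" and \<beta>: "\<And>k. k < DIM('a) \<Longrightarrow> 0 \<le> \<beta> k" "(\<Sum>k<DIM('a). \<beta> k) < 1" and y: "\<And>k. k < DIM('a) \<Longrightarrow> y k \<in> K"
  shows "(1 - (\<Sum>k<DIM('a). \<beta> k)) *\<^sub>R c + (\<Sum>k<DIM('a). \<beta> k *\<^sub>R y k) \<in> interior K"
proof (cases "(\<Sum>k<DIM('a). \<beta> k) = 0")
  case True
  then have "\<forall>k\<in>{..<DIM('a)}. \<beta> k = 0" using \<beta>(1) by (subst (asm) sum_nonneg_eq_0_iff) auto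
  then show ?thesis using c True by simp
next
  case False
  define s where "s = (\<Sum>k<DIM('a). \<beta> k)"
  have s: "s > 0" "s < 1" using False \<beta> sum_nonneg[of "{..<DIM('a)}" \<beta>] by (auto simp: s_def less_le)
  define z where "z = (\<Sum>k<DIM('a). (\<beta> k / s) *\<^sub>R y k)"
  have "z \<in> K" unfolding z_def
  proof (rule convex_sum[OF _ K(2)])
    show "(\<Sum>k<DIM('a). \<beta> k / s) = 1" using s by (simp add: sum_divide_distrib[symmetric] s_def)
  qed (use \<beta>(1) y s in auto)
  then have "z - (1 - s) *\<^sub>R (z - c) \<in> interior K"
    using s by (intro mem_interior_convex_shrink[OF K(2) c]) auto
  moreover have "z - (1 - s) *\<^sub>R (z - c) = (1 - s) *\<^sub>R c + s *\<^sub>R z" by (simp add: algebra_simps)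
  moreover have "s *\<^sub>R z = (\<Sum>k<DIM('a). \<beta> k *\<^sub>R y k)" using s by (simp add: z_def scaleR_sum_right)
  ultimately show ?thesis by (simp add: s_def)
qed

text \<open>Give the chord from a k to b k the weight \<nu> k / l k. Running through the chord then
  moves the weighted sum by \<nu> k times u k, so a whole box with sides \<nu> in the directions u
  fits. The weight left over goes to c and makes the points interior.\<close>

lemma interior_point:
  assumes c: "c \<in> interior K" and \<nu>: "\<And>k. k < DIM('a) \<Longrightarrow> 0 < \<nu> k" "(\<Sum>k<DIM('a). \<nu> k / l k) < 1" and t: "\<And>k. k < DIM('a) \<Longrightarrow> 0 \<le> t k \<and> t k \<le> \<nu> k"
  shows "(1 - (\<Sum>k<DIM('a). \<nu> k / l k)) *\<^sub>R c + (\<Sum>k<DIM('a). (\<nu> k / l k) *\<^sub>R a k) + (\<Sum>k<DIM('a). t k *\<^sub>R u k) \<in> interior K"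
proof -
  define y where "y k = (1 - t k / \<nu> k) *\<^sub>R a k + (t k / \<nu> k) *\<^sub>R b k" for k
  have "(1 - (\<Sum>k<DIM('a). \<nu> k / l k)) *\<^sub>R c + (\<Sum>k<DIM('a). (\<nu> k / l k) *\<^sub>R y k) \<in> interior K"
  proof (rule interior_combination[OF c _ \<nu>(2)])
    fix k assume k: "k < DIM('a)"
    show "0 \<le> \<nu> k / l k" using \<nu>(1)[OF k] l_pos[OF k] by simp
    have "0 \<le> t k / \<nu> k" "t k / \<nu> k \<le> 1" using t[OF k] \<nu>(1)[OF k] by auto
    then show "y k \<in> K" unfolding y_def using ab[OF k] by (intro convexD[OF K(2)]) auto
  qed
  moreover have "(\<Sum>k<DIM('a). (\<nu> k / l k) *\<^sub>R y k) = (\<Sum>k<DIM('a). (\<nu> k / l k) *\<^sub>R a k) + (\<Sum>k<DIM('a). t k *\<^sub>R u k)"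
    unfolding sum.distrib[symmetric]
  proof (rule sum.cong[OF refl])
    fix k assume "k \<in> {..<DIM('a)}"
    then have "\<nu> k \<noteq> 0" using \<nu>(1)[of k] by auto
    have "y k = a k + (t k / \<nu> k) *\<^sub>R (b k - a k)" by (simp add: y_def algebra_simps)
    then have "(\<nu> k / l k) *\<^sub>R y k = (\<nu> k / l k) *\<^sub>R a k + ((\<nu> k / l k) * (t k / \<nu> k)) *\<^sub>R (b k - a k)" by (simp add: scaleR_add_right)
    also have "(\<nu> k / l k) * (t k / \<nu> k) = t k * (1 / l k)" using \<open>\<nu> k \<noteq> 0\<close> by simp
    finally show "(\<nu> k / l k) *\<^sub>R y k = (\<nu> k / l k) *\<^sub>R a k + t k *\<^sub>R u k" by (simp add: u_def)
  qed
  ultimately show ?thesis by (simp add: add.assoc)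
qed

lemma inv_l_le: "k < DIM('a) \<Longrightarrow> 1 / l k \<le> real (DIM('a) - k) / w"
  using l[of k] l_pos[of k] w by (simp add: field_simps)

lemma sum_inv_l: "(\<Sum>k<DIM('a). 1 / l k) \<le> real DIM('a) * (real DIM('a) + 1) / (2 * w)"
proof -
  have "(\<Sum>k<DIM('a). 1 / l k) \<le> (\<Sum>k<DIM('a). real (DIM('a) - k) / w)" by (intro sum_mono inv_l_le) auto
  also have "\<dots> = real DIM('a) * (real DIM('a) + 1) / (2 * w)" unfolding sum_divide_distrib[symmetric] sum_rev_real by simp
  finally show ?thesis .
qed

lemma DIM_ge_1: "real DIM('a) \<ge> 1"
  using DIM_positive[where 'a='a] by (metis One_nat_def Suc_leI of_nat_1 of_nat_le_iff)

lemma sum_inv_l': "(\<Sum>k<DIM('a). 1 / l k) \<le> (real DIM('a))\<^sup>2 / w"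
proof -
  have "real DIM('a) * (real DIM('a) + 1) / 2 \<le> (real DIM('a))\<^sup>2" using mult_left_mono[OF DIM_ge_1, of "real DIM('a)"] by (simp add: power2_eq_square field_simps)
  then have "real DIM('a) * (real DIM('a) + 1) / 2 / w \<le> (real DIM('a))\<^sup>2 / w" using w by (intro divide_right_mono) auto
  then show ?thesis using sum_inv_l by simp
qed

theorem interior_lattice_point: assumes "w > (real DIM('a))\<^sup>2" shows "M \<inter> interior K \<noteq> {}"
proof -
  obtain c where c: "c \<in> interior K" using K(3) by blast
  have "(real DIM('a))\<^sup>2 / w < 1" using assms w by simp
  then have s: "(\<Sum>k<DIM('a). 1 / l k) < 1" using sum_inv_l' by linarith
  define x where "x = (1 - (\<Sum>k<DIM('a). 1 / l k)) *\<^sub>R c + (\<Sum>k<DIM('a). (1 / l k) *\<^sub>R a k)"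
  obtain t where t: "\<forall>k<DIM('a). 0 \<le> t k \<and> t k < 0 + 1" "x + (\<Sum>k<DIM('a). t k *\<^sub>R u k) \<in> M"
    using lattice_fit[of "DIM('a)" x "\<lambda>_. 0"] span_all by auto
  have "x + (\<Sum>k<DIM('a). t k *\<^sub>R u k) \<in> interior K"
    unfolding x_def using t(1) s by (intro interior_point[OF c, where \<nu>="\<lambda>_. 1"]) (auto simp: less_imp_le)
  then show ?thesis using t(2) by blast
qed

text \<open>With \<nu> = 2 the interior contains a translate of the doubled parallelepiped, so its
  half contains a translate of the parallelepiped itself, which meets every translate of
  \<open>M\<close>.\<close>

theorem half_interior_covering: assumes "w > 2 * (real DIM('a))\<^sup>2" shows "\<exists>m\<in>M. \<exists>y\<in>interior K. m = x + (1/2) *\<^sub>R y"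
proof -
  obtain c where c: "c \<in> interior K" using K(3) by blast
  have "(\<Sum>k<DIM('a). 2 / l k) = 2 * (\<Sum>k<DIM('a). 1 / l k)" by (simp add: sum_distrib_left)
  also have "\<dots> \<le> 2 * ((real DIM('a))\<^sup>2 / w)" using sum_inv_l' by simp
  also have "\<dots> < 1" using assms w by simp
  finally have s: "(\<Sum>k<DIM('a). 2 / l k) < 1" .
  define x0 where "x0 = (1 - (\<Sum>k<DIM('a). 2 / l k)) *\<^sub>R c + (\<Sum>k<DIM('a). (2 / l k) *\<^sub>R a k)"
  obtain t where t: "\<forall>k<DIM('a). 0 \<le> t k \<and> t k < 0 + 1" "(x + (1/2) *\<^sub>R x0) + (\<Sum>k<DIM('a). t k *\<^sub>R u k) \<in> M"
    using lattice_fit[of "DIM('a)" "x + (1/2) *\<^sub>R x0" "\<lambda>_. 0"] span_all by auto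
  have "x0 + (\<Sum>k<DIM('a). (2 * t k) *\<^sub>R u k) \<in> interior K"
    unfolding x0_def using t(1) s by (intro interior_point[OF c, where \<nu>="\<lambda>_. 2"]) (auto simp: less_imp_le)
  moreover have "(x + (1/2) *\<^sub>R x0) + (\<Sum>k<DIM('a). t k *\<^sub>R u k) = x + (1/2) *\<^sub>R (x0 + (\<Sum>k<DIM('a). (2 * t k) *\<^sub>R u k))"
    by (simp add: scaleR_add_right scaleR_sum_right)
  ultimately show ?thesis using t(2) by metis
qed

text \<open>For each i there are two interior lattice points whose difference is v i modulo the
  earlier basis vectors. They come from a box of side 2 in direction i and side 1 elsewhere, which
  fits because the extra weight 1 / l i is at most d / w and d (d + 1) / 2 + d <= d (d + 1).\<close>

theorem dim_interior_lattice_points: assumes "w > real DIM('a) * (real DIM('a) + 1)" shows "dim {p - q |p q. p \<in> M \<inter> interior K \<and> q \<in> M \<inter> interior K} = DIM('a)"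
proof -
  let ?\<Delta> = "{p - q |p q. p \<in> M \<inter> interior K \<and> q \<in> M \<inter> interior K}"
  obtain c where c: "c \<in> interior K" using K(3) by blast
  have step: "\<exists>d\<in>?\<Delta>. d - v i \<in> span (v ` {..<i})" if i: "i < DIM('a)" for i
  proof -
    define \<nu> where "\<nu> k = (if k = i then 2 else 1 :: real)" for k
    have "(\<Sum>k<DIM('a). \<nu> k / l k) = (\<Sum>k<DIM('a). 1 / l k + (if k = i then 1 / l i else 0))"
      by (rule sum.cong) (auto simp: \<nu>_def)
    also have "\<dots> = (\<Sum>k<DIM('a). 1 / l k) + 1 / l i" using i by (simp add: sum.distrib)
    also have "\<dots> \<le> real DIM('a) * (real DIM('a) + 1) / (2 * w) + real DIM('a) / w"
    proof (rule add_mono[OF sum_inv_l])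
      have "real (DIM('a) - i) / w \<le> real DIM('a) / w" using w by (intro divide_right_mono) auto
      then show "1 / l i \<le> real DIM('a) / w" using inv_l_le[OF i] by linarith
    qed
    also have "\<dots> < 1"
    proof -
      have "real DIM('a) * (real DIM('a) + 1) / 2 + real DIM('a) \<le> real DIM('a) * (real DIM('a) + 1)"
        using mult_left_mono[OF DIM_ge_1, of "real DIM('a)"] by (simp add: field_simps)
      then have "real DIM('a) * (real DIM('a) + 1) / 2 + real DIM('a) < w" using assms by linarith
      moreover have "real DIM('a) * (real DIM('a) + 1) / (2 * w) + real DIM('a) / w = (real DIM('a) * (real DIM('a) + 1) / 2 + real DIM('a)) / w" using w by (simp add: field_simps)
      ultimately show ?thesis using w by simp
    qed
    finally have s: "(\<Sum>k<DIM('a). \<nu> k / l k) < 1" .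
    define x where "x = (1 - (\<Sum>k<DIM('a). \<nu> k / l k)) *\<^sub>R c + (\<Sum>k<DIM('a). (\<nu> k / l k) *\<^sub>R a k)"
    have inK: "x + (\<Sum>k<DIM('a). t k *\<^sub>R u k) \<in> interior K" if "\<And>k. k < DIM('a) \<Longrightarrow> 0 \<le> t k \<and> t k \<le> \<nu> k" for t
      unfolding x_def using that s by (intro interior_point[OF c]) (auto simp: \<nu>_def)
    obtain t where t: "\<forall>k<DIM('a). 0 \<le> t k \<and> t k < 0 + 1" "x + (\<Sum>k<DIM('a). t k *\<^sub>R u k) \<in> M"
      using lattice_fit[of "DIM('a)" x "\<lambda>_. 0"] span_all by auto
    define y where "y = (u i - v i) - (\<Sum>k<i. t k *\<^sub>R u k)"
    have y: "y \<in> span (v ` {..<i})" unfolding y_def using i by (intro span_diff[OF u_v[OF i]] span_sum span_scale u_span) auto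
    then obtain t' where t': "\<forall>k<i. 0 \<le> t' k \<and> t' k < 0 + 1" "y + (\<Sum>k<i. t' k *\<^sub>R u k) \<in> M"
      using lattice_fit[of i y "\<lambda>_. 0"] i by auto
    \<comment> \<open>The second point keeps the coefficients above i and raises the one at i by 1,
      which the side 2 allows. The lower ones are refitted: \<open>y\<close> is what adding u i and
      dropping the old lower terms leaves beyond v i, and t' makes it a lattice vector.\<close>
    define s' where "s' k = (if k < i then t' k else if k = i then t i + 1 else t k)" for k
    define p where "p = x + (\<Sum>k<DIM('a). t k *\<^sub>R u k)"
    define p' where "p' = x + (\<Sum>k<DIM('a). s' k *\<^sub>R u k)"
    have diff: "p' - p = v i + (y + (\<Sum>k<i. t' k *\<^sub>R u k))"
    proof -
      have "p' - p = (\<Sum>k<DIM('a). (s' k - t k) *\<^sub>R u k)" by (simp add: p_def p'_def sum_subtractf scaleR_diff_left)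
      also have "\<dots> = (\<Sum>k<Suc i. (s' k - t k) *\<^sub>R u k)"
        using i by (intro sum.mono_neutral_right) (auto simp: s'_def)
      also have "\<dots> = (\<Sum>k<i. (t' k - t k) *\<^sub>R u k) + u i" by (simp add: s'_def)
      also have "\<dots> = v i + (y + (\<Sum>k<i. t' k *\<^sub>R u k))" by (simp add: y_def sum_subtractf scaleR_diff_left)
      finally show ?thesis .
    qed
    have vi: "v i \<in> M" using v(3) i by auto
    have "p \<in> interior K" unfolding p_def using t(1) by (intro inK) (auto simp: \<nu>_def less_imp_le intro: order_trans[of _ 1])
    moreover have "p' \<in> interior K" unfolding p'_def using t(1) t'(1) i by (intro inK) (auto simp: \<nu>_def s'_def less_imp_le)
    moreover have "p \<in> M" using t(2) by (simp add: p_def)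
    moreover have "p' \<in> M"
    proof -
      have "p + (v i + (y + (\<Sum>k<i. t' k *\<^sub>R u k))) \<in> M" by (rule M_add[OF \<open>p \<in> M\<close> M_add[OF vi t'(2)]])
      then show ?thesis using diff by (metis add_diff_cancel_left' diff_add_cancel add.commute)
    qed
    ultimately have "p' - p \<in> ?\<Delta>" by blast
    moreover have "p' - p - v i \<in> span (v ` {..<i})"
    proof -
      have "y + (\<Sum>k<i. t' k *\<^sub>R u k) \<in> span (v ` {..<i})" using y i by (intro span_add span_sum span_scale u_span) auto
      then show ?thesis by (simp add: diff)
    qed
    ultimately show ?thesis by blast
  qed
  have "i \<le> DIM('a) \<Longrightarrow> v ` {..<i} \<subseteq> span ?\<Delta>" for i
  proof (induction i)
    case (Suc i)
    then have IH: "span (v ` {..<i}) \<subseteq> span ?\<Delta>" by (intro span_minimal) auto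
    obtain d where d: "d \<in> ?\<Delta>" "d - v i \<in> span (v ` {..<i})" using step[of i] Suc.prems by auto
    have "d - (d - v i) \<in> span ?\<Delta>" by (rule span_diff[OF span_base[OF d(1)] subsetD[OF IH d(2)]])
    then have "v i \<in> span ?\<Delta>" by simp
    then show ?case using Suc by (simp add: lessThan_Suc)
  qed simp
  then have "span (v ` {..<DIM('a)}) \<subseteq> span ?\<Delta>" by (intro span_minimal) auto
  then have "span ?\<Delta> = UNIV" using span_all by auto
  then show ?thesis by (simp only: dim_eq_full)
qed

text \<open>Averages of one point from each chord fill a parallelepiped with edges (l k / d) u k.
  Its volume is \<open>ldet P\<close> times the product of the l k / d, and the lower bounds w / (d
  - k) on l k multiply to w^d / d!.\<close>

theorem volume_bound: "ennreal (ldet P * (w ^ DIM('a) / (fact DIM('a) * real DIM('a) ^ DIM('a)))) \<le> emeasure lborel (interior K)"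
proof -
  obtain U e where U: "linear U" "bij U" "bij_betw e {..<DIM('a)} (Basis :: 'a set)" "\<And>x. U x = (\<Sum>k<DIM('a). (x \<bullet> e k) *\<^sub>R u k)" "ldet U = ldet P"
    using ex_chord_coordinates by blast
  have eB: "e k \<in> Basis" if "k < DIM('a)" for k using U(3) that by (auto simp: bij_betw_def)
  have n0: "real DIM('a) > 0" using DIM_ge_1 by linarith
  define d where "d = (\<Sum>k<DIM('a). (l k / DIM('a)) *\<^sub>R e k)"
  have d: "d \<bullet> e k = l k / DIM('a)" if k: "k < DIM('a)" for k
  proof -
    have "d \<bullet> e k = (\<Sum>i<DIM('a). (l i / DIM('a)) * (e i \<bullet> e k))" by (simp add: d_def inner_sum_left)
    also have "\<dots> = (\<Sum>i<DIM('a). if i = k then l k / DIM('a) else 0)"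
      using U(3) k eB by (intro sum.cong) (auto simp: inner_Basis bij_betw_def inj_on_def)
    finally show ?thesis using k by simp
  qed
  define x0 where "x0 = (\<Sum>k<DIM('a). (1 / DIM('a)) *\<^sub>R a k)"
  have sub: "(\<lambda>x. x0 + 1 *\<^sub>R x) ` U ` box 0 d \<subseteq> K"
  proof clarify
    fix x assume x: "x \<in> box 0 d"
    \<comment> \<open>The point of the k-th chord whose share 1 / d in the average contributes
      exactly (x \<bullet> e k) u k.\<close>
    define y where "y k = (1 - DIM('a) * (x \<bullet> e k) / l k) *\<^sub>R a k + (DIM('a) * (x \<bullet> e k) / l k) *\<^sub>R b k" for k
    have yK: "y k \<in> K" if k: "k < DIM('a)" for k
    proof -
      have "0 < x \<bullet> e k" "x \<bullet> e k < l k / DIM('a)" using x eB[OF k] d[OF k] by (auto simp: mem_box)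
      then have "0 \<le> DIM('a) * (x \<bullet> e k) / l k" "DIM('a) * (x \<bullet> e k) / l k \<le> 1" using l_pos[OF k] n0 by (auto simp: field_simps)
      then show ?thesis unfolding y_def using ab[OF k] by (intro convexD[OF K(2)]) auto
    qed
    have "(\<Sum>k<DIM('a). (1 / DIM('a)) *\<^sub>R y k) \<in> K" using yK n0 by (intro convex_sum[OF _ K(2)]) auto
    moreover have "(\<Sum>k<DIM('a). (1 / DIM('a)) *\<^sub>R y k) = x0 + 1 *\<^sub>R U x"
      unfolding x0_def U(4) scaleR_one sum.distrib[symmetric]
    proof (rule sum.cong[OF refl])
      fix k
      have "y k = a k + (DIM('a) * (x \<bullet> e k) / l k) *\<^sub>R (b k - a k)" by (simp add: y_def algebra_simps)
      then have "(1 / DIM('a)) *\<^sub>R y k = (1 / DIM('a)) *\<^sub>R a k + ((1 / DIM('a)) * (DIM('a) * (x \<bullet> e k) / l k)) *\<^sub>R (b k - a k)" by (simp add: scaleR_add_right)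
      also have "(1 / DIM('a)) * (DIM('a) * (x \<bullet> e k) / l k) = (x \<bullet> e k) * (1 / l k)" using n0 by simp
      finally show "(1 / DIM('a)) *\<^sub>R y k = (1 / DIM('a)) *\<^sub>R a k + (x \<bullet> e k) *\<^sub>R u k" by (simp add: u_def)
    qed
    ultimately show "x0 + 1 *\<^sub>R U x \<in> K" by simp
  qed
  have bU: "U ` box 0 d \<in> sets borel" by (rule linear_image_borel[OF U(1,2)]) simp
  have "open (U ` box 0 d)" using open_surjective_linear_image[OF open_box U(1)] U(2) by (simp add: bij_is_surj)
  then have op: "open ((\<lambda>x. x0 + 1 *\<^sub>R x) ` U ` box 0 d)" using open_translation by auto
  have "ldet P * (w ^ DIM('a) / (fact DIM('a) * real DIM('a) ^ DIM('a))) \<le> ldet P * (\<Prod>k<DIM('a). l k / DIM('a))"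
  proof (intro mult_left_mono)
    have "fact DIM('a) = (\<Prod>k<DIM('a). real (DIM('a) - k))" by (simp add: fact_prod_rev atLeast0LessThan)
    then have "w ^ DIM('a) / (fact DIM('a) * real DIM('a) ^ DIM('a)) = (\<Prod>k<DIM('a). w / real (DIM('a) - k) / DIM('a))"
      unfolding prod_dividef by simp
    also have "\<dots> \<le> (\<Prod>k<DIM('a). l k / DIM('a))"
      using w n0 by (intro prod_mono conjI divide_right_mono l divide_nonneg_nonneg) auto
    finally show "w ^ DIM('a) / (fact DIM('a) * real DIM('a) ^ DIM('a)) \<le> (\<Prod>k<DIM('a). l k / DIM('a))" .
  qed simp
  then have "ennreal (ldet P * (w ^ DIM('a) / (fact DIM('a) * real DIM('a) ^ DIM('a)))) \<le> ennreal (ldet P) * ennreal (\<Prod>k<DIM('a). l k / DIM('a))"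
    by (metis ennreal_leI ennreal_mult' ldet_nonneg)
  also have "ennreal (\<Prod>k<DIM('a). l k / DIM('a)) = emeasure lborel (box 0 d)"
  proof -
    have "(\<Prod>c\<in>Basis. d \<bullet> c) = (\<Prod>k<DIM('a). l k / DIM('a))"
      using prod.reindex_bij_betw[OF U(3), of "\<lambda>c. d \<bullet> c"] d by simp
    moreover have "0 \<le> d \<bullet> c" if "c \<in> Basis" for c
    proof -
      obtain k where "k < DIM('a)" "c = e k" using U(3) \<open>c \<in> Basis\<close> by (auto simp: bij_betw_def)
      then show ?thesis using d[of k] l_pos[of k] by (simp add: less_imp_le)
    qed
    ultimately show ?thesis by (subst emeasure_lborel_box) auto
  qed
  also have "ennreal (ldet P) * emeasure lborel (box 0 d) = emeasure lborel (U ` box 0 d)"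
    using emeasure_ldet[OF U(1,2), of "box 0 d"] emeasure_lborel_box_finite[of 0 d] by (simp add: U(5))
  also have "\<dots> = emeasure lborel ((\<lambda>x. x0 + 1 *\<^sub>R x) ` U ` box 0 d)"
    by (subst emeasure_affine(2)[OF _ bU]) auto
  also have "\<dots> \<le> emeasure lborel (interior K)"
    using sub op by (intro emeasure_mono interior_maximal) auto
  finally show ?thesis .
qed

lemma finite_interior_lattice_points: "finite (M \<inter> interior K)"
  using compact_imp_bounded[OF K(1)] bounded_subset interior_subset by (blast intro: finite_M_bounded)

text \<open>The copy x1 + (1 - \<sigma>) int K of the interior is covered by the sets m - Fd with m
  an interior lattice point: adding a suitable element of the parallelepiped to any of its points
  gives such an m. Comparing volumes bounds the count from below by (1 - \<sigma>)^d times the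
  normalised volume, to which \<open>volume_bound\<close> applies.\<close>

theorem count_bound:
  assumes "w > (real DIM('a))\<^sup>2"
  shows "(w / DIM('a) - DIM('a)) ^ DIM('a) \<le> fact DIM('a) * real (card (M \<inter> interior K))"
proof -
  let ?A = "M \<inter> interior K" let ?\<sigma> = "\<Sum>k<DIM('a). 1 / l k"
  obtain U e where U: "linear U" "bij U" "bij_betw e {..<DIM('a)} (Basis :: 'a set)" "\<And>x. U x = (\<Sum>k<DIM('a). (x \<bullet> e k) *\<^sub>R u k)" "ldet U = ldet P"
    using ex_chord_coordinates by blast
  have n0: "real DIM('a) > 0" using DIM_ge_1 by linarith
  have eB: "e k \<in> Basis" if "k < DIM('a)" for k using U(3) that by (auto simp: bij_betw_def)
  have "(real DIM('a))\<^sup>2 / w < 1" using assms w by simp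
  then have s: "?\<sigma> < 1" using sum_inv_l' by linarith
  define x1 where "x1 = (\<Sum>k<DIM('a). (1 / l k) *\<^sub>R a k)"
  define Fd where "Fd = U ` slab Basis"
  have sb: "(slab Basis :: 'a set) \<in> sets borel" by (rule slab_borel) simp
  have Fb: "Fd \<in> sets borel" unfolding Fd_def by (rule linear_image_borel[OF U(1,2) sb])
  have eF: "emeasure lborel Fd = ennreal (ldet P)" unfolding Fd_def using emeasure_ldet[OF U(1,2) sb] by (simp add: emeasure_slab U(5))
  let ?X = "(\<lambda>y. x1 + (1 - ?\<sigma>) *\<^sub>R y) ` interior K"
  have sub: "?X \<subseteq> (\<Union>m\<in>?A. (\<lambda>f. m + (-1) *\<^sub>R f) ` Fd)"
  proof clarify
    fix y assume y: "y \<in> interior K"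
    define x where "x = x1 + (1 - ?\<sigma>) *\<^sub>R y"
    obtain t where t: "\<forall>k<DIM('a). 0 \<le> t k \<and> t k < 0 + 1" "x + (\<Sum>k<DIM('a). t k *\<^sub>R u k) \<in> M"
      using lattice_fit[of "DIM('a)" x "\<lambda>_. 0"] span_all by auto
    have "(1 - (\<Sum>k<DIM('a). 1 / l k)) *\<^sub>R y + (\<Sum>k<DIM('a). (1 / l k) *\<^sub>R a k) + (\<Sum>k<DIM('a). t k *\<^sub>R u k) \<in> interior K"
      using t(1) s by (intro interior_point[OF y, where \<nu>="\<lambda>_. 1"]) (auto simp: less_imp_le)
    then have "x + (\<Sum>k<DIM('a). t k *\<^sub>R u k) \<in> ?A" using t(2) by (simp add: x_def x1_def add_ac)
    moreover have "(\<Sum>k<DIM('a). t k *\<^sub>R u k) \<in> Fd"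
    proof -
      define p where "p = (\<Sum>k<DIM('a). t k *\<^sub>R e k)"
      have p: "p \<bullet> e k = t k" if k: "k < DIM('a)" for k
      proof -
        have "p \<bullet> e k = (\<Sum>i<DIM('a). t i * (e i \<bullet> e k))" by (simp add: p_def inner_sum_left)
        also have "\<dots> = (\<Sum>i<DIM('a). if i = k then t k else 0)"
          using U(3) k eB by (intro sum.cong) (auto simp: inner_Basis bij_betw_def inj_on_def)
        finally show ?thesis using k by simp
      qed
      have "0 \<le> p \<bullet> c \<and> p \<bullet> c < 1" if "c \<in> Basis" for c
      proof -
        obtain k where "k < DIM('a)" "c = e k" using U(3) \<open>c \<in> Basis\<close> by (auto simp: bij_betw_def)
        then show ?thesis using p[of k] t(1) by simp
      qed
      then have "p \<in> slab Basis" by (simp add: slab_def)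
      moreover have "U p = (\<Sum>k<DIM('a). t k *\<^sub>R u k)" unfolding U(4) by (rule sum.cong) (auto simp: p)
      ultimately show ?thesis unfolding Fd_def by (metis image_eqI)
    qed
    moreover have "x = (x + (\<Sum>k<DIM('a). t k *\<^sub>R u k)) + (-1) *\<^sub>R (\<Sum>k<DIM('a). t k *\<^sub>R u k)" by simp
    ultimately show "x1 + (1 - ?\<sigma>) *\<^sub>R y \<in> (\<Union>m\<in>?A. (\<lambda>f. m + (-1) *\<^sub>R f) ` Fd)"
      unfolding x_def[symmetric] by blast
  qed
  have eX: "emeasure lborel ?X = ennreal ((1 - ?\<sigma>) ^ DIM('a)) * emeasure lborel (interior K)"
    using emeasure_affine(2)[of "1 - ?\<sigma>" "interior K" x1] s by simp
  have "ennreal ((1 - ?\<sigma>) ^ DIM('a) * (ldet P * (w ^ DIM('a) / (fact DIM('a) * real DIM('a) ^ DIM('a))))) \<le> ennreal ((1 - ?\<sigma>) ^ DIM('a)) * emeasure lborel (interior K)"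
    using volume_bound s w by (subst ennreal_mult) (auto intro!: mult_left_mono)
  also have "\<dots> \<le> emeasure lborel (\<Union>m\<in>?A. (\<lambda>f. m + (-1) *\<^sub>R f) ` Fd)"
    unfolding eX[symmetric]
  proof (rule emeasure_mono[OF sub])
    show "(\<Union>m\<in>?A. (\<lambda>f. m + (-1) *\<^sub>R f) ` Fd) \<in> sets lborel"
      using finite_interior_lattice_points emeasure_affine(1)[of "-1", OF _ Fb] by (intro sets.finite_UN) auto
  qed
  also have "\<dots> \<le> (\<Sum>m\<in>?A. emeasure lborel ((\<lambda>f. m + (-1) *\<^sub>R f) ` Fd))"
    using finite_interior_lattice_points emeasure_affine(1)[of "-1", OF _ Fb] by (intro emeasure_subadditive_finite) auto
  also have "\<dots> = (\<Sum>m\<in>?A. ennreal (ldet P))"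
    by (intro sum.cong refl, subst emeasure_affine(2)[OF _ Fb]) (auto simp: eF)
  also have "\<dots> = ennreal (real (card ?A) * ldet P)" by (simp add: ennreal_mult ennreal_of_nat_eq_real_of_nat)
  finally have "(1 - ?\<sigma>) ^ DIM('a) * (ldet P * (w ^ DIM('a) / (fact DIM('a) * real DIM('a) ^ DIM('a)))) \<le> real (card ?A) * ldet P"
    by (simp add: ennreal_le_iff)
  moreover note ldP = ldet_pos
  ultimately have "ldet P * ((1 - ?\<sigma>) ^ DIM('a) * (w ^ DIM('a) / (fact DIM('a) * real DIM('a) ^ DIM('a)))) \<le> ldet P * real (card ?A)" by (simp add: mult_ac)
  then have "(1 - ?\<sigma>) ^ DIM('a) * (w ^ DIM('a) / (fact DIM('a) * real DIM('a) ^ DIM('a))) \<le> real (card ?A)"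
    by (rule mult_left_le_imp_le[OF _ ldP])
  then have "fact DIM('a) * ((1 - ?\<sigma>) ^ DIM('a) * (w ^ DIM('a) / (fact DIM('a) * real DIM('a) ^ DIM('a)))) \<le> fact DIM('a) * real (card ?A)" by (intro mult_left_mono) auto
  moreover have "fact DIM('a) * ((1 - ?\<sigma>) ^ DIM('a) * (w ^ DIM('a) / (fact DIM('a) * real DIM('a) ^ DIM('a)))) = ((1 - ?\<sigma>) * (w / DIM('a))) ^ DIM('a)"
    by (simp add: power_mult_distrib power_divide)
  moreover have "(w / DIM('a) - DIM('a)) ^ DIM('a) \<le> ((1 - ?\<sigma>) * (w / DIM('a))) ^ DIM('a)"
  proof (rule power_mono)
    \<comment> \<open>This is where the subtracted d comes from: (1 - \<sigma>) w / d loses at most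
      d^2 / d.\<close>
    have "?\<sigma> * w \<le> (real DIM('a))\<^sup>2" using sum_inv_l' w by (simp add: le_divide_eq)
    then have "w - (real DIM('a))\<^sup>2 \<le> (1 - ?\<sigma>) * w" by (simp add: algebra_simps)
    then have "(w - (real DIM('a))\<^sup>2) / DIM('a) \<le> (1 - ?\<sigma>) * w / DIM('a)" using n0 by (intro divide_right_mono) auto
    moreover have "(w - (real DIM('a))\<^sup>2) / DIM('a) = w / DIM('a) - DIM('a)" using n0 by (simp add: diff_divide_distrib power2_eq_square)
    ultimately show "w / DIM('a) - DIM('a) \<le> (1 - ?\<sigma>) * (w / DIM('a))" by simp
    have "real DIM('a) * real DIM('a) < w" using assms by (simp add: power2_eq_square)
    then show "0 \<le> w / DIM('a) - DIM('a)" using n0 by (simp add: le_divide_eq)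
  qed
  ultimately show ?thesis by linarith
qed

end

section \<open>From the locales back to lattice bases, widths and spanning sets\<close>

lemma group_closure_scale:
  fixes B :: "'a::real_vector set"
  assumes "s \<in> group_closure B" shows "of_int k *\<^sub>R s \<in> group_closure B"
proof (induction k rule: int_induct[where k=0])
  case base
  then show ?case by simp
next
  case (step1 i)
  then show ?case using assms by (simp add: scaleR_add_left group_closure_add)
next
  case (step2 i)
  then show ?case using assms by (simp add: scaleR_diff_left group_closure.diff)
qed

lemma group_closure_sum_scale:
  fixes f :: "'b \<Rightarrow> 'a::real_vector"
  assumes "finite I" "\<And>i. i \<in> I \<Longrightarrow> f i \<in> group_closure B"
  shows "(\<Sum>i\<in>I. of_int (k i) *\<^sub>R f i) \<in> group_closure B"
  using assms by (induction I rule: finite_induct) (auto intro!: group_closure_add group_closure_scale)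

lemma lattice_basis_iso:
  fixes B M :: "'a::euclidean_space set"
  assumes B: "lattice_basis B M"
  obtains P where "lattice_iso P M" "fundamental_parallelepiped B = P ` slab Basis"
proof -
  have ind: "independent B" and sp: "span B = UNIV" and M: "M = group_closure B" using B by (auto simp: lattice_basis_def)
  have finB: "finite B" using ind independent_imp_finite by blast
  have "card B = DIM('a)" using ind sp by (metis dim_UNIV dim_eq_card_independent dim_span)
  then obtain F where F: "bij_betw F (Basis :: 'a set) B" using finB by (metis bij_betw_iff_card finite_Basis)
  obtain P where P: "linear P" "\<And>x. x \<in> Basis \<Longrightarrow> P x = F x" using linear_independent_extend[OF independent_Basis] by blast
  have "P ` Basis = B" using F P(2) by (metis bij_betw_imp_surj_on image_cong)
  then have "surj P" using linear_span_image[OF P(1), of Basis] sp by simp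
  then have bij: "bij P" using linear_surjective_imp_injective[OF P(1)] by (simp add: bij_def)
  have PF: "P x = (\<Sum>b\<in>Basis. (x \<bullet> b) *\<^sub>R F b)" for x
  proof -
    have "P x = P (\<Sum>b\<in>Basis. (x \<bullet> b) *\<^sub>R b)" by (simp only: euclidean_representation)
    also have "\<dots> = (\<Sum>b\<in>Basis. (x \<bullet> b) *\<^sub>R F b)"
      unfolding linear_sum[OF P(1)] linear_scale[OF P(1)] by (rule sum.cong) (simp_all add: P(2))
    finally show ?thesis .
  qed
  have FB: "F b \<in> B" if "b \<in> Basis" for b using F that by (auto simp: bij_betw_def)
  interpret Q: lattice_iso P "P ` Zn" by (rule lattice_iso.intro[OF P(1) bij refl])
  have "M = P ` Zn"
  proof (rule equalityI)
    show "M \<subseteq> P ` Zn"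
    proof
      fix x assume "x \<in> M"
      then show "x \<in> P ` Zn" unfolding M
      proof induction
        case (base s)
        have "s \<in> P ` Zn" if "s \<in> B"
          using that \<open>P ` Basis = B\<close> Zn_Basis by blast
        then show ?case using base Q.M_0 by blast
      next
        case (diff s t)
        then show ?case using Q.M_diff by blast
      qed
    qed
    show "P ` Zn \<subseteq> M"
    proof clarify
      fix x :: 'a assume x: "x \<in> Zn"
      have "P x = (\<Sum>b\<in>Basis. of_int \<lfloor>x \<bullet> b\<rfloor> *\<^sub>R F b)"
        unfolding PF using x by (intro sum.cong) (auto simp: Zn_def)
      also have "\<dots> \<in> M" unfolding M using FB by (intro group_closure_sum_scale) (auto intro: group_closure.base)
      finally show "P x \<in> M" .
    qed
  qed
  moreover have "fundamental_parallelepiped B = P ` slab Basis"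
  proof (intro equalityI subsetI)
    fix x assume "x \<in> fundamental_parallelepiped B"
    then obtain c where c: "x = (\<Sum>b\<in>B. c b *\<^sub>R b)" "\<forall>b\<in>B. 0 \<le> c b \<and> c b < 1" by (auto simp: fundamental_parallelepiped_def)
    define y where "y = (\<Sum>b\<in>Basis. c (F b) *\<^sub>R b)"
    have y: "y \<bullet> b = c (F b)" if "b \<in> Basis" for b using that by (simp add: y_def inner_sum_left_Basis)
    have "P y = (\<Sum>b\<in>Basis. c (F b) *\<^sub>R F b)" unfolding PF by (rule sum.cong) (simp_all add: y)
    also have "\<dots> = x" unfolding c(1) by (rule sum.reindex_bij_betw[OF F])
    finally show "x \<in> P ` slab Basis" using c(2) FB by (intro image_eqI[of _ _ y]) (auto simp: slab_def y)
  next
    fix x assume "x \<in> P ` slab Basis"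
    then obtain y where y: "y \<in> slab Basis" "x = P y" by blast
    define c where "c b = y \<bullet> inv_into Basis F b" for b
    have cF: "c (F b) = y \<bullet> b" if "b \<in> Basis" for b using that F by (simp add: c_def bij_betw_def inv_into_f_f)
    have "x = (\<Sum>b\<in>Basis. c (F b) *\<^sub>R F b)" unfolding y(2) PF by (rule sum.cong) (simp_all add: cF)
    also have "\<dots> = (\<Sum>b\<in>B. c b *\<^sub>R b)" by (rule sum.reindex_bij_betw[OF F])
    finally have "x = (\<Sum>b\<in>B. c b *\<^sub>R b)" .
    moreover have "\<forall>b\<in>B. 0 \<le> c b \<and> c b < 1"
    proof
      fix b assume "b \<in> B"
      then have "inv_into Basis F b \<in> Basis" using F by (metis bij_betw_def inv_into_into)
      then show "0 \<le> c b \<and> c b < 1" using y(1) by (simp add: slab_def c_def)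
    qed
    ultimately show "x \<in> fundamental_parallelepiped B" by (auto simp: fundamental_parallelepiped_def)
  qed
  ultimately show ?thesis using that[of P] Q.lattice_iso_axioms by simp
qed

lemma interior_nonempty_full_dim:
  fixes S :: "'a::euclidean_space set"
  assumes "convex S" "dim_set S = DIM('a)"
  shows "interior S \<noteq> {}"
proof
  assume "interior S = {}"
  then obtain a b where ab: "a \<noteq> 0" "S \<subseteq> {x. a \<bullet> x = b}" using empty_interior_subset_hyperplane[OF assms(1)] by blast
  have "a \<bullet> x = b" if "x \<in> S" for x using that ab(2) by blast
  then have "differences S \<subseteq> {x. a \<bullet> x = 0}" by (auto simp: differences_def inner_diff_right)
  then have "dim_set S \<le> DIM('a) - 1" unfolding dim_set_def using dim_subset dim_hyperplane[OF ab(1)] by metis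
  then show False using assms(2) DIM_positive[where 'a='a] by linarith
qed

lemma lattice_width_le:
  fixes S :: "'a::euclidean_space set"
  assumes S: "compact S" "S \<noteq> {}" and \<phi>: "linear \<phi>" "\<And>m. m \<in> M \<Longrightarrow> \<phi> m \<in> \<int>" "\<exists>x. \<phi> x \<noteq> 0"
  shows "\<exists>a\<in>S. \<exists>b\<in>S. lattice_width M S \<le> \<phi> b - \<phi> a"
proof -
  have cont: "continuous_on S \<psi>" if "linear \<psi>" for \<psi> :: "'a \<Rightarrow> real"
    using that by (intro linear_continuous_on) (simp add: linear_linear)
  have "lattice_width M S \<le> Sup (\<phi> ` S) - Inf (\<phi> ` S)"
    unfolding lattice_width_def
  proof (rule cINF_lower)
    show "\<phi> \<in> lattice_dual M - {\<lambda>_. 0}" using \<phi> by (auto simp: lattice_dual_def)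
    \<comment> \<open>An infimum of reals is a lower bound only for sets bounded below; 0 serves, as
      no width is negative.\<close>
    show "bdd_below ((\<lambda>\<phi>. Sup (\<phi> ` S) - Inf (\<phi> ` S)) ` (lattice_dual M - {\<lambda>_. 0}))"
    proof (rule bdd_belowI2)
      fix \<psi> assume "\<psi> \<in> lattice_dual M - {\<lambda>_. 0}"
      then have "linear \<psi>" by (simp add: lattice_dual_def)
      then have "bounded (\<psi> ` S)" using compact_continuous_image[OF cont S(1)] compact_imp_bounded by blast
      then have "Inf (\<psi> ` S) \<le> Sup (\<psi> ` S)"
        using S(2) by (intro cInf_le_cSup) (auto intro: bounded_imp_bdd_above bounded_imp_bdd_below)
      then show "0 \<le> Sup (\<psi> ` S) - Inf (\<psi> ` S)" by simp
    qed
  qed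
  moreover obtain b where b: "b \<in> S" "\<And>x. x \<in> S \<Longrightarrow> \<phi> x \<le> \<phi> b" using continuous_attains_sup[OF S cont[OF \<phi>(1)]] by blast
  moreover obtain a where a: "a \<in> S" "\<And>x. x \<in> S \<Longrightarrow> \<phi> a \<le> \<phi> x" using continuous_attains_inf[OF S cont[OF \<phi>(1)]] by blast
  moreover have "Sup (\<phi> ` S) \<le> \<phi> b" using S(2) b by (intro cSup_least) auto
  moreover have "\<phi> a \<le> Inf (\<phi> ` S)" using S(2) a by (intro cInf_greatest) auto
  ultimately have "lattice_width M S \<le> \<phi> b - \<phi> a" by linarith
  then show ?thesis using a(1) b(1) by blast
qed

text \<open>The sets \<open>m - (1/2) int K\<close> with \<open>m\<close> in a fixed coset of \<open>G\<close> are disjoint from those of another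
  coset, because all of them meet only such \<open>m' + (1/2) int K\<close> for which \<open>m - m'\<close> lies in \<open>M \<inter> int K\<close>;
  connectedness of the whole space then leaves a single coset.\<close>

lemma (in lattice_iso) spans_lattice_if_covering:
  assumes K: "convex K" and cover: "\<And>x. \<exists>m\<in>M. \<exists>y\<in>interior K. m = x + (1/2) *\<^sub>R y"
  shows "spans_lattice (M \<inter> interior K) M"
proof -
  let ?A = "M \<inter> interior K"
  define G where "G = group_closure (differences ?A)"
  have GM: "G \<subseteq> M"
  proof
    fix x assume "x \<in> G"
    then show "x \<in> M" unfolding G_def
    proof induction
      case (base s)
      then show ?case using M_0 M_diff by (auto simp: differences_def)
    next
      case (diff s t)
      then show ?case using M_diff by blast
    qed
  qed
  have same: "m1 - m2 \<in> G" if m: "m1 \<in> M" "m2 \<in> M" "m1 - x \<in> (*\<^sub>R) (1/2) ` interior K" "m2 - x \<in> (*\<^sub>R) (1/2) ` interior K" for m1 m2 x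
  proof -
    \<comment> \<open>Covering is applied to -x: then x + m0 lies in half the interior as well, so m
      + m0 is the midpoint of two interior points, for every admissible m with the same m0. The
      differences m1 - m2 are therefore differences of interior lattice points.\<close>
    obtain m0 y where y: "m0 \<in> M" "y \<in> interior K" "m0 = - x + (1/2) *\<^sub>R y" using cover by blast
    have "m + m0 \<in> ?A" if mM: "m \<in> M" and mx: "m - x \<in> (*\<^sub>R) (1/2) ` interior K" for m
    proof -
      obtain z where z: "z \<in> interior K" "m - x = (1/2) *\<^sub>R z" using mx by blast
      have "(1/2) *\<^sub>R z + (1/2) *\<^sub>R y \<in> interior K"
        using convexD[OF convex_interior[OF K] z(1) y(2), of "1/2" "1/2"] by simp
      moreover have "m + m0 = (1/2) *\<^sub>R z + (1/2) *\<^sub>R y" unfolding z(2)[symmetric] y(3) by simp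
      ultimately show ?thesis using M_add[OF mM y(1)] by simp
    qed
    then have "(m1 + m0) - (m2 + m0) \<in> differences ?A" using m unfolding differences_def by blast
    then show ?thesis unfolding G_def by (intro group_closure.base) simp
  qed
  define T where "T N = (\<Union>m\<in>N. (\<lambda>y. m + (-1/2) *\<^sub>R y) ` interior K)" for N
  have memT: "x \<in> T N \<longleftrightarrow> (\<exists>m\<in>N. m - x \<in> (*\<^sub>R) (1/2) ` interior K)" for x N
  proof -
    have "x \<in> (\<lambda>y. m + (-1/2) *\<^sub>R y) ` interior K \<longleftrightarrow> m - x \<in> (*\<^sub>R) (1/2) ` interior K" for m
      by (auto simp: image_iff algebra_simps)
    then show ?thesis unfolding T_def by blast
  qed
  have opT: "open (T N)" for N
  proof -
    have "open ((\<lambda>y. m + (-1/2) *\<^sub>R y) ` interior K)" for m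
      using open_translation[OF open_scaling[of "-1/2", OF _ open_interior[of K]], of m] by (simp add: image_image)
    then show ?thesis unfolding T_def by blast
  qed
  obtain m0 y0 where m0: "m0 \<in> M" "y0 \<in> interior K" "m0 = 0 + (1/2) *\<^sub>R y0" using cover by blast
  let ?N = "{m \<in> M. m - m0 \<in> G}" let ?N' = "{m \<in> M. m - m0 \<notin> G}"
  have "T ?N \<union> T ?N' = UNIV"
  proof (intro equalityI subsetI)
    fix x :: 'a
    obtain m y where "m \<in> M" "y \<in> interior K" "m = x + (1/2) *\<^sub>R y" using cover by blast
    then have "m \<in> M" "m - x \<in> (*\<^sub>R) (1/2) ` interior K" by auto
    then show "x \<in> T ?N \<union> T ?N'" unfolding Un_iff memT by blast
  qed simp
  moreover have "T ?N \<inter> T ?N' = {}"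
  proof (rule ccontr)
    assume "T ?N \<inter> T ?N' \<noteq> {}"
    then obtain x m m' where m: "m \<in> ?N" "m' \<in> ?N'" "m - x \<in> (*\<^sub>R) (1/2) ` interior K" "m' - x \<in> (*\<^sub>R) (1/2) ` interior K"
      unfolding disjoint_iff memT by blast
    then have "m' - m \<in> G" using same[of m' m x] by blast
    then have "(m' - m) + (m - m0) \<in> G" using m(1) unfolding G_def by (intro group_closure_add) auto
    then show False using m(2) by simp
  qed
  moreover have "m0 \<in> ?N" using m0(1) by (simp add: G_def)
  then have "0 \<in> T ?N" unfolding memT using m0 by (intro bexI[of _ m0]) auto
  ultimately have T0: "T ?N' = {}"
    using connectedD[OF connected_UNIV opT opT, of ?N ?N'] by blast
  have "M \<subseteq> ?N"
  proof
    fix m assume m: "m \<in> M"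
    show "m \<in> ?N"
    proof (rule ccontr)
      assume "m \<notin> ?N"
      then have "m \<in> ?N'" using m by blast
      \<comment> \<open>Any interior point shows that the set belonging to m is nonempty;
        \<open>y0\<close> is at hand.\<close>
      then have "m - (1/2) *\<^sub>R y0 \<in> T ?N'" unfolding memT using m0(2) by (intro bexI[of _ m]) auto
      then show False using T0 by blast
    qed
  qed
  have "M \<subseteq> G"
  proof
    fix m assume m: "m \<in> M"
    have "0 - m0 \<in> G" "m - m0 \<in> G" using \<open>M \<subseteq> ?N\<close> M_0 m by blast+
    then have "(m - m0) - (0 - m0) \<in> G" unfolding G_def by (rule group_closure.diff[rotated])
    then show "m \<in> G" by simp
  qed
  then show ?thesis using GM by (auto simp: spans_lattice_def G_def)
qed

theorem theorem5p2:
  fixes M B S :: "'a::euclidean_space set" and d :: nat and w :: real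
  assumes "d = DIM('a)"
    and "lattice_basis B M"
    and "compact S" and "convex S" and "dim_set S = d"
    and "w = lattice_width M S"
  shows "(w > real d ^ 2 \<longrightarrow> M \<inter> interior S \<noteq> {}) \<and>
    (w > real d * (real d + 1) \<longrightarrow> dim_set (M \<inter> interior S) = d) \<and>
    (w > 2 * real d ^ 2 \<longrightarrow> spans_lattice (M \<inter> interior S) M) \<and>
    root d (fact d * real (card (M \<inter> interior S))) \<ge> w / real d - real d \<and>
    root d (fact d * lattice_volume B S) \<ge> w / real d"
proof (cases "w > 0")
  \<comment> \<open>Here every premise of the implications fails and both lower bounds are
    nonpositive.\<close>
  case False
  have d: "real d > 0" using assms(1) by simp
  have "w / d \<le> 0" using False d by (simp add: divide_nonpos_pos)
  moreover have "0 \<le> root d (fact d * real (card (M \<inter> interior S)))" by (intro real_root_ge_zero) simp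
  moreover have "0 \<le> root d (fact d * lattice_volume B S)" by (intro real_root_ge_zero) (simp add: lattice_volume_def)
  moreover have "0 \<le> real d ^ 2" "0 \<le> real d * (real d + 1)" by simp_all
  ultimately show ?thesis using False d by (intro conjI impI) linarith+
next
  case w: True
  have d: "d > 0" using assms(1) by simp
  obtain P where Piso: "lattice_iso P M" "fundamental_parallelepiped B = P ` slab Basis" using lattice_basis_iso[OF assms(2)] by blast
  interpret lattice_iso P M by (rule Piso(1))
  have int: "interior S \<noteq> {}" using interior_nonempty_full_dim assms by blast
  then have "S \<noteq> {}" by auto
  interpret lattice_convex P M S w
    by unfold_locales (use assms int w lattice_width_le[OF assms(3) \<open>S \<noteq> {}\<close>] in auto)
  obtain v :: "nat \<Rightarrow> 'a" where v: "inj_on v {..<DIM('a)}" "independent (v ` {..<DIM('a)})" "v ` {..<DIM('a)} \<subseteq> M"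
      "M \<inter> span (v ` {..<DIM('a)}) \<subseteq> zspan (v ` {..<DIM('a)})"
    and ch: "\<forall>k<DIM('a). \<exists>l\<ge>w / real (DIM('a) - k). \<exists>c\<in>{b - a |b a. b \<in> S \<and> a \<in> S}. c - l *\<^sub>R v k \<in> span (v ` {..<k})"
    using lattice_body.chain[OF lattice_body order_refl] by blast
  have "\<forall>k. \<exists>a b l. k < DIM('a) \<longrightarrow> a \<in> S \<and> b \<in> S \<and> w / real (DIM('a) - k) \<le> l \<and> b - a - l *\<^sub>R v k \<in> span (v ` {..<k})"
  proof
    fix k
    show "\<exists>a b l. k < DIM('a) \<longrightarrow> a \<in> S \<and> b \<in> S \<and> w / real (DIM('a) - k) \<le> l \<and> b - a - l *\<^sub>R v k \<in> span (v ` {..<k})"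
    proof (cases "k < DIM('a)")
      case True
      then obtain l c where l: "w / real (DIM('a) - k) \<le> l" "c \<in> {b - a |b a. b \<in> S \<and> a \<in> S}" "c - l *\<^sub>R v k \<in> span (v ` {..<k})"
        using ch by blast
      then obtain a b where "a \<in> S" "b \<in> S" "c = b - a" by blast
      then show ?thesis using l by blast
    qed simp
  qed
  then obtain a b l where abl: "\<And>k. k < DIM('a) \<Longrightarrow> a k \<in> S \<and> b k \<in> S \<and> w / real (DIM('a) - k) \<le> l k \<and> b k - a k - l k *\<^sub>R v k \<in> span (v ` {..<k})"
    by metis
  interpret chain_body P M S w v a b l
    by unfold_locales (use v abl in auto)
  have a: "M \<inter> interior S \<noteq> {}" if "w > real d ^ 2" using interior_lattice_point that assms(1) by simp
  have b: "dim_set (M \<inter> interior S) = d" if "w > real d * (real d + 1)"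
  proof -
    have "differences (M \<inter> interior S) = {p - q |p q. p \<in> M \<inter> interior S \<and> q \<in> M \<inter> interior S}"
      unfolding differences_def by blast
    then show ?thesis unfolding dim_set_def using dim_interior_lattice_points that assms(1) by simp
  qed
  have c: "spans_lattice (M \<inter> interior S) M" if "w > 2 * real d ^ 2"
    by (rule spans_lattice_if_covering[OF assms(4) half_interior_covering]) (use that assms(1) in simp)
  have d_part: "w / d - d \<le> root d (fact d * real (card (M \<inter> interior S)))"
  proof (cases "w > real d ^ 2")
    case True
    have "real d * real d < w" using True by (simp add: power2_eq_square)
    then have "0 \<le> w / d - d" using d by (simp add: le_divide_eq)
    then have "w / d - d = root d ((w / d - d) ^ d)" using d by (simp add: real_root_power_cancel)
    also have "\<dots> \<le> root d (fact d * real (card (M \<inter> interior S)))"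
      using count_bound True d assms(1) by (intro real_root_le_mono) auto
    finally show ?thesis .
  next
    case False
    then have "w / d - d \<le> 0" using d by (simp add: divide_le_eq power2_eq_square)
    also have "0 \<le> root d (fact d * real (card (M \<inter> interior S)))" by (intro real_root_ge_zero) simp
    finally show ?thesis .
  qed
  have e_part: "w / d \<le> root d (fact d * lattice_volume B S)"
  proof -
    have sb: "(slab Basis :: 'a set) \<in> sets borel" by (rule slab_borel) simp
    have Fb: "P ` slab Basis \<in> sets borel" using linear_image_borel[OF P sb] .
    have eF: "emeasure lborel (P ` slab Basis) = ennreal (ldet P)"
      using emeasure_ldet[OF P sb] by (simp add: emeasure_slab)
    have mF: "measure lebesgue (fundamental_parallelepiped B) = ldet P"
      unfolding Piso(2) using Fb eF by (simp add: measure_completion measure_def)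
    have "emeasure lborel (interior S) \<le> emeasure lborel S"
      using assms(3) by (intro emeasure_mono interior_subset) (simp add: compact_imp_closed)
    also have "\<dots> = ennreal (measure lborel S)"
      using emeasure_compact_finite[OF assms(3)] by (intro emeasure_eq_ennreal_measure) auto
    also have "measure lborel S = measure lebesgue S"
      using assms(3) by (intro measure_completion[symmetric]) (simp add: compact_imp_closed)
    finally have "ennreal (ldet P * (w ^ d / (fact d * real d ^ d))) \<le> ennreal (measure lebesgue S)"
      using volume_bound assms(1) by (metis order_trans)
    then have "ldet P * (w ^ d / (fact d * real d ^ d)) \<le> measure lebesgue S" by (simp add: ennreal_le_iff)
    then have "w ^ d / (fact d * real d ^ d) \<le> lattice_volume B S"
      unfolding lattice_volume_def mF using ldet_pos by (simp add: le_divide_eq mult.commute)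
    then have "fact d * (w ^ d / (fact d * real d ^ d)) \<le> fact d * lattice_volume B S" by (intro mult_left_mono) auto
    moreover have "fact d * (w ^ d / (fact d * real d ^ d)) = (w / d) ^ d" by (simp add: power_divide)
    ultimately have "root d ((w / d) ^ d) \<le> root d (fact d * lattice_volume B S)" using d by (intro real_root_le_mono) auto
    then show ?thesis using d w by (simp add: real_root_power_cancel)
  qed
  show ?thesis using a b c d_part e_part by blast
qed

end
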